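(* In the setting and notation of the context, assume that admissible contours exist for both $l=+1$ and $l=-1$, and let $l\in\{+1,-1\}$. For $\varkappa=\triangleright,\triangleleft$ let $X_\varkappa^{(l)}\in\mathcal B(\mathcal H_A)$ be the solution (the same for all admissible contours $\Gamma_l$) of $X=V^\varkappa_{\Gamma_l}(\widetilde A+X)$ with $\|X_\varkappa^{(l)}\|\le r_0^{(l)}(K)$, and put $Z_\varkappa^{(l)}=\widetilde A+X_\varkappa^{(l)}$. Then the spectra $\sigma(Z^{(l)}_{\triangleright})$ and $\sigma(Z^{(l)}_{\triangleleft})$ coincide and are contained in $$\{z\in\mathbb C:\operatorname{dist}(z,\nu(\widetilde A))\le r_0^{(l)}(K)\}.$$ Moreover, for any admissible contour $\Gamma_l$, $$\sigma\big(M_{\Gamma_l}(\cdot)\big)\cap\mathcal O(\widetilde A,\Gamma_l)=\sigma(Z^{(l)}_{\triangleright})=\sigma(Z^{(l)}_{\triangleleft}),$$ where $$\mathcal O(\widetilde A,\Gamma_l)=\big\{z\in\mathbb C:\operatorname{dist}(z,\nu(\widetilde A))\le \tfrac12d(\Gamma_l)[1-\operatorname{Var}_{\widetilde A}(K,\Gamma_l)]\big\}.$$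
   Context: **Operators.** $\mathcal H_A,\mathcal H_C$ are separable Hilbert spaces; $\mathcal B(\cdot)$ denotes bounded operators. $C$ is a (possibly unbounded) self-adjoint operator in $\mathcal H_C$ with $C\ge\lambda_C>0$, whose spectrum is absolutely continuous and equals $[\lambda_C,+\infty)$. $A\in\mathcal B(\mathcal H_A)$ is not necessarily self-adjoint. $D$ is a densely defined closable operator from $\operatorname{dom}(D)\subset\mathcal H_A$ to $\mathcal H_C$ such that $C^{-1/2}D$ extends to a bounded operator $\widetilde D=\overline{C^{-1/2}D}\in\mathcal B(\mathcal H_A,\mathcal H_C)$. $B$ is a densely defined closable operator from $\operatorname{dom}(B)\subset\mathcal H_C$ to $\mathcal H_A$ with $\operatorname{dom}(B)\supset\operatorname{dom}(C^{1/2})$; then $\widetilde B=BC^{-1/2}\in\mathcal B(\mathcal H_C,\mathcal H_A)$. Put $\widetilde A=A-\widetilde B\widetilde D$. **Numerical range.** $\nu(\widetilde A)=\overline{\{\langle\widetilde Ax,x\rangle: x\in\mathcal H_A,\ \|x\|=1\}}$ is assumed to lie in $\mathcal O_\eta([\alpha_1,\alpha_2])=\{z\in\mathbb C:\operatorname{dist}(z,[\alpha_1,\alpha_2])\le\eta\}$ for some $\eta>0$ and real $\alpha_1<\alpha_2$ with $\alpha_1-\eta>\lambda_C$. **The function $K$.** Let $\{E_C(\mu)\}_{\mu\in\mathbb R}$ be the spectral family of $C$ and $K(\mu)=\widetilde BE_C(\mu)\widetilde D$. It is assumed that $K$ is continuously differentiable on $(\lambda_C,+\infty)$ in the operator norm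 topology and that it admits an analytic continuation (again denoted $K$, with derivative $K'$) from $(\lambda_C,\beta)$, where $\beta>\alpha_2+\eta$, to a simply connected domain $\mathcal D\subset\mathbb C$ with $\mathcal D\supset\mathcal O_\eta([\alpha_1,\alpha_2])$; that at the points $\lambda=\lambda_C$ and $\lambda=\beta$ it satisfies $\|K'(\mu)\|\le c|\mu-\lambda|^\gamma$, $\mu\in\mathcal D$, with some $c>0$, $\gamma\in(-1,0]$; and that $\int_\beta^\infty(1+|\mu|)^{-1}\|K'(\mu)\|\,d\mu<\infty$. **Contours.** $\mathcal D^{(\pm1)}=\mathcal D\cap\mathbb C^{\pm}$ (open upper/lower half-planes). For $l=\pm1$ we consider contours $\Gamma_l=\widetilde\Gamma_l\cup[\beta,+\infty)$, where $\widetilde\Gamma_l$ is a rectifiable Jordan curve in $\mathcal D^{(l)}$ resulting from continuous deformation of the interval $(\lambda_C,\beta)$ with the end points kept fixed; $\Gamma_l$ is traversed from $\lambda_C$ to $+\infty$. **Transfer function.** $M_{\Gamma_l}(z)=\widetilde A-z+V_{\Gamma_l}(z)$, $V_{\Gamma_l}(z)=\int_{\Gamma_l}d\mu\,K'(\mu)\frac{z}{z-\mu}$, for $z\in\mathbb C\setminus\Gamma_l$. A point $z\in\mathbb C\setminus\Gamma_l$ belongs to $\sigma(M_{\Gamma_l}(\cdot))$ iff $M_{\Gamma_l}(z)$ has no bounded inverse in $\mathcal B(\mathcal H_A)$. (For admissible $\Gamma_l$ the set $\mathcal O(\widetilde A,\Gamma_l)$ does not meet $\Gamma_l$.) **Transformations.**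 For $Z\in\mathcal B(\mathcal H_A)$ with spectrum satisfying $\operatorname{dist}(\sigma(Z),\Gamma_l)>0$, $$V^{\triangleright}_{\Gamma_l}(Z)=\int_{\Gamma_l}d\mu\,K'(\mu)Z(Z-\mu)^{-1},\qquad V^{\triangleleft}_{\Gamma_l}(Z)=\int_{\Gamma_l}Z(Z-\mu)^{-1}K'(\mu)\,d\mu.$$ **Admissible contours.** Put $d(\Gamma_l)=\operatorname{dist}(\nu(\widetilde A),\Gamma_l)$ and $\operatorname{Var}_{\widetilde A}(K,\Gamma_l)=\int_{\Gamma_l}|d\mu|\frac{\|K'(\mu)\|}{\operatorname{dist}(\mu,\nu(\widetilde A))}$. A contour $\Gamma_l=\widetilde\Gamma_l\cup[\beta,+\infty)$, with $\widetilde\Gamma_l$ a rectifiable Jordan curve in $\mathcal D^{(l)}$ resulting from continuous deformation of $(\lambda_C,\beta)$ with the end points kept fixed, is admissible if $d(\Gamma_l)>0$, $\operatorname{Var}_{\widetilde A}(K,\Gamma_l)<1$ and $\operatorname{Var}_{\widetilde A}(K,\Gamma_l)\|\widetilde A\|<\frac14d(\Gamma_l)[1-\operatorname{Var}_{\widetilde A}(K,\Gamma_l)]^2$. **Radii.** For admissible $\Gamma_l$, $$r_{\min}(\Gamma_l)=\tfrac12d(\Gamma_l)[1-\operatorname{Var}_{\widetilde A}(K,\Gamma_l)]-\sqrt{\tfrac14d(\Gamma_l)^2[1-\operatorname{Var}_{\widetilde A}(K,\Gamma_l)]^2-d(\Gamma_l)\operatorname{Var}_{\widetilde A}(K,\Gamma_l)\|\widetilde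 A\|},$$ and $r_0^{(l)}(K)=\inf\{r_{\min}(\Gamma_l):\Gamma_l\text{ admissible}\}$. The solution of $X=V^\varkappa_{\Gamma_l}(\widetilde A+X)$ with $\|X\|\le r_0^{(l)}(K)$ is unique and is the same for all admissible contours $\Gamma_l$ with the given $l$. *)

theory Defs
  imports "HOL-Analysis.Analysis"
begin

section \<open>Complex Hilbert spaces\<close>

text \<open>The inner product is linear in the first argument. Separability is expressed separately, by
  the sort \<open>second_countable_topology\<close>.\<close>

class complex_hilbert = banach +
  fixes scaleC :: "complex \<Rightarrow> 'a \<Rightarrow> 'a"  (infixr "*\<^sub>C" 75)
    and cinner :: "'a \<Rightarrow> 'a \<Rightarrow> complex"
  assumes scaleC_add_right: "c *\<^sub>C (x + y) = c *\<^sub>C x + c *\<^sub>C y"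
    and scaleC_add_left: "(b + c) *\<^sub>C x = b *\<^sub>C x + c *\<^sub>C x"
    and scaleC_scaleC: "b *\<^sub>C c *\<^sub>C x = (b * c) *\<^sub>C x"
    and scaleC_of_real: "complex_of_real r *\<^sub>C x = r *\<^sub>R x"
    and cinner_commute: "cinner x y = cnj (cinner y x)"
    and cinner_add_left: "cinner (x + y) z = cinner x z + cinner y z"
    and cinner_scaleC_left: "cinner (c *\<^sub>C x) y = c * cinner x y"
    and cinner_nonneg: "0 \<le> Re (cinner x x)"
    and cinner_eq_0_iff: "cinner x x = 0 \<longleftrightarrow> x = 0"
    and norm_eq_sqrt_cinner: "norm x = sqrt (Re (cinner x x))"

instantiation complex :: complex_hilbert
begin
definition "scaleC c (x::complex) = c * x"
definition "cinner x (y::complex) = x * cnj y"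
instance
proof
  fix x :: complex
  show "norm x = sqrt (Re (cinner x x))"
    by (simp add: cinner_complex_def cmod_def power2_eq_square)
qed (simp_all add: scaleC_complex_def cinner_complex_def ring_distribs scaleR_conv_of_real mult.commute)
end

section \<open>Bounded operators\<close>

text \<open>The library type \<open>'a \<Rightarrow>\<^sub>L 'b\<close> consists of the bounded real-linear maps; the space
  $\mathcal B(\mathcal H_1,\mathcal H_2)$ is the subset of the complex-linear ones.\<close>

definition bop :: "('a::complex_hilbert \<Rightarrow>\<^sub>L 'b::complex_hilbert) \<Rightarrow> bool" where
  "bop T \<longleftrightarrow> (\<forall>c x. T (c *\<^sub>C x) = c *\<^sub>C T x)"

definition scalar_op :: "complex \<Rightarrow> 'a::complex_hilbert \<Rightarrow>\<^sub>L 'a" where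
  "scalar_op z = Blinfun (\<lambda>x. z *\<^sub>C x)"

definition scale_op :: "complex \<Rightarrow> ('a::complex_hilbert \<Rightarrow>\<^sub>L 'a) \<Rightarrow> 'a \<Rightarrow>\<^sub>L 'a" where
  "scale_op z T = scalar_op z o\<^sub>L T"

definition is_op_inverse :: "('a::complex_hilbert \<Rightarrow>\<^sub>L 'a) \<Rightarrow> ('a \<Rightarrow>\<^sub>L 'a) \<Rightarrow> bool" where
  "is_op_inverse T S \<longleftrightarrow> bop S \<and> S o\<^sub>L T = id_blinfun \<and> T o\<^sub>L S = id_blinfun"

definition op_inverse :: "('a::complex_hilbert \<Rightarrow>\<^sub>L 'a) \<Rightarrow> 'a \<Rightarrow>\<^sub>L 'a" where
  "op_inverse T = (THE S. is_op_inverse T S)"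

definition op_spectrum :: "('a::complex_hilbert \<Rightarrow>\<^sub>L 'a) \<Rightarrow> complex set" where
  "op_spectrum T = {z. \<not> (\<exists>S. is_op_inverse (T - scalar_op z) S)}"

text \<open>The closure of the set of values of the quadratic form on the unit sphere.\<close>

definition numrange :: "('a::complex_hilbert \<Rightarrow>\<^sub>L 'a) \<Rightarrow> complex set" where
  "numrange T = closure {cinner (T x) x | x. norm x = 1}"

text \<open>Complex differentiation of operator-valued functions in the operator norm.\<close>

definition has_op_derivative ::
    "(complex \<Rightarrow> ('a::complex_hilbert \<Rightarrow>\<^sub>L 'a)) \<Rightarrow> ('a \<Rightarrow>\<^sub>L 'a) \<Rightarrow> complex \<Rightarrow> bool" where
  "has_op_derivative F L z \<longleftrightarrow> ((\<lambda>w. scale_op (inverse (w - z)) (F w - F z)) \<longlongrightarrow> L) (at z)"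

definition op_deriv ::
    "(complex \<Rightarrow> ('a::complex_hilbert \<Rightarrow>\<^sub>L 'a)) \<Rightarrow> complex \<Rightarrow> ('a \<Rightarrow>\<^sub>L 'a)" where
  "op_deriv F z = (THE L. has_op_derivative F L z)"

section \<open>Unbounded operators, represented by a domain and a function\<close>

definition csubspace :: "'a::complex_hilbert set \<Rightarrow> bool" where
  "csubspace S \<longleftrightarrow> 0 \<in> S \<and> (\<forall>x\<in>S. \<forall>y\<in>S. x + y \<in> S) \<and> (\<forall>c. \<forall>x\<in>S. c *\<^sub>C x \<in> S)"

definition clinear_on ::
    "'a::complex_hilbert set \<Rightarrow> ('a \<Rightarrow> 'b::complex_hilbert) \<Rightarrow> bool" where
  "clinear_on S T \<longleftrightarrow> csubspace S \<and> (\<forall>x\<in>S. \<forall>y\<in>S. T (x + y) = T x + T y) \<and>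
     (\<forall>c. \<forall>x\<in>S. T (c *\<^sub>C x) = c *\<^sub>C T x)"

definition densely_defined ::
    "'a::complex_hilbert set \<Rightarrow> ('a \<Rightarrow> 'b::complex_hilbert) \<Rightarrow> bool" where
  "densely_defined S T \<longleftrightarrow> clinear_on S T \<and> closure S = UNIV"

definition closable ::
    "'a::complex_hilbert set \<Rightarrow> ('a \<Rightarrow> 'b::complex_hilbert) \<Rightarrow> bool" where
  "closable S T \<longleftrightarrow> (\<forall>u y. (\<forall>n::nat. u n \<in> S) \<and> u \<longlonglongrightarrow> 0 \<and> (\<lambda>n. T (u n)) \<longlonglongrightarrow> y \<longrightarrow> y = 0)"

text \<open>The graph of the adjoint coincides with the graph of the operator.\<close>

definition selfadjoint :: "'a::complex_hilbert set \<Rightarrow> ('a \<Rightarrow> 'a) \<Rightarrow> bool" where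
  "selfadjoint S T \<longleftrightarrow> densely_defined S T \<and>
     (\<forall>y w. (\<forall>x\<in>S. cinner (T x) y = cinner x w) \<longleftrightarrow> y \<in> S \<and> w = T y)"

definition unbounded_spectrum :: "'a::complex_hilbert set \<Rightarrow> ('a \<Rightarrow> 'a) \<Rightarrow> complex set" where
  "unbounded_spectrum S T = {z. \<not> (\<exists>R :: 'a \<Rightarrow>\<^sub>L 'a. bop R \<and>
     (\<forall>x. R x \<in> S \<and> T (R x) - z *\<^sub>C R x = x) \<and> (\<forall>x\<in>S. R (T x - z *\<^sub>C x) = x))}"

section \<open>Spectral families\<close>

text \<open>Spectral families are normalized to be strongly continuous from the right.\<close>

definition spectral_family :: "(real \<Rightarrow> ('a::complex_hilbert \<Rightarrow>\<^sub>L 'a)) \<Rightarrow> bool" where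
  "spectral_family E \<longleftrightarrow> (\<forall>m. bop (E m)) \<and>
     (\<forall>m x y. cinner (E m x) y = cinner x (E m y)) \<and>
     (\<forall>m n. E m o\<^sub>L E n = E (min m n)) \<and>
     (\<forall>x m. ((\<lambda>n. E n x) \<longlongrightarrow> E m x) (at_right m)) \<and>
     (\<forall>x. ((\<lambda>n. E n x) \<longlongrightarrow> 0) at_bot) \<and>
     (\<forall>x. ((\<lambda>n. E n x) \<longlongrightarrow> x) at_top)"

text \<open>The Lebesgue-Stieltjes measure $d\langle E(\mu)x,x\rangle$.\<close>

definition spectral_measure ::
    "(real \<Rightarrow> ('a::complex_hilbert \<Rightarrow>\<^sub>L 'a)) \<Rightarrow> 'a \<Rightarrow> real measure" where
  "spectral_measure E x = interval_measure (\<lambda>m. Re (cinner (E m x) x))"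

definition spectral_dom ::
    "(real \<Rightarrow> ('a::complex_hilbert \<Rightarrow>\<^sub>L 'a)) \<Rightarrow> (real \<Rightarrow> real) \<Rightarrow> 'a set" where
  "spectral_dom E \<phi> = {x. integrable (spectral_measure E x) (\<lambda>m. (\<phi> m)\<^sup>2)}"

text \<open>\<open>T\<close> with domain \<open>S\<close> is the operator $\int\varphi(\mu)\,dE(\mu)$; by polarization its
  quadratic form determines it.\<close>

definition spectral_integral :: "(real \<Rightarrow> ('a::complex_hilbert \<Rightarrow>\<^sub>L 'a)) \<Rightarrow> (real \<Rightarrow> real) \<Rightarrow>
    'a set \<Rightarrow> ('a \<Rightarrow> 'a) \<Rightarrow> bool" where
  "spectral_integral E \<phi> S T \<longleftrightarrow> S = spectral_dom E \<phi> \<and> clinear_on S T \<and>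
     (\<forall>x\<in>S. cinner (T x) x = of_real (\<integral>m. \<phi> m \<partial>spectral_measure E x))"

section \<open>Operator data\<close>

text \<open>\<open>Cmh\<close> is $C^{-1/2}$, \<open>Dt\<close> and \<open>Bt\<close> are the bounded operators $\widetilde D$ and
  $\widetilde B$; \<open>spectral_dom E sqrt\<close> is the domain of $C^{1/2}$ (the spectral measures of \<open>C\<close>
  live on positive numbers).\<close>

locale operator_data =
  fixes domC :: "'c::{complex_hilbert, second_countable_topology} set" and C :: "'c \<Rightarrow> 'c"
    and lamC :: real and E :: "real \<Rightarrow> 'c \<Rightarrow>\<^sub>L 'c" and Cmh :: "'c \<Rightarrow>\<^sub>L 'c"
    and A :: "'a::{complex_hilbert, second_countable_topology} \<Rightarrow>\<^sub>L 'a"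
    and domD :: "'a set" and D :: "'a \<Rightarrow> 'c" and Dt :: "'a \<Rightarrow>\<^sub>L 'c"
    and domB :: "'c set" and B :: "'c \<Rightarrow> 'a" and Bt :: "'c \<Rightarrow>\<^sub>L 'a"
  assumes C_selfadjoint: "selfadjoint domC C"
    and lamC_pos: "0 < lamC"
    and C_lower_bound: "\<And>x. x \<in> domC \<Longrightarrow> lamC * (norm x)\<^sup>2 \<le> Re (cinner (C x) x)"
    and C_spectrum: "unbounded_spectrum domC C = complex_of_real ` {lamC..}"
    and E_family: "spectral_family E"
    and E_of_C: "spectral_integral E (\<lambda>m. m) domC C"
    and C_abs_continuous: "\<And>x. absolutely_continuous lborel (spectral_measure E x)"
    and Cmh_bop: "bop Cmh"
    and Cmh: "spectral_integral E (\<lambda>m. 1 / sqrt m) UNIV (blinfun_apply Cmh)"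
    and A_bop: "bop A"
    and D_densely_defined: "densely_defined domD D"
    and D_closable: "closable domD D"
    and Dt_bop: "bop Dt"
    and Dt: "\<And>x. x \<in> domD \<Longrightarrow> Dt x = Cmh (D x)"
    and B_densely_defined: "densely_defined domB B"
    and B_closable: "closable domB B"
    and B_domain: "spectral_dom E sqrt \<subseteq> domB"
    and Bt_bop: "bop Bt"
    and Bt: "\<And>x. Bt x = B (Cmh x)"

definition spectral_kernel :: "('c::complex_hilbert \<Rightarrow>\<^sub>L 'a::complex_hilbert) \<Rightarrow>
    (real \<Rightarrow> 'c \<Rightarrow>\<^sub>L 'c) \<Rightarrow> ('a \<Rightarrow>\<^sub>L 'c) \<Rightarrow> real \<Rightarrow> ('a \<Rightarrow>\<^sub>L 'a)" where
  "spectral_kernel Bt E Dt m = Bt o\<^sub>L E m o\<^sub>L Dt"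

text \<open>\<open>Kr\<close> is the function on the real line, \<open>Kc\<close> its analytic continuation from \<open>(lamC, b)\<close>
  to \<open>\<D>\<close>. The two may differ on the part of \<open>\<D>\<close> in \<open>[b, \<infinity>)\<close>. The point \<open>lam\<close> is
  excluded in the growth bound because \<open>0 powr g = 0\<close>.\<close>

locale kernel_data =
  fixes lamC b :: real and \<D> :: "complex set"
    and Kr :: "real \<Rightarrow> ('a::complex_hilbert \<Rightarrow>\<^sub>L 'a)" and Kc :: "complex \<Rightarrow> 'a \<Rightarrow>\<^sub>L 'a"
    and c g :: real
  assumes Kr_C1: "Kr C1_differentiable_on {lamC<..}"
    and open_\<D>: "open \<D>"
    and connected_\<D>: "connected \<D>"
    and simply_connected_\<D>: "simply_connected \<D>"
    and interval_in_\<D>: "complex_of_real ` {lamC<..<b} \<subseteq> \<D>"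
    and Kc_bop: "\<And>z. z \<in> \<D> \<Longrightarrow> bop (Kc z)"
    and Kc_analytic: "\<And>z. z \<in> \<D> \<Longrightarrow> \<exists>L. has_op_derivative Kc L z"
    and Kc_continues: "\<And>m. m \<in> {lamC<..<b} \<Longrightarrow> Kc (complex_of_real m) = Kr m"
    and c_pos: "0 < c"
    and g_bounds: "-1 < g" "g \<le> 0"
    and growth: "\<And>lam z. lam \<in> {lamC, b} \<Longrightarrow> z \<in> \<D> - {complex_of_real lam} \<Longrightarrow>
      norm (op_deriv Kc z) \<le> c * norm (z - complex_of_real lam) powr g"
    and tail_integrable:
      "(\<lambda>m. norm (vector_derivative Kr (at m)) / (1 + \<bar>m\<bar>)) integrable_on {b..}"

text \<open>The derivative $K'$ as a single function on a contour $\Gamma_l$: the curve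
  $\widetilde\Gamma_l$ runs off the real axis, where the continuation is used, and the rest of
  $\Gamma_l$ is real. On \<open>(lamC, b)\<close> both clauses agree.\<close>

definition kernel_deriv :: "(real \<Rightarrow> ('a::complex_hilbert \<Rightarrow>\<^sub>L 'a)) \<Rightarrow> (complex \<Rightarrow> 'a \<Rightarrow>\<^sub>L 'a) \<Rightarrow>
    complex \<Rightarrow> ('a \<Rightarrow>\<^sub>L 'a)" where
  "kernel_deriv Kr Kc z =
     (if Im z = 0 then vector_derivative Kr (at (Re z)) else op_deriv Kc z)"

section \<open>Rectifiable curves and line integrals\<close>

definition polygon_lengths :: "(real \<Rightarrow> complex) \<Rightarrow> real \<Rightarrow> real set" where
  "polygon_lengths p t = {\<Sum>k\<in>d. norm (p (Sup k) - p (Inf k)) | d. d division_of {0..t}}"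

definition rectifiable :: "(real \<Rightarrow> complex) \<Rightarrow> bool" where
  "rectifiable p \<longleftrightarrow> path p \<and> bdd_above (polygon_lengths p 1)"

definition arc_length :: "(real \<Rightarrow> complex) \<Rightarrow> real \<Rightarrow> real" where
  "arc_length p t = Sup (polygon_lengths p t)"

text \<open>The integral $\int_0^1 f\,dh$ as a limit of Stieltjes sums along gauges, which is the
  definition of the library's \<open>has_integral\<close> with the lengths of the intervals replaced by the
  increments of \<open>h\<close>. For continuous \<open>h\<close> it contains the improper integrals with singularities of
  \<open>f\<close> at 0 and 1, and the values of \<open>f\<close> at these points are irrelevant. The argument \<open>pr\<close> is
  the product of an increment with a value of \<open>f\<close>.\<close>

definition has_stieltjes_integral :: "('d::real_vector \<Rightarrow> 'b \<Rightarrow> 'b) \<Rightarrow>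
    (real \<Rightarrow> 'b::real_normed_vector) \<Rightarrow> (real \<Rightarrow> 'd) \<Rightarrow> 'b \<Rightarrow> bool" where
  "has_stieltjes_integral pr f h I \<longleftrightarrow> (\<forall>e>0. \<exists>\<gamma>. gauge \<gamma> \<and>
     (\<forall>p. p tagged_division_of {0..1} \<and> \<gamma> fine p \<longrightarrow>
       norm ((\<Sum>(x, k)\<in>p. pr (h (Sup k) - h (Inf k)) (f x)) - I) < e))"

definition stieltjes_integral :: "('d::real_vector \<Rightarrow> 'b \<Rightarrow> 'b) \<Rightarrow>
    (real \<Rightarrow> 'b::real_normed_vector) \<Rightarrow> (real \<Rightarrow> 'd) \<Rightarrow> 'b" where
  "stieltjes_integral pr f h = (THE I. has_stieltjes_integral pr f h I)"

section \<open>Contours\<close>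

text \<open>A contour $\Gamma_l=\widetilde\Gamma_l\cup[\beta,+\infty)$ is given by a parametrization
  \<open>p\<close> of $\widetilde\Gamma_l$ on \<open>[0, 1]\<close> together with \<open>b\<close>.\<close>

definition contour_set :: "real \<Rightarrow> (real \<Rightarrow> complex) \<Rightarrow> complex set" where
  "contour_set b p = path_image p \<union> complex_of_real ` {b..}"

text \<open>$\int_{\Gamma_l}d\mu\,F(\mu)$ and $\int_{\Gamma_l}|d\mu|\,\varphi(\mu)$.\<close>

definition contour_op_integral :: "real \<Rightarrow> (real \<Rightarrow> complex) \<Rightarrow>
    (complex \<Rightarrow> ('a::complex_hilbert \<Rightarrow>\<^sub>L 'a)) \<Rightarrow> ('a \<Rightarrow>\<^sub>L 'a)" where
  "contour_op_integral b p F =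
     stieltjes_integral scale_op (\<lambda>t. F (p t)) p + integral {b..} (\<lambda>m. F (complex_of_real m))"

definition contour_length_integrable ::
    "real \<Rightarrow> (real \<Rightarrow> complex) \<Rightarrow> (complex \<Rightarrow> real) \<Rightarrow> bool" where
  "contour_length_integrable b p \<phi> \<longleftrightarrow>
     (\<exists>I. has_stieltjes_integral (*) (\<lambda>t. \<phi> (p t)) (arc_length p) I) \<and>
     (\<lambda>m. \<phi> (complex_of_real m)) integrable_on {b..}"

definition contour_length_integral ::
    "real \<Rightarrow> (real \<Rightarrow> complex) \<Rightarrow> (complex \<Rightarrow> real) \<Rightarrow> real" where
  "contour_length_integral b p \<phi> =
     stieltjes_integral (*) (\<lambda>t. \<phi> (p t)) (arc_length p) +
     integral {b..} (\<lambda>m. \<phi> (complex_of_real m))"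

text \<open>\<open>p\<close> is a rectifiable Jordan curve in $\mathcal D^{(l)}$ (apart from its end points, which are
  real) resulting from a deformation through curves in $\mathcal D$ with the same end points.\<close>

definition deformed_curve ::
    "real \<Rightarrow> real \<Rightarrow> complex set \<Rightarrow> int \<Rightarrow> (real \<Rightarrow> complex) \<Rightarrow> bool" where
  "deformed_curve lamC b \<D> l p \<longleftrightarrow> arc p \<and> rectifiable p \<and>
     p ` {0<..<1} \<subseteq> \<D> \<inter> {z. 0 < of_int l * Im z} \<and>
     homotopic_with_canon
       (\<lambda>q. pathstart q = complex_of_real lamC \<and> pathfinish q = complex_of_real b \<and>
            q ` {0<..<1} \<subseteq> \<D>)
       {0..1} UNIV (linepath (complex_of_real lamC) (complex_of_real b)) p"

section \<open>Transfer function, transformations and admissible contours\<close>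

text \<open>In the following \<open>K'\<close> is the derivative of the kernel and \<open>At\<close> the operator
  $\widetilde A$.\<close>

definition V_fun :: "(complex \<Rightarrow> ('a::complex_hilbert \<Rightarrow>\<^sub>L 'a)) \<Rightarrow> real \<Rightarrow> (real \<Rightarrow> complex) \<Rightarrow>
    complex \<Rightarrow> ('a \<Rightarrow>\<^sub>L 'a)" where
  "V_fun K' b p z = contour_op_integral b p (\<lambda>m. scale_op (z / (z - m)) (K' m))"

definition transfer_fun :: "('a::complex_hilbert \<Rightarrow>\<^sub>L 'a) \<Rightarrow> (complex \<Rightarrow> ('a \<Rightarrow>\<^sub>L 'a)) \<Rightarrow> real \<Rightarrow>
    (real \<Rightarrow> complex) \<Rightarrow> complex \<Rightarrow> ('a \<Rightarrow>\<^sub>L 'a)" where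
  "transfer_fun At K' b p z = At - scalar_op z + V_fun K' b p z"

definition transfer_spectrum :: "('a::complex_hilbert \<Rightarrow>\<^sub>L 'a) \<Rightarrow> (complex \<Rightarrow> ('a \<Rightarrow>\<^sub>L 'a)) \<Rightarrow>
    real \<Rightarrow> (real \<Rightarrow> complex) \<Rightarrow> complex set" where
  "transfer_spectrum At K' b p =
     {z. z \<notin> contour_set b p \<and> \<not> (\<exists>S. is_op_inverse (transfer_fun At K' b p z) S)}"

definition V_right :: "(complex \<Rightarrow> ('a::complex_hilbert \<Rightarrow>\<^sub>L 'a)) \<Rightarrow> real \<Rightarrow> (real \<Rightarrow> complex) \<Rightarrow>
    ('a \<Rightarrow>\<^sub>L 'a) \<Rightarrow> ('a \<Rightarrow>\<^sub>L 'a)" where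
  "V_right K' b p Z =
     contour_op_integral b p (\<lambda>m. K' m o\<^sub>L Z o\<^sub>L op_inverse (Z - scalar_op m))"

definition V_left :: "(complex \<Rightarrow> ('a::complex_hilbert \<Rightarrow>\<^sub>L 'a)) \<Rightarrow> real \<Rightarrow> (real \<Rightarrow> complex) \<Rightarrow>
    ('a \<Rightarrow>\<^sub>L 'a) \<Rightarrow> ('a \<Rightarrow>\<^sub>L 'a)" where
  "V_left K' b p Z =
     contour_op_integral b p (\<lambda>m. Z o\<^sub>L op_inverse (Z - scalar_op m) o\<^sub>L K' m)"

definition contour_dist ::
    "('a::complex_hilbert \<Rightarrow>\<^sub>L 'a) \<Rightarrow> real \<Rightarrow> (real \<Rightarrow> complex) \<Rightarrow> real" where
  "contour_dist At b p = setdist (numrange At) (contour_set b p)"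

definition var_density :: "('a::complex_hilbert \<Rightarrow>\<^sub>L 'a) \<Rightarrow> (complex \<Rightarrow> ('a \<Rightarrow>\<^sub>L 'a)) \<Rightarrow>
    complex \<Rightarrow> real" where
  "var_density At K' m = norm (K' m) / infdist m (numrange At)"

definition contour_var :: "('a::complex_hilbert \<Rightarrow>\<^sub>L 'a) \<Rightarrow> (complex \<Rightarrow> ('a \<Rightarrow>\<^sub>L 'a)) \<Rightarrow> real \<Rightarrow>
    (real \<Rightarrow> complex) \<Rightarrow> real" where
  "contour_var At K' b p = contour_length_integral b p (var_density At K')"

text \<open>Finiteness of the integral defining the variation is a separate clause, since divergent
  integrals have unspecified values here.\<close>

definition admissible :: "('a::complex_hilbert \<Rightarrow>\<^sub>L 'a) \<Rightarrow> (complex \<Rightarrow> ('a \<Rightarrow>\<^sub>L 'a)) \<Rightarrow> real \<Rightarrow>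
    real \<Rightarrow> complex set \<Rightarrow> int \<Rightarrow> (real \<Rightarrow> complex) \<Rightarrow> bool" where
  "admissible At K' lamC b \<D> l p \<longleftrightarrow> deformed_curve lamC b \<D> l p \<and>
     contour_dist At b p > 0 \<and>
     contour_length_integrable b p (var_density At K') \<and>
     contour_var At K' b p < 1 \<and>
     contour_var At K' b p * norm At <
       1/4 * contour_dist At b p * (1 - contour_var At K' b p)\<^sup>2"

definition r_min :: "('a::complex_hilbert \<Rightarrow>\<^sub>L 'a) \<Rightarrow> (complex \<Rightarrow> ('a \<Rightarrow>\<^sub>L 'a)) \<Rightarrow> real \<Rightarrow>
    (real \<Rightarrow> complex) \<Rightarrow> real" where
  "r_min At K' b p =
     1/2 * contour_dist At b p * (1 - contour_var At K' b p) -
     sqrt (1/4 * (contour_dist At b p)\<^sup>2 * (1 - contour_var At K' b p)\<^sup>2 -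
           contour_dist At b p * contour_var At K' b p * norm At)"

definition r_zero :: "('a::complex_hilbert \<Rightarrow>\<^sub>L 'a) \<Rightarrow> (complex \<Rightarrow> ('a \<Rightarrow>\<^sub>L 'a)) \<Rightarrow> real \<Rightarrow>
    real \<Rightarrow> complex set \<Rightarrow> int \<Rightarrow> real" where
  "r_zero At K' lamC b \<D> l = Inf {r_min At K' b p | p. admissible At K' lamC b \<D> l p}"

definition O_set :: "('a::complex_hilbert \<Rightarrow>\<^sub>L 'a) \<Rightarrow> (complex \<Rightarrow> ('a \<Rightarrow>\<^sub>L 'a)) \<Rightarrow> real \<Rightarrow>
    (real \<Rightarrow> complex) \<Rightarrow> complex set" where
  "O_set At K' b p = {z. infdist z (numrange At) \<le>
     1/2 * contour_dist At b p * (1 - contour_var At K' b p)}"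

text \<open>\<open>X\<close> is the solution of $X=V_{\Gamma_l}(\widetilde A+X)$, common to all admissible contours
  $\Gamma_l$ with the given \<open>l\<close>, with norm at most $r_0^{(l)}(K)$; here \<open>V\<close> is \<open>V_right\<close> or
  \<open>V_left\<close>.\<close>

definition common_solution :: "((complex \<Rightarrow> ('a::complex_hilbert \<Rightarrow>\<^sub>L 'a)) \<Rightarrow> real \<Rightarrow>
    (real \<Rightarrow> complex) \<Rightarrow> ('a \<Rightarrow>\<^sub>L 'a) \<Rightarrow> ('a \<Rightarrow>\<^sub>L 'a)) \<Rightarrow>
    ('a \<Rightarrow>\<^sub>L 'a) \<Rightarrow> (complex \<Rightarrow> ('a \<Rightarrow>\<^sub>L 'a)) \<Rightarrow> real \<Rightarrow> real \<Rightarrow> complex set \<Rightarrow> int \<Rightarrow>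
    ('a \<Rightarrow>\<^sub>L 'a) \<Rightarrow> bool" where
  "common_solution V At K' lamC b \<D> l X \<longleftrightarrow> bop X \<and> norm X \<le> r_zero At K' lamC b \<D> l \<and>
     (\<forall>p. admissible At K' lamC b \<D> l p \<longrightarrow> X = V K' b p (At + X))"

end

theory Submission
  imports Defs "HOL-Complex_Analysis.Complex_Analysis"
begin

text \<open>If \<open>X\<close> solves the equation for one of the two transformations and \<open>Z = At + X\<close>, the identity
  $\frac{z}{z-\mu} = Z(Z-\mu)^{-1} + \frac{\mu}{z-\mu}(Z-\mu)^{-1}(Z-z)$, multiplied by $K'(\mu)$ and
  integrated over the contour, gives the factorization $M(z) = W(z)(Z-z)$ with
  $W(z) = 1 + \int K'(\mu)\frac{\mu}{z-\mu}(Z-\mu)^{-1}d\mu$ (and the mirror image for the left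
  transformation). For $z$ within $r = \frac12 d(1-\mathrm{Var})$ of the numerical range and
  $\|X\|\le r$, the resolvent bound $\|(Z-\mu)^{-1}\|\le(\mathrm{dist}(\mu,\nu)-\|X\|)^{-1}$ and
  admissibility give $\|W(z)-1\|<1$. Hence $M(z)$ and $Z-z$ are invertible for the same $z$, and the
  resolvent bound at $z$ itself confines the spectrum of $Z$ to distance $\|X\|$ from the
  numerical range.\<close>

section \<open>Complex Hilbert spaces and invertibility\<close>

text \<open>The hypotheses provide integrability of the scalar variation density only; that the
  operator integrals behind \<open>V_fun\<close>, \<open>V_right\<close> and \<open>V_left\<close>
  exist has to be derived. They are gauge integrals against a merely rectifiable curve, and
  \<open>K'\<close> may be unbounded towards its end points. Hence a domination theorem for
  Stieltjes integrals is proved by means of primitives, and existence is carried through every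
  manipulation. Since the operator type consists of real-linear maps, complex linearity must also be
  followed through limits, derivatives and integrals.

  The admissibility inequality is just what makes W(z) invertible. Let v be the variation and a the
  norm of \<open>At\<close>. On the contour |z - \<mu>| is at least (1 + v)/2 times the distance of
  \<mu> from the numerical range, the norm of \<mu> (Z - \<mu>)^-1 is at most (d + a)/(d - norm X),
  and d - norm X \<ge> d (1 + v)/2. Integration bounds the norm of W(z) - 1 by 4 v (d + a)/(d (1 +
  v)^2), and this bound is below 1 exactly when v a < d (1 - v)^2 / 4.\<close>

lemma cinner_add_right: "cinner x (y + z) = cinner x y + cinner x (z::'a::complex_hilbert)"
  by (metis cinner_add_left cinner_commute complex_cnj_add)

lemma cinner_scaleC_right: "cinner x (c *\<^sub>C y) = cnj c * cinner x (y::'a::complex_hilbert)"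
  by (metis cinner_scaleC_left cinner_commute complex_cnj_mult)

lemma cinner_zero_left [simp]: "cinner 0 (x::'a::complex_hilbert) = 0"
  using cinner_add_left[of 0 0 x] by simp

lemma cinner_zero_right [simp]: "cinner (x::'a::complex_hilbert) 0 = 0"
  using cinner_add_right[of x 0 0] by simp

lemma cinner_minus_left [simp]: "cinner (- x) (y::'a::complex_hilbert) = - cinner x y"
  using cinner_add_left[of x "- x" y] by (simp add: eq_neg_iff_add_eq_0 add.commute)

lemma cinner_minus_right [simp]: "cinner (x::'a::complex_hilbert) (- y) = - cinner x y"
  using cinner_add_right[of x y "- y"] by (simp add: eq_neg_iff_add_eq_0 add.commute)

lemma cinner_diff_left: "cinner (x - y) (z::'a::complex_hilbert) = cinner x z - cinner y z"
  using cinner_add_left[of x "- y" z] by simp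

lemma cinner_diff_right: "cinner (x::'a::complex_hilbert) (y - z) = cinner x y - cinner x z"
  using cinner_add_right[of x y "- z"] by simp

lemma mult_cnj_cmod: "z * cnj z = (of_real (cmod z))\<^sup>2"
  by (simp add: complex_norm_square flip: of_real_power)

lemma cinner_self: "cinner x (x::'a::complex_hilbert) = of_real ((norm x)\<^sup>2)"
proof -
  have "cinner x x = cnj (cinner x x)" by (rule cinner_commute)
  then have "Im (cinner x x) = 0" by (simp add: complex_eq_iff)
  moreover have "Re (cinner x x) = (norm x)\<^sup>2"
    by (simp add: norm_eq_sqrt_cinner cinner_nonneg)
  ultimately show ?thesis by (simp add: complex_eq_iff)
qed

text \<open>One expansion serves four purposes: homogeneity of the norm (\<open>x = 0\<close>),
  Cauchy-Schwarz, the parallelogram law (\<open>c = 1\<close> and \<open>c = -1\<close>), and the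
  variation argument at a nearest point.\<close>

lemma norm_diff_scaleC_sq:
  fixes x y :: "'a::complex_hilbert"
  shows "(norm (x - c *\<^sub>C y))\<^sup>2 = (norm x)\<^sup>2 - 2 * Re (cnj c * cinner x y) + (cmod c)\<^sup>2 * (norm y)\<^sup>2"
proof -
  have "of_real ((norm (x - c *\<^sub>C y))\<^sup>2) = cinner (x - c *\<^sub>C y) (x - c *\<^sub>C y)"
    by (simp add: cinner_self)
  also have "\<dots> = cinner x x - cnj c * cinner x y - c * cinner y x + c * cnj c * cinner y y"
    by (simp add: cinner_diff_left cinner_diff_right cinner_scaleC_left cinner_scaleC_right algebra_simps)
  also have "\<dots> = of_real ((norm x)\<^sup>2) - cnj c * cinner x y - cnj (cnj c * cinner x y)
      + of_real ((cmod c)\<^sup>2) * of_real ((norm y)\<^sup>2)"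
    using cinner_commute[of y x]
    by (simp add: cinner_self mult_cnj_cmod)
  finally have "Re (of_real ((norm (x - c *\<^sub>C y))\<^sup>2)) = Re (of_real ((norm x)\<^sup>2) - cnj c * cinner x y
      - cnj (cnj c * cinner x y) + of_real ((cmod c)\<^sup>2 * (norm y)\<^sup>2))" by simp
  then show ?thesis by (simp only: Re_complex_of_real complex_cnj minus_complex.simps plus_complex.simps cnj.simps)
qed

lemma norm_scaleC [simp]: "norm (c *\<^sub>C (x::'a::complex_hilbert)) = cmod c * norm x"
proof -
  have "(norm (c *\<^sub>C x))\<^sup>2 = (cmod c * norm x)\<^sup>2"
    using norm_diff_scaleC_sq[of 0 c x] by (simp add: power_mult_distrib)
  then show ?thesis by (simp add: power2_eq_iff_nonneg)
qed

lemma cinner_cauchy_schwarz: "cmod (cinner x y) \<le> norm x * norm (y::'a::complex_hilbert)"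
proof (cases "y = 0")
  case False
  define N where "N = (norm y)\<^sup>2"
  have N: "N > 0" using False by (simp add: N_def)
  define c where "c = cinner x y / of_real N"
  have "cnj c * cinner x y = of_real ((cmod (cinner x y))\<^sup>2 / N)"
    using mult_cnj_cmod[of "cinner x y"] by (simp add: c_def mult.commute)
  moreover have "(cmod c)\<^sup>2 * N = (cmod (cinner x y))\<^sup>2 / N"
    using N by (simp add: c_def norm_divide power_divide power2_eq_square)
  moreover have "0 \<le> (norm (x - c *\<^sub>C y))\<^sup>2" by simp
  ultimately have "0 \<le> (norm x)\<^sup>2 - (cmod (cinner x y))\<^sup>2 / N"
    using norm_diff_scaleC_sq[of x c y] unfolding N_def[symmetric] by simp
  then have "(cmod (cinner x y))\<^sup>2 \<le> (norm x * norm y)\<^sup>2"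
    using N by (simp add: field_simps N_def)
  then show ?thesis by (rule power2_le_imp_le) simp
qed simp

section \<open>Complex scaling of vectors and operators, and complex-linear operators\<close>

lemma scaleC_one [simp]: "1 *\<^sub>C (x::'a::complex_hilbert) = x"
  using scaleC_of_real[of 1 x] by simp

lemma scaleC_scaleR_commute: "r *\<^sub>R (c *\<^sub>C x) = c *\<^sub>C (r *\<^sub>R (x::'a::complex_hilbert))"
  by (simp add: scaleC_scaleC mult.commute flip: scaleC_of_real)

lemma bounded_bilinear_scaleC: "bounded_bilinear (scaleC :: complex \<Rightarrow> 'a \<Rightarrow> 'a::complex_hilbert)"
  by standard (auto simp: scaleC_add_left scaleC_add_right scaleC_scaleC scaleR_conv_of_real
      mult.commute simp flip: scaleC_of_real intro!: exI[of _ 1])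

lemma bounded_linear_cinner_left: "bounded_linear (\<lambda>x::'a::complex_hilbert. cinner x y)"
  by (rule bounded_linear_intro[where K="norm y"])
    (auto simp: cinner_add_left cinner_scaleC_left scaleR_conv_of_real cinner_cauchy_schwarz
      simp flip: scaleC_of_real)

lemma scalar_op_apply [simp]: "scalar_op c x = c *\<^sub>C x"
  unfolding scalar_op_def
  by (simp add: bounded_linear_Blinfun_apply bounded_bilinear.bounded_linear_right[OF bounded_bilinear_scaleC])

lemma scale_op_apply [simp]: "scale_op c T x = c *\<^sub>C T x"
  by (simp add: scale_op_def)

lemma norm_scale_op_le: "norm (scale_op c T) \<le> cmod c * norm T"
  by (rule norm_blinfun_bound) (auto simp: norm_blinfun mult.assoc intro!: mult_left_mono)

lemma bounded_bilinear_scale_op: "bounded_bilinear scale_op"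
proof
  fix a b :: complex and S T :: "'a \<Rightarrow>\<^sub>L 'a" and r :: real
  show "scale_op (a + b) S = scale_op a S + scale_op b S"
    by (rule blinfun_eqI) (simp add: blinfun.add_left scaleC_add_left)
  show "scale_op a (S + T) = scale_op a S + scale_op a T"
    by (rule blinfun_eqI) (simp add: blinfun.add_left scaleC_add_right)
  show "scale_op (r *\<^sub>R a) S = r *\<^sub>R scale_op a S"
    by (rule blinfun_eqI) (simp add: blinfun.scaleR_left scaleR_conv_of_real scaleC_scaleC
        flip: scaleC_of_real)
  show "scale_op a (r *\<^sub>R S) = r *\<^sub>R scale_op a S"
    by (rule blinfun_eqI) (simp add: blinfun.scaleR_left scaleC_scaleR_commute)
  show "\<exists>K. \<forall>a (S::'a \<Rightarrow>\<^sub>L 'a). norm (scale_op a S) \<le> norm a * norm S * K"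
    by (rule exI[of _ 1]) (simp add: norm_scale_op_le)
qed

lemmas scale_op_simps =
  bounded_bilinear.add_left[OF bounded_bilinear_scale_op]
  bounded_bilinear.add_right[OF bounded_bilinear_scale_op]
  bounded_bilinear.diff_left[OF bounded_bilinear_scale_op]
  bounded_bilinear.diff_right[OF bounded_bilinear_scale_op]
  bounded_bilinear.zero_left[OF bounded_bilinear_scale_op]
  bounded_bilinear.zero_right[OF bounded_bilinear_scale_op]

lemma scale_op_scale_op: "scale_op a (scale_op b T) = scale_op (a * b) T"
  by (rule blinfun_eqI) (simp add: scaleC_scaleC)

lemma scale_op_one [simp]: "scale_op 1 T = T"
  by (rule blinfun_eqI) simp

lemma bopD: "bop T \<Longrightarrow> T (c *\<^sub>C x) = c *\<^sub>C T x"
  by (simp add: bop_def)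

lemma bop_add: "bop S \<Longrightarrow> bop T \<Longrightarrow> bop (S + T)"
  by (simp add: bop_def blinfun.add_left scaleC_add_right)

lemma bop_diff: "bop S \<Longrightarrow> bop T \<Longrightarrow> bop (S - T)"
  by (simp add: bop_def blinfun.diff_left bounded_bilinear.diff_right[OF bounded_bilinear_scaleC])

lemma bop_compose: "bop S \<Longrightarrow> bop T \<Longrightarrow> bop (S o\<^sub>L T)"
  by (simp add: bop_def)

lemma bop_id: "bop id_blinfun"
  by (simp add: bop_def)

lemma bop_scalar_op: "bop (scalar_op c)"
  by (simp add: bop_def scaleC_scaleC mult.commute)

lemma bop_scale_op: "bop T \<Longrightarrow> bop (scale_op c T)"
  by (simp add: scale_op_def bop_compose bop_scalar_op)

text \<open>Complex linearity of \<open>T\<close> means that all these defects vanish. Each defect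
  is a bounded linear function of \<open>T\<close>, so complex linearity passes to limits,
  derivatives and integrals of operators.\<close>

lemma bounded_linear_bop_defect:
  "bounded_linear (\<lambda>T::'a::complex_hilbert \<Rightarrow>\<^sub>L 'b::complex_hilbert. T (c *\<^sub>C x) - c *\<^sub>C T x)"
  by (intro bounded_linear_sub bounded_linear_compose[OF bounded_bilinear.bounded_linear_right[OF
      bounded_bilinear_scaleC]] bounded_linear_blinfun_apply bounded_linear_ident
      blinfun.bounded_linear_left)

lemma closed_bop: "closed {T::'a::complex_hilbert \<Rightarrow>\<^sub>L 'b::complex_hilbert. bop T}"
proof -
  have "{T::'a \<Rightarrow>\<^sub>L 'b. bop T} = (\<Inter>c. \<Inter>x. {T::'a \<Rightarrow>\<^sub>L 'b. T (c *\<^sub>C x) - c *\<^sub>C T x = 0})"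
    by (auto simp: bop_def)
  moreover have "closed {T::'a \<Rightarrow>\<^sub>L 'b. T (c *\<^sub>C x) - c *\<^sub>C T x = 0}" for c x
    by (intro closed_Collect_eq continuous_on_const linear_continuous_on bounded_linear_bop_defect)
  ultimately show ?thesis by (metis (mono_tags, lifting) closed_INT)
qed

text \<open>The vector points from the nearest point of \<open>S\<close> to some \<open>v \<notin> S\<close>; a minimizing sequence is Cauchy
  by the parallelogram law.\<close>

lemma exists_orthogonal_vector:
  fixes S :: "'a::complex_hilbert set"
  assumes S: "csubspace S" and "closed S" and "S \<noteq> UNIV"
  obtains y where "y \<noteq> 0" "\<And>x. x \<in> S \<Longrightarrow> cinner x y = 0"
proof -
  have S_add: "x \<in> S \<Longrightarrow> y \<in> S \<Longrightarrow> x + y \<in> S" and S_scale: "x \<in> S \<Longrightarrow> c *\<^sub>C x \<in> S"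
    and S_0: "0 \<in> S" for x y c
    using S by (auto simp: csubspace_def)
  obtain v where v: "v \<notin> S" using assms by auto
  define d where "d = infdist v S"
  have d_le: "d \<le> norm (v - s)" if "s \<in> S" for s
    using infdist_le[OF that, of v] by (simp add: d_def dist_norm)
  have d0: "0 \<le> d" by (simp add: d_def infdist_nonneg)
  have "\<exists>s\<in>S. (norm (v - s))\<^sup>2 < d\<^sup>2 + 1 / real (Suc n)" for n
  proof -
    define e where "e = 1 / real (Suc n)"
    have "d < sqrt (d\<^sup>2 + e)" using d0 by (intro real_less_rsqrt) (simp add: e_def)
    moreover have "S \<noteq> {}" using S_0 by auto
    ultimately obtain s where "s \<in> S" "dist v s < sqrt (d\<^sup>2 + e)"
      by (metis d_def infdist_notempty cINF_less_iff bdd_below_image_dist)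
    moreover from this have "(norm (v - s))\<^sup>2 < (sqrt (d\<^sup>2 + e))\<^sup>2"
      by (intro power_strict_mono) (auto simp: dist_norm)
    ultimately show ?thesis by (auto simp: e_def intro!: bexI[of _ s])
  qed
  then obtain s where sS: "\<And>n. s n \<in> S"
    and s: "\<And>n. (norm (v - s n))\<^sup>2 < d\<^sup>2 + 1 / real (Suc n)"
    by metis
  have close: "(norm (s m - s n))\<^sup>2 \<le> 2 / real (Suc m) + 2 / real (Suc n)" for m n
  proof -
    define a b where "a = v - s m" and "b = v - s n"
    have "d \<le> norm (v - (1/2) *\<^sub>C (s m + s n))"
      by (intro d_le S_scale S_add sS)
    also have "v - (1/2) *\<^sub>C (s m + s n) = (1/2) *\<^sub>R (a + b)"
      using scaleC_of_real[of "1/2" "s m + s n"] scaleR_half_double[of v]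
      by (simp add: a_def b_def algebra_simps)
    finally have "2 * d \<le> norm (a + b)" by simp
    then have "4 * d\<^sup>2 \<le> (norm (a + b))\<^sup>2"
      using power_mono[of "2 * d" "norm (a + b)" 2] d0 by simp
    moreover have "(norm (a - b))\<^sup>2 + (norm (a + b))\<^sup>2 = 2 * (norm a)\<^sup>2 + 2 * (norm b)\<^sup>2"
      using norm_diff_scaleC_sq[of a 1 b] norm_diff_scaleC_sq[of a "-1" b] scaleC_of_real[of "-1" b]
      by simp
    moreover have "norm (a - b) = norm (s m - s n)"
      by (simp add: a_def b_def norm_minus_commute)
    ultimately show ?thesis using s[of m] s[of n] unfolding a_def b_def by simp
  qed
  have "Cauchy s"
  proof (rule metric_CauchyI)
    fix e :: real assume "0 < e"
    then obtain M where "inverse (real (Suc M)) < e\<^sup>2 / 4"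
      using reals_Archimedean[of "e\<^sup>2 / 4"] by auto
    then have M: "4 / real (Suc M) < e\<^sup>2" by (simp add: field_simps)
    have "dist (s m) (s n) < e" if "M \<le> m" "M \<le> n" for m n
    proof -
      have "2 / real (Suc m) \<le> 2 / real (Suc M)" "2 / real (Suc n) \<le> 2 / real (Suc M)"
        using that by (auto simp: field_simps)
      with M close[of m n] have "(norm (s m - s n))\<^sup>2 < e\<^sup>2" by simp
      then show ?thesis using \<open>0 < e\<close> by (simp add: dist_norm power_less_imp_less_base)
    qed
    then show "\<exists>M. \<forall>m\<ge>M. \<forall>n\<ge>M. dist (s m) (s n) < e" by blast
  qed
  then obtain w where w: "s \<longlonglongrightarrow> w" by (auto simp: Cauchy_convergent_iff convergent_def)
  have wS: "w \<in> S" using closed_sequentially[OF \<open>closed S\<close> _ w] sS by auto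
  have "(norm (v - w))\<^sup>2 \<le> d\<^sup>2 + 0"
  proof (rule LIMSEQ_le[OF _ _ exI[of _ 0]])
    show "(\<lambda>n. (norm (v - s n))\<^sup>2) \<longlonglongrightarrow> (norm (v - w))\<^sup>2"
      by (intro tendsto_intros w)
    show "(\<lambda>n. d\<^sup>2 + 1 / real (Suc n)) \<longlonglongrightarrow> d\<^sup>2 + 0"
      by (intro tendsto_intros LIMSEQ_Suc[OF lim_1_over_n])
  qed (use s less_imp_le in blast)
  then have nw: "(norm (v - w))\<^sup>2 \<le> d\<^sup>2" by simp
  define y where "y = v - w"
  have "cinner y x = 0" if x: "x \<in> S" for x
  proof (rule ccontr)
    assume nz: "cinner y x \<noteq> 0"
    \<comment> \<open>Moving from \<open>w\<close> by \<open>c *\<^sub>C x\<close> changes the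
      squared distance to \<open>v\<close> by t |<y,x>|^2 (t |x|^2 - 2). The summand 1 in the
      denominator keeps t |x|^2 below 1, so the change would be strictly negative, against the
      minimality of \<open>w\<close>.\<close>
    define t where "t = 1 / ((norm x)\<^sup>2 + 1)"
    have t: "t > 0" "t * (norm x)\<^sup>2 < 1" by (auto simp: t_def field_simps add_pos_nonneg)
    define c where "c = of_real t * cinner y x"
    have "d \<le> norm (v - (w + c *\<^sub>C x))" by (intro d_le S_add S_scale wS x)
    then have "d\<^sup>2 \<le> (norm (y - c *\<^sub>C x))\<^sup>2"
      using d0 by (simp add: y_def algebra_simps power_mono)
    also have "\<dots> = (norm y)\<^sup>2 - 2 * Re (cnj c * cinner y x) + (cmod c)\<^sup>2 * (norm x)\<^sup>2"
      by (rule norm_diff_scaleC_sq)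
    also have "cnj c * cinner y x = of_real (t * (cmod (cinner y x))\<^sup>2)"
      using mult_cnj_cmod[of "cinner y x"] by (simp add: c_def mult.commute)
    finally have "2 * t * (cmod (cinner y x))\<^sup>2 \<le> (cmod c)\<^sup>2 * (norm x)\<^sup>2"
      using nw by (simp add: y_def)
    also have "(cmod c)\<^sup>2 * (norm x)\<^sup>2 = t * (cmod (cinner y x))\<^sup>2 * (t * (norm x)\<^sup>2)"
      using t by (simp add: c_def norm_mult power2_eq_square)
    also have "\<dots> \<le> t * (cmod (cinner y x))\<^sup>2 * 1"
      using t by (intro mult_left_mono) auto
    finally show False using nz t by simp
  qed
  then have "cinner x y = 0" if "x \<in> S" for x
    by (metis cinner_commute complex_cnj_zero that)
  moreover have "y \<noteq> 0" using v wS by (auto simp: y_def)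
  ultimately show thesis using that by blast
qed

section \<open>Bounded inverses from lower bounds of the quadratic form\<close>

lemma is_op_inverse_unique: "is_op_inverse T S \<Longrightarrow> is_op_inverse T S' \<Longrightarrow> S = S'"
proof -
  assume "is_op_inverse T S" "is_op_inverse T S'"
  then have *: "T (S' x) = x" "S (T x) = x" for x
    unfolding is_op_inverse_def by (metis blinfun_apply_blinfun_compose blinfun_apply_id_blinfun id_apply)+
  show "S = S'" by (rule blinfun_eqI) (metis *)
qed

lemma op_inverse_eq: "is_op_inverse T S \<Longrightarrow> op_inverse T = S"
  unfolding op_inverse_def by (blast intro: is_op_inverse_unique the_equality)

text \<open>The range is closed since \<open>T\<close> is bounded below, and a vector \<open>y\<close> orthogonal to it would
  satisfy \<open>cinner (T y) y = 0\<close>.\<close>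

lemma is_op_inverse_if_form_bounded_below:
  fixes T :: "'a::complex_hilbert \<Rightarrow>\<^sub>L 'a"
  assumes T: "bop T" and "0 < k" and form: "\<And>x. norm x = 1 \<Longrightarrow> k \<le> cmod (cinner (T x) x)"
  shows "\<exists>S. is_op_inverse T S \<and> norm S \<le> 1 / k"
proof -
  have form': "k * (norm x)\<^sup>2 \<le> cmod (cinner (T x) x)" for x
  proof (cases "x = 0")
    case False
    define u where "u = of_real (1 / norm x) *\<^sub>C x"
    have "norm u = 1" using False by (simp add: u_def norm_divide)
    then have "k \<le> cmod (cinner (T u) u)" by (rule form)
    also have "cinner (T u) u = of_real ((1 / norm x)\<^sup>2) * cinner (T x) x"
      by (simp add: u_def bopD[OF T] cinner_scaleC_left cinner_scaleC_right power2_eq_square)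
    finally show ?thesis using False by (simp add: norm_mult norm_divide norm_power field_simps)
  qed simp
  have lower: "k * norm x \<le> norm (T x)" for x
  proof (cases "x = 0")
    case False
    have "k * (norm x)\<^sup>2 \<le> norm (T x) * norm x"
      using form'[of x] cinner_cauchy_schwarz[of "T x" x] by linarith
    then show ?thesis using False by (simp add: power2_eq_square)
  qed simp
  have "inj T"
    using lower \<open>0 < k\<close> by (intro linear_injective_0[THEN iffD2] blinfun.bounded_linear_right
        bounded_linear.linear) (metis mult_pos_pos norm_zero not_le zero_less_norm_iff allI impI)
  have "closed (range T)"
    using complete_isometric_image[OF \<open>0 < k\<close> subspace_UNIV blinfun.bounded_linear_right, of T] lower
    by (simp add: complete_UNIV complete_imp_closed)
  moreover have "csubspace (range T)"
    unfolding csubspace_def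
  proof (intro conjI ballI allI)
    show "0 \<in> range T" by (metis blinfun.zero_right rangeI)
    show "x + y \<in> range T" if "x \<in> range T" "y \<in> range T" for x y
      using that by (auto simp flip: blinfun.add_right)
    show "c *\<^sub>C x \<in> range T" if "x \<in> range T" for c x
      using that by (auto simp flip: bopD[OF T])
  qed
  ultimately have "range T = UNIV"
  proof (rule_tac ccontr)
    assume "closed (range T)" "csubspace (range T)" "range T \<noteq> UNIV"
    then obtain y where "y \<noteq> 0" and y: "\<And>x. x \<in> range T \<Longrightarrow> cinner x y = 0"
      using exists_orthogonal_vector by metis
    with form'[of y] y[of "T y"] \<open>0 < k\<close> show False by (simp add: mult_le_0_iff)
  qed
  define g where "g = inv T"
  have Tg: "T (g y) = y" and gT: "g (T x) = x" for x y
    using \<open>range T = UNIV\<close> \<open>inj T\<close> by (auto simp: g_def surj_f_inv_f)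
  have g_bound: "norm (g y) \<le> norm y * (1 / k)" for y
    using lower[of "g y"] \<open>0 < k\<close> by (simp add: Tg field_simps)
  have bl: "bounded_linear g"
  proof (rule bounded_linear_intro)
    show "g (x + y) = g x + g y" for x y
      by (metis Tg gT blinfun.add_right)
    show "g (r *\<^sub>R x) = r *\<^sub>R g x" for r x
      by (metis Tg gT blinfun.scaleR_right)
  qed (rule g_bound)
  define S where "S = Blinfun g"
  have S: "S y = g y" for y using bl by (simp add: S_def bounded_linear_Blinfun_apply)
  have "is_op_inverse T S"
    unfolding is_op_inverse_def bop_def
    by (auto intro!: blinfun_eqI simp: S Tg gT) (metis Tg gT bopD[OF T])
  moreover have "norm S \<le> 1 / k"
    using \<open>0 < k\<close> g_bound by (intro norm_blinfun_bound) (auto simp: S mult.commute)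
  ultimately show ?thesis by blast
qed

section \<open>Stieltjes sums and primitives\<close>

text \<open>No sign is imposed on \<open>K\<close>, so error terms such as \<open>e\<close> times an
  increment of \<open>s\<close> can be discarded without inspecting that increment.\<close>

lemma le_if_le_add_small_multiple:
  fixes x y K :: real
  assumes "\<And>e. e > 0 \<Longrightarrow> x \<le> y + e * K"
  shows "x \<le> y"
proof (rule field_le_epsilon)
  fix e :: real assume "e > 0"
  obtain M where "M > 0" "K \<le> M" using that[of "max 1 K"] by simp
  have "e / M > 0" using \<open>e > 0\<close> \<open>M > 0\<close> by simp
  then have "x \<le> y + (e / M) * K" by (rule assms)
  moreover have "(e / M) * K \<le> (e / M) * M"
    using mult_left_mono[OF \<open>K \<le> M\<close>, of "e / M"] \<open>e / M > 0\<close> by simp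
  moreover have "(e / M) * M = e" using \<open>M > 0\<close> by simp
  ultimately show "x \<le> y + e" by linarith
qed

definition stieltjes_sum :: "('d::real_vector \<Rightarrow> 'b \<Rightarrow> 'b) \<Rightarrow> (real \<Rightarrow> 'b) \<Rightarrow> (real \<Rightarrow> 'd) \<Rightarrow>
    (real \<times> real set) set \<Rightarrow> 'b::real_normed_vector" where
  "stieltjes_sum pr f h p = (\<Sum>(x, k)\<in>p. pr (h (Sup k) - h (Inf k)) (f x))"

lemma has_stieltjes_integral_iff:
  "has_stieltjes_integral pr f h I \<longleftrightarrow> (\<forall>e>0. \<exists>g. gauge g \<and>
     (\<forall>p. p tagged_division_of {0..1} \<and> g fine p \<longrightarrow> norm (stieltjes_sum pr f h p - I) < e))"
  by (simp add: has_stieltjes_integral_def stieltjes_sum_def)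

lemma norm_add_less_half: "norm x < e / 2 \<Longrightarrow> norm y < e / 2 \<Longrightarrow> norm (x + y :: 'a::real_normed_vector) < e"
  using norm_triangle_ineq[of x y] by linarith

lemma has_stieltjes_integral_add:
  assumes pr: "\<And>a x y. pr a (x + y) = pr a x + pr a y"
    and f: "has_stieltjes_integral pr f h I" and g: "has_stieltjes_integral pr g h J"
  shows "has_stieltjes_integral pr (\<lambda>t. f t + g t) h (I + J)"
  unfolding has_stieltjes_integral_iff
proof (intro allI impI)
  fix e :: real assume "e > 0"
  then have e: "e / 2 > 0" by simp
  obtain g1 where g1: "gauge g1" "\<forall>p. p tagged_division_of {0..1} \<and> g1 fine p \<longrightarrow>
      norm (stieltjes_sum pr f h p - I) < e / 2"
    using f e unfolding has_stieltjes_integral_iff by metis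
  obtain g2 where g2: "gauge g2" "\<forall>p. p tagged_division_of {0..1} \<and> g2 fine p \<longrightarrow>
      norm (stieltjes_sum pr g h p - J) < e / 2"
    using g e unfolding has_stieltjes_integral_iff by metis
  have "norm (stieltjes_sum pr (\<lambda>t. f t + g t) h p - (I + J)) < e"
    if p: "p tagged_division_of {0..1}" "(\<lambda>x. g1 x \<inter> g2 x) fine p" for p
  proof -
    have "stieltjes_sum pr (\<lambda>t. f t + g t) h p - (I + J) =
        (stieltjes_sum pr f h p - I) + (stieltjes_sum pr g h p - J)"
      by (simp add: stieltjes_sum_def pr sum.distrib case_prod_unfold)
    moreover have "norm (stieltjes_sum pr f h p - I) < e / 2" "norm (stieltjes_sum pr g h p - J) < e / 2"
      using p g1(2) g2(2) by (simp_all add: fine_Int)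
    ultimately show ?thesis by (simp only: norm_add_less_half)
  qed
  then show "\<exists>\<gamma>. gauge \<gamma> \<and> (\<forall>p. p tagged_division_of {0..1} \<and> \<gamma> fine p \<longrightarrow>
      norm (stieltjes_sum pr (\<lambda>t. f t + g t) h p - (I + J)) < e)"
    using gauge_Int[OF g1(1) g2(1)] by blast
qed

text \<open>Two products are allowed because \<open>L\<close> may change the type of the values:
  evaluating an operator at a vector turns \<open>scale_op\<close> into
  \<open>scaleC\<close>.\<close>

lemma has_stieltjes_integral_linear:
  assumes L: "bounded_linear L" and pr: "\<And>a x. L (pr a x) = pr' a (L x)"
    and f: "has_stieltjes_integral pr f h I"
  shows "has_stieltjes_integral pr' (\<lambda>t. L (f t)) h (L I)"
  unfolding has_stieltjes_integral_iff
proof (intro allI impI)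
  fix e :: real assume "e > 0"
  obtain K where K: "K > 0" "\<And>x. norm (L x) \<le> norm x * K"
    using bounded_linear.pos_bounded[OF L] by blast
  with \<open>e > 0\<close> have "e / K > 0" by simp
  then obtain g where g: "gauge g" "\<forall>p. p tagged_division_of {0..1} \<and> g fine p \<longrightarrow>
      norm (stieltjes_sum pr f h p - I) < e / K"
    using f unfolding has_stieltjes_integral_iff by metis
  have "norm (stieltjes_sum pr' (\<lambda>t. L (f t)) h p - L I) < e"
    if p: "p tagged_division_of {0..1}" "g fine p" for p
  proof -
    have "stieltjes_sum pr' (\<lambda>t. L (f t)) h p = L (stieltjes_sum pr f h p)"
      by (simp add: stieltjes_sum_def linear_sum[OF bounded_linear.linear[OF L]] pr case_prod_unfold)
    then have "norm (stieltjes_sum pr' (\<lambda>t. L (f t)) h p - L I) = norm (L (stieltjes_sum pr f h p - I))"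
      using linear_diff[OF bounded_linear.linear[OF L]] by simp
    also have "\<dots> \<le> norm (stieltjes_sum pr f h p - I) * K" by (rule K)
    also have "\<dots> < e" using g(2) p K(1) by (simp add: pos_less_divide_eq)
    finally show ?thesis .
  qed
  then show "\<exists>\<gamma>. gauge \<gamma> \<and> (\<forall>p. p tagged_division_of {0..1} \<and> \<gamma> fine p \<longrightarrow>
      norm (stieltjes_sum pr' (\<lambda>t. L (f t)) h p - L I) < e)"
    using g(1) by blast
qed

lemma has_stieltjes_integral_unique:
  assumes I: "has_stieltjes_integral pr f h I" and J: "has_stieltjes_integral pr f h J"
  shows "I = J"
proof (rule ccontr)
  assume "I \<noteq> J"
  then have e: "norm (I - J) / 2 > 0" by simp
  obtain g1 where g1: "gauge g1" "\<forall>p. p tagged_division_of {0..1} \<and> g1 fine p \<longrightarrow>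
      norm (stieltjes_sum pr f h p - I) < norm (I - J) / 2"
    using I e unfolding has_stieltjes_integral_iff by metis
  obtain g2 where g2: "gauge g2" "\<forall>p. p tagged_division_of {0..1} \<and> g2 fine p \<longrightarrow>
      norm (stieltjes_sum pr f h p - J) < norm (I - J) / 2"
    using J e unfolding has_stieltjes_integral_iff by metis
  obtain p where "p tagged_division_of {0..1::real}" "(\<lambda>x. g1 x \<inter> g2 x) fine p"
    by (rule fine_division_exists_real[OF gauge_Int[OF g1(1) g2(1)]])
  then have "norm (stieltjes_sum pr f h p - I) < norm (I - J) / 2"
    "norm (stieltjes_sum pr f h p - J) < norm (I - J) / 2"
    using g1(2) g2(2) by (simp_all add: fine_Int)
  then show False
    using norm_triangle_ineq4[of "stieltjes_sum pr f h p - J" "stieltjes_sum pr f h p - I"]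
    by (simp add: algebra_simps)
qed

lemma stieltjes_integral_eq: "has_stieltjes_integral pr f h I \<Longrightarrow> stieltjes_integral pr f h = I"
  unfolding stieltjes_integral_def by (blast intro: has_stieltjes_integral_unique)

text \<open>A primitive of \<open>f\<close> with respect to \<open>h\<close> up to the error \<open>e\<close>, where \<open>s\<close> bounds the variation
  of \<open>h\<close>: Stieltjes sums can then be compared with telescoping sums of \<open>G\<close>.\<close>

definition approx_primitive :: "('d::real_normed_vector \<Rightarrow> 'b \<Rightarrow> 'b) \<Rightarrow>
    (real \<Rightarrow> 'b::real_normed_vector) \<Rightarrow> (real \<Rightarrow> 'd) \<Rightarrow> (real \<Rightarrow> real) \<Rightarrow> (real \<Rightarrow> 'b) \<Rightarrow>
    real \<Rightarrow> real \<Rightarrow> real \<Rightarrow> bool" where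
  "approx_primitive pr f h s G e a b \<longleftrightarrow> (\<forall>x\<in>{a..b}. \<exists>\<delta>>0. \<forall>u v.
     a \<le> u \<and> x - \<delta> < u \<and> u \<le> x \<and> x \<le> v \<and> v < x + \<delta> \<and> v \<le> b \<longrightarrow>
     norm (pr (h v - h u) (f x) - (G v - G u)) \<le> e * (s v - s u))"

lemma approx_primitiveD:
  assumes "approx_primitive pr f h s G e a b" "x \<in> {a..b}"
  obtains \<delta> where "\<delta> > 0" "\<forall>u v. a \<le> u \<and> x - \<delta> < u \<and> u \<le> x \<and> x \<le> v \<and> v < x + \<delta> \<and> v \<le> b \<longrightarrow>
     norm (pr (h v - h u) (f x) - (G v - G u)) \<le> e * (s v - s u)"
  using bspec[OF assms(1)[unfolded approx_primitive_def] assms(2)] by (elim exE conjE) (rule that)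

lemma approx_primitive_subinterval:
  assumes "approx_primitive pr f h s G e a b" "a \<le> a'" "b' \<le> b"
  shows "approx_primitive pr f h s G e a' b'"
  unfolding approx_primitive_def
proof
  fix x assume x: "x \<in> {a'..b'}"
  then have "x \<in> {a..b}" using assms by auto
  from approx_primitiveD[OF assms(1) this] obtain \<delta> where "\<delta> > 0"
    "\<forall>u v. a \<le> u \<and> x - \<delta> < u \<and> u \<le> x \<and> x \<le> v \<and> v < x + \<delta> \<and> v \<le> b \<longrightarrow>
     norm (pr (h v - h u) (f x) - (G v - G u)) \<le> e * (s v - s u)" by blast
  then show "\<exists>\<delta>>0. \<forall>u v. a' \<le> u \<and> x - \<delta> < u \<and> u \<le> x \<and> x \<le> v \<and> v < x + \<delta> \<and> v \<le> b' \<longrightarrow>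
     norm (pr (h v - h u) (f x) - (G v - G u)) \<le> e * (s v - s u)"
    using assms by (intro exI[of _ \<delta>]) auto
qed

lemma approx_primitive_cong:
  assumes "approx_primitive pr f h s G e a b"
    and "\<And>t. a \<le> t \<Longrightarrow> t \<le> b \<Longrightarrow> G' t = G t + c"
  shows "approx_primitive pr f h s G' e a b"
  unfolding approx_primitive_def
proof
  fix x assume x: "x \<in> {a..b}"
  from approx_primitiveD[OF assms(1) this] obtain \<delta> where "\<delta> > 0"
    "\<forall>u v. a \<le> u \<and> x - \<delta> < u \<and> u \<le> x \<and> x \<le> v \<and> v < x + \<delta> \<and> v \<le> b \<longrightarrow>
     norm (pr (h v - h u) (f x) - (G v - G u)) \<le> e * (s v - s u)" by blast
  then show "\<exists>\<delta>>0. \<forall>u v. a \<le> u \<and> x - \<delta> < u \<and> u \<le> x \<and> x \<le> v \<and> v < x + \<delta> \<and> v \<le> b \<longrightarrow>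
     norm (pr (h v - h u) (f x) - (G' v - G' u)) \<le> e * (s v - s u)"
    using assms(2) by (intro exI[of _ \<delta>]) auto
qed

text \<open>Bisection: by the triangle inequality the estimate is inherited when adjacent intervals
  are joined, so a failure would persist on arbitrarily small intervals around some
  \<open>x\<close>. Those intervals contain \<open>x\<close>, which is the only kind the local
  hypothesis has to treat, just as for tagged intervals.\<close>

lemma norm_increment_le_if_locally:
  fixes G :: "real \<Rightarrow> 'b::real_normed_vector"
  assumes "a \<le> b"
    and local: "\<And>x. a \<le> x \<Longrightarrow> x \<le> b \<Longrightarrow> \<exists>\<delta>>0. \<forall>u v. a \<le> u \<and> x - \<delta> < u \<and> u \<le> x \<and> x \<le> v \<and> v < x + \<delta> \<and> v \<le> b
      \<longrightarrow> norm (G v - G u) \<le> S v - S u"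
  shows "norm (G b - G a) \<le> (S b - S a :: real)"
proof -
  define P where "P u v \<longleftrightarrow> a \<le> u \<longrightarrow> v \<le> b \<longrightarrow> norm (G v - G u) \<le> S v - S u" for u v
  have "P a b"
    using \<open>a \<le> b\<close>
  proof (induction rule: Bolzano)
    case (trans x y z)
    then show ?case using norm_triangle_ineq[of "G z - G y" "G y - G x"] by (auto simp: P_def)
  next
    case (local x)
    then obtain \<delta> where "\<delta> > 0" "\<forall>u v. a \<le> u \<and> x - \<delta> < u \<and> u \<le> x \<and> x \<le> v \<and> v < x + \<delta> \<and> v \<le> b
      \<longrightarrow> norm (G v - G u) \<le> S v - S u" using assms(2) by blast
    then show ?case by (intro exI[of _ \<delta>]) (auto simp: P_def)
  qed
  then show ?thesis by (simp add: P_def)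
qed

text \<open>Near a tag both increments are compared with the same term
  \<open>pr (h v - h u) (f x)\<close>, which cancels. The result gives uniqueness of increments as
  well as the Cauchy property of successive approximations.\<close>

lemma approx_primitive_diff_le:
  assumes "a \<le> b" "approx_primitive pr f h s G e a b" "approx_primitive pr f h s G' e' a b"
  shows "norm ((G b - G a) - (G' b - G' a)) \<le> (e + e') * (s b - s a)"
proof -
  have "norm ((G b - G' b) - (G a - G' a)) \<le> (e + e') * s b - (e + e') * s a"
  proof (rule norm_increment_le_if_locally[OF \<open>a \<le> b\<close>])
    fix x assume "a \<le> x" "x \<le> b"
    then have x: "x \<in> {a..b}" by auto
    obtain \<delta> where 1: "\<delta> > 0"
      "\<forall>u v. a \<le> u \<and> x - \<delta> < u \<and> u \<le> x \<and> x \<le> v \<and> v < x + \<delta> \<and> v \<le> b \<longrightarrow>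
       norm (pr (h v - h u) (f x) - (G v - G u)) \<le> e * (s v - s u)"
      using approx_primitiveD[OF assms(2) x] by blast
    obtain \<delta>' where 2: "\<delta>' > 0"
      "\<forall>u v. a \<le> u \<and> x - \<delta>' < u \<and> u \<le> x \<and> x \<le> v \<and> v < x + \<delta>' \<and> v \<le> b \<longrightarrow>
       norm (pr (h v - h u) (f x) - (G' v - G' u)) \<le> e' * (s v - s u)"
      using approx_primitiveD[OF assms(3) x] by blast
    have "norm ((G v - G' v) - (G u - G' u)) \<le> (e + e') * s v - (e + e') * s u"
      if "a \<le> u" "x - min \<delta> \<delta>' < u" "u \<le> x" "x \<le> v" "v < x + min \<delta> \<delta>'" "v \<le> b" for u v
    proof -
      have "(G v - G' v) - (G u - G' u) = (pr (h v - h u) (f x) - (G' v - G' u)) -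
          (pr (h v - h u) (f x) - (G v - G u))" by simp
      moreover have "norm (pr (h v - h u) (f x) - (G v - G u)) \<le> e * (s v - s u)"
        using that by (intro 1(2)[rule_format]) auto
      moreover have "norm (pr (h v - h u) (f x) - (G' v - G' u)) \<le> e' * (s v - s u)"
        using that by (intro 2(2)[rule_format]) auto
      ultimately show ?thesis
        using norm_triangle_ineq4[of "pr (h v - h u) (f x) - (G' v - G' u)" "pr (h v - h u) (f x) - (G v - G u)"]
        by (simp add: algebra_simps)
    qed
    then show "\<exists>\<delta>>0. \<forall>u v. a \<le> u \<and> x - \<delta> < u \<and> u \<le> x \<and> x \<le> v \<and> v < x + \<delta> \<and> v \<le> b
      \<longrightarrow> norm ((G v - G' v) - (G u - G' u)) \<le> (e + e') * s v - (e + e') * s u"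
      using 1(1) 2(1) by (intro exI[of _ "min \<delta> \<delta>'"]) auto
  qed
  moreover have "(G b - G' b) - (G a - G' a) = (G b - G a) - (G' b - G' a)" by simp
  ultimately show ?thesis by (simp add: algebra_simps)
qed

section \<open>Gluing and existence of primitives\<close>

lemma diff_min_less_iff: "(x::real) - min d d' < u \<longleftrightarrow> x - d < u \<and> x - d' < u"
  by (auto simp: min_def)

lemma less_add_min_iff: "(v::real) < x + min d d' \<longleftrightarrow> v < x + d \<and> v < x + d'"
  by (auto simp: min_def)

lemma approx_primitive_concat:
  assumes pr: "bounded_bilinear pr" and "a \<le> b" "b \<le> c"
    and 1: "approx_primitive pr f h s G e a b" and 2: "approx_primitive pr f h s G' e b c"
  shows "approx_primitive pr f h s (\<lambda>t. if t \<le> b then G t else G' t + (G b - G' b)) e a c"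
    (is "approx_primitive _ _ _ _ ?H _ _ _")
  unfolding approx_primitive_def
proof
  fix x assume x: "x \<in> {a..c}"
  consider "x < b" | "x = b" | "x > b" by linarith
  then show "\<exists>\<delta>>0. \<forall>u v. a \<le> u \<and> x - \<delta> < u \<and> u \<le> x \<and> x \<le> v \<and> v < x + \<delta> \<and> v \<le> c \<longrightarrow>
     norm (pr (h v - h u) (f x) - (?H v - ?H u)) \<le> e * (s v - s u)"
  proof cases
    case l: 1
    then have "x \<in> {a..b}" using x by auto
    from approx_primitiveD[OF 1 this] obtain \<delta> where "\<delta> > 0"
      "\<forall>u v. a \<le> u \<and> x - \<delta> < u \<and> u \<le> x \<and> x \<le> v \<and> v < x + \<delta> \<and> v \<le> b \<longrightarrow>
       norm (pr (h v - h u) (f x) - (G v - G u)) \<le> e * (s v - s u)" by blast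
    then show ?thesis using l by (intro exI[of _ "min \<delta> (b - x)"]) (auto simp: diff_min_less_iff less_add_min_iff)
  next
    case l: 3
    then have "x \<in> {b..c}" using x by auto
    from approx_primitiveD[OF 2 this] obtain \<delta> where "\<delta> > 0"
      "\<forall>u v. b \<le> u \<and> x - \<delta> < u \<and> u \<le> x \<and> x \<le> v \<and> v < x + \<delta> \<and> v \<le> c \<longrightarrow>
       norm (pr (h v - h u) (f x) - (G' v - G' u)) \<le> e * (s v - s u)" by blast
    then show ?thesis using l by (intro exI[of _ "min \<delta> (x - b)"]) (auto simp: diff_min_less_iff less_add_min_iff)
  next
    case l: 2
    have x1: "x \<in> {a..b}" and x2: "x \<in> {b..c}" using x l by auto
    obtain \<delta> where d: "\<delta> > 0"
      "\<forall>u v. a \<le> u \<and> x - \<delta> < u \<and> u \<le> x \<and> x \<le> v \<and> v < x + \<delta> \<and> v \<le> b \<longrightarrow>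
       norm (pr (h v - h u) (f x) - (G v - G u)) \<le> e * (s v - s u)"
      using approx_primitiveD[OF 1 x1] by blast
    obtain \<delta>' where d': "\<delta>' > 0"
      "\<forall>u v. b \<le> u \<and> x - \<delta>' < u \<and> u \<le> x \<and> x \<le> v \<and> v < x + \<delta>' \<and> v \<le> c \<longrightarrow>
       norm (pr (h v - h u) (f x) - (G' v - G' u)) \<le> e * (s v - s u)"
      using approx_primitiveD[OF 2 x2] by blast
    have "norm (pr (h v - h u) (f x) - (?H v - ?H u)) \<le> e * (s v - s u)"
      if "a \<le> u" "x - min \<delta> \<delta>' < u" "u \<le> x" "x \<le> v" "v < x + min \<delta> \<delta>'" "v \<le> c" for u v
    proof -
      \<comment> \<open>The tag is the gluing point, so it cuts the interval into two halves. Each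
        half is controlled by its own primitive, and \<open>pr\<close> is additive in the increment
        of \<open>h\<close>.\<close>
      have "norm (pr (h x - h u) (f x) - (G x - G u)) \<le> e * (s x - s u)"
        using that d(1) l by (intro d(2)[rule_format]) auto
      moreover have "norm (pr (h v - h x) (f x) - (G' v - G' x)) \<le> e * (s v - s x)"
        using that d'(1) l by (intro d'(2)[rule_format]) auto
      moreover have "pr (h v - h u) (f x) - (?H v - ?H u) =
        (pr (h x - h u) (f x) - (G x - G u)) + (pr (h v - h x) (f x) - (G' v - G' x))"
        using that l by (simp add: bounded_bilinear.diff_left[OF pr])
      ultimately have "norm (pr (h v - h u) (f x) - (?H v - ?H u)) \<le> e * (s x - s u) + e * (s v - s x)"
        by (simp only: norm_triangle_mono)
      then show ?thesis by (simp add: algebra_simps)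
    qed
    then show ?thesis using d(1) d'(1) by (intro exI[of _ "min \<delta> \<delta>'"]) auto
  qed
qed

text \<open>The abstraction covers three products: operators scaled by increments of a curve,
  vectors scaled in the same way, and real densities multiplied by increments of \<open>s\<close>
  itself, where \<open>h = s\<close>.\<close>

locale dominated_integrator =
  fixes pr :: "'d::real_normed_vector \<Rightarrow> 'b::banach \<Rightarrow> 'b" and h :: "real \<Rightarrow> 'd" and s :: "real \<Rightarrow> real"
  assumes pr: "bounded_bilinear pr"
    and norm_pr: "norm (pr a x) \<le> norm a * norm x"
    and increment_le: "0 \<le> u \<Longrightarrow> u \<le> v \<Longrightarrow> v \<le> 1 \<Longrightarrow> norm (h v - h u) \<le> s v - s u"
begin

lemma s_mono: "0 \<le> u \<Longrightarrow> u \<le> v \<Longrightarrow> v \<le> 1 \<Longrightarrow> s u \<le> s v"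
  using increment_le[of u v] norm_ge_zero[of "h v - h u"] by linarith

text \<open>Where \<open>f\<close> deviates from \<open>f x\<close> by less than \<open>e\<close>,
  the function \<open>pr (h t) (f x)\<close> of \<open>t\<close> is a primitive up to the error
  \<open>e\<close>. Bisection and gluing extend this to the whole interval, by continuity of
  \<open>f\<close>.\<close>

lemma ex_approx_primitive:
  assumes "0 \<le> a" "a \<le> b" "b \<le> 1" and f: "continuous_on {a..b} f" and "e > 0"
  shows "\<exists>G. approx_primitive pr f h s G e a b"
proof -
  define P where "P u v \<longleftrightarrow> a \<le> u \<longrightarrow> v \<le> b \<longrightarrow> (\<exists>G. approx_primitive pr f h s G e u v)" for u v
  have "P a b"
    using \<open>a \<le> b\<close>
  proof (induction rule: Bolzano)
    case (trans x y z)
    show ?case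
      unfolding P_def
    proof (intro impI)
      assume "a \<le> x" "z \<le> b"
      with trans obtain G G' where "approx_primitive pr f h s G e x y" "approx_primitive pr f h s G' e y z"
        unfolding P_def by (meson order_trans)
      from approx_primitive_concat[OF pr \<open>x \<le> y\<close> \<open>y \<le> z\<close> this]
      show "\<exists>G. approx_primitive pr f h s G e x z" by blast
    qed
  next
    case (local x)
    then obtain \<delta> where d: "\<delta> > 0" "\<And>y. y \<in> {a..b} \<Longrightarrow> dist y x < \<delta> \<Longrightarrow> dist (f y) (f x) < e"
      using f[unfolded continuous_on_iff, rule_format, of x e] \<open>e > 0\<close> by auto
    have "approx_primitive pr f h s (\<lambda>t. pr (h t) (f x)) e u v"
      if uv: "u \<le> x" "x \<le> v" "v - u < \<delta>" "a \<le> u" "v \<le> b" for u v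
      unfolding approx_primitive_def
    proof (intro ballI exI[of _ 1] conjI allI impI)
      fix y u' v' assume y: "y \<in> {u..v}"
        and "u \<le> u' \<and> y - 1 < u' \<and> u' \<le> y \<and> y \<le> v' \<and> v' < y + 1 \<and> v' \<le> v"
      then have "u' \<le> v'" "0 \<le> u'" "v' \<le> 1" using assms uv by auto
      have "pr (h v' - h u') (f y) - (pr (h v') (f x) - pr (h u') (f x)) = pr (h v' - h u') (f y - f x)"
        by (simp add: bounded_bilinear.diff_left[OF pr] bounded_bilinear.diff_right[OF pr])
      moreover have "dist (f y) (f x) < e" using y uv by (intro d) (auto simp: dist_real_def)
      moreover have "norm (h v' - h u') * norm (f y - f x) \<le> (s v' - s u') * e"
        using \<open>dist (f y) (f x) < e\<close> increment_le[OF \<open>0 \<le> u'\<close> \<open>u' \<le> v'\<close> \<open>v' \<le> 1\<close>]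
        by (intro mult_mono) (auto simp: dist_norm s_mono \<open>0 \<le> u'\<close> \<open>u' \<le> v'\<close> \<open>v' \<le> 1\<close>)
      ultimately show "norm (pr (h v' - h u') (f y) - (pr (h v') (f x) - pr (h u') (f x)))
          \<le> e * (s v' - s u')"
        using norm_pr[of "h v' - h u'" "f y - f x"] by (simp add: mult.commute)
    qed simp
    then show ?case using d(1) unfolding P_def by (intro exI[of _ \<delta>]) blast
  qed
  then show ?thesis by (simp add: P_def)
qed

text \<open>Approximate primitives for the errors 1/(n+1), normalized to vanish at \<open>a\<close>,
  form a pointwise Cauchy sequence. The distance of their increments is bounded by a multiple of the
  increment of \<open>s\<close>, and this form of the bound survives in the limit and makes the
  limit a primitive for every error.\<close>

lemma ex_primitive:
  assumes ab: "0 \<le> a" "a \<le> b" "b \<le> 1" and f: "continuous_on {a..b} f"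
  shows "\<exists>G. \<forall>e>0. approx_primitive pr f h s G e a b"
proof -
  have "\<forall>n. \<exists>G. approx_primitive pr f h s G (1 / real (Suc n)) a b"
    using ex_approx_primitive[OF assms] by simp
  then obtain G where G: "\<And>n. approx_primitive pr f h s (G n) (1 / real (Suc n)) a b"
    by metis
  define H where "H n t = G n t - G n a" for n t
  have diff: "norm ((H m v - H m u) - (H n v - H n u)) \<le> (1 / real (Suc m) + 1 / real (Suc n)) * (s v - s u)"
    if "a \<le> u" "u \<le> v" "v \<le> b" for m n u v
    using approx_primitive_diff_le[OF \<open>u \<le> v\<close> approx_primitive_subinterval[OF G[of m]]
        approx_primitive_subinterval[OF G[of n]]] that by (simp add: H_def)
  have "Cauchy (\<lambda>n. H n t)" if t: "a \<le> t" "t \<le> b" for t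
  proof (rule metric_CauchyI)
    fix e :: real assume "e > 0"
    define K where "K = s t - s a + 1"
    have K: "K > 0" using s_mono[of a t] t ab by (simp add: K_def)
    obtain M where "inverse (real (Suc M)) < e / (2 * K)"
      using reals_Archimedean[of "e / (2 * K)"] K \<open>e > 0\<close> by auto
    then have M: "2 / real (Suc M) * K < e" using K by (simp add: field_simps)
    have "dist (H m t) (H n t) < e" if "M \<le> m" "M \<le> n" for m n
    proof -
      have "dist (H m t) (H n t) \<le> (1 / real (Suc m) + 1 / real (Suc n)) * (s t - s a)"
        using diff[of a t m n] t by (simp add: dist_norm H_def)
      also have "\<dots> \<le> (1 / real (Suc M) + 1 / real (Suc M)) * K"
        using that K s_mono[of a t] t ab
        by (intro mult_mono add_mono divide_left_mono) (auto simp: K_def)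
      finally show ?thesis using M by simp
    qed
    then show "\<exists>M. \<forall>m\<ge>M. \<forall>n\<ge>M. dist (H m t) (H n t) < e" by blast
  qed
  then have "\<forall>t. \<exists>L. a \<le> t \<and> t \<le> b \<longrightarrow> (\<lambda>n. H n t) \<longlonglongrightarrow> L"
    by (metis Cauchy_convergent_iff convergent_def)
  then obtain L where L: "\<And>t. a \<le> t \<Longrightarrow> t \<le> b \<Longrightarrow> (\<lambda>n. H n t) \<longlonglongrightarrow> L t"
    by metis
  have diffL: "norm ((L v - L u) - (H n v - H n u)) \<le> 1 / real (Suc n) * (s v - s u)"
    if "a \<le> u" "u \<le> v" "v \<le> b" for n u v
  proof -
    have "norm ((L v - L u) - (H n v - H n u)) \<le> (0 + 1 / real (Suc n)) * (s v - s u)"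
    proof (rule LIMSEQ_le[OF _ _ exI[of _ 0]])
      show "(\<lambda>m. norm ((H m v - H m u) - (H n v - H n u))) \<longlonglongrightarrow> norm ((L v - L u) - (H n v - H n u))"
        using that by (intro tendsto_intros L) auto
      show "(\<lambda>m. (1 / real (Suc m) + 1 / real (Suc n)) * (s v - s u)) \<longlonglongrightarrow>
          (0 + 1 / real (Suc n)) * (s v - s u)"
        by (intro tendsto_intros LIMSEQ_Suc[OF lim_1_over_n])
    qed (use diff that in auto)
    then show ?thesis by simp
  qed
  have "approx_primitive pr f h s L e a b" if "e > 0" for e
    unfolding approx_primitive_def
  proof
    fix x assume x: "x \<in> {a..b}"
    obtain n where "inverse (real (Suc n)) < e / 2"
      using reals_Archimedean[of "e / 2"] \<open>e > 0\<close> by auto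
    \<comment> \<open>Two errors of size 1/(n+1) add up: that of the approximate primitive
      \<open>G n\<close>, and that of replacing its increments by those of the limit
      \<open>L\<close>.\<close>
    then have n: "2 / real (Suc n) \<le> e" by (simp add: field_simps)
    obtain \<delta> where d: "\<delta> > 0"
      "\<forall>u v. a \<le> u \<and> x - \<delta> < u \<and> u \<le> x \<and> x \<le> v \<and> v < x + \<delta> \<and> v \<le> b \<longrightarrow>
       norm (pr (h v - h u) (f x) - (G n v - G n u)) \<le> 1 / real (Suc n) * (s v - s u)"
      using approx_primitiveD[OF G[of n] x] by blast
    have "norm (pr (h v - h u) (f x) - (L v - L u)) \<le> e * (s v - s u)"
      if uv: "a \<le> u" "x - \<delta> < u" "u \<le> x" "x \<le> v" "v < x + \<delta>" "v \<le> b" for u v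
    proof -
      have eq: "pr (h v - h u) (f x) - (L v - L u) = (pr (h v - h u) (f x) - (G n v - G n u))
          - ((L v - L u) - (H n v - H n u))" by (simp add: H_def)
      have "norm (pr (h v - h u) (f x) - (L v - L u)) \<le>
          1 / real (Suc n) * (s v - s u) + 1 / real (Suc n) * (s v - s u)"
        unfolding eq using uv
        by (intro order_trans[OF norm_triangle_ineq4 add_mono] d(2)[rule_format] diffL) auto
      also have "\<dots> = 2 / real (Suc n) * (s v - s u)" by (simp add: algebra_simps)
      also have "\<dots> \<le> e * (s v - s u)"
        using n s_mono[of u v] uv ab by (intro mult_right_mono) auto
      finally show ?thesis .
    qed
    then show "\<exists>\<delta>>0. \<forall>u v. a \<le> u \<and> x - \<delta> < u \<and> u \<le> x \<and> x \<le> v \<and> v < x + \<delta> \<and> v \<le> b \<longrightarrow>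
     norm (pr (h v - h u) (f x) - (L v - L u)) \<le> e * (s v - s u)"
      using d(1) by blast
  qed
  then show ?thesis by blast
qed

lemma primitive_increment_unique:
  assumes "a \<le> b" "\<And>e. e > 0 \<Longrightarrow> approx_primitive pr f h s G e a b"
    "\<And>e. e > 0 \<Longrightarrow> approx_primitive pr f h s G' e a b"
  shows "G b - G a = G' b - G' a"
proof -
  have "norm ((G b - G a) - (G' b - G' a)) \<le> 0"
  proof (rule le_if_le_add_small_multiple)
    fix e :: real assume "e > 0"
    then show "norm ((G b - G a) - (G' b - G' a)) \<le> 0 + e * (2 * (s b - s a))"
      using approx_primitive_diff_le[OF assms(1) assms(2)[of e] assms(3)[of e]] by (simp add: algebra_simps)
  qed
  then show ?thesis by simp
qed

end

section \<open>Stieltjes integrals from primitives\<close>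

lemma stieltjes_sum_diff_le:
  assumes p: "p tagged_division_of {0..1::real}"
    and le: "\<And>x k. (x, k) \<in> p \<Longrightarrow>
      norm (pr (h (Sup k) - h (Inf k)) (f x) - (G (Sup k) - G (Inf k))) \<le> t (Sup k) - t (Inf k)"
  shows "norm (stieltjes_sum pr f h p - (G 1 - G 0)) \<le> t 1 - (t 0 :: real)"
proof -
  have "stieltjes_sum pr f h p - (G 1 - G 0) =
      stieltjes_sum pr f h p - (\<Sum>(x, k)\<in>p. G (Sup k) - G (Inf k))"
    using additive_tagged_division_1[OF _ p, of G] by simp
  also have "\<dots> = (\<Sum>(x, k)\<in>p. pr (h (Sup k) - h (Inf k)) (f x) - (G (Sup k) - G (Inf k)))"
    by (simp add: stieltjes_sum_def case_prod_unfold sum_subtractf)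
  also have "norm \<dots> \<le> (\<Sum>(x, k)\<in>p. t (Sup k) - t (Inf k))"
    by (rule sum_norm_le) (use le in auto)
  also have "\<dots> = t 1 - t 0"
    using additive_tagged_division_1[OF _ p, of t] by simp
  finally show ?thesis .
qed

lemma tagged_division_of_unit_intervalD:
  assumes p: "p tagged_division_of {0..1::real}" and "(x, k) \<in> p"
  shows "0 \<le> Inf k" "Inf k \<le> x" "x \<le> Sup k" "Sup k \<le> 1" "Inf k \<in> k" "Sup k \<in> k" "x \<in> k"
proof -
  obtain a b where k: "k = {a..b}"
    using tagged_division_ofD(4)[OF p \<open>(x, k) \<in> p\<close>] by (metis box_real(2))
  moreover have "x \<in> k" "k \<subseteq> {0..1}"
    using tagged_division_ofD(2,3)[OF p \<open>(x, k) \<in> p\<close>] by auto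
  ultimately show "0 \<le> Inf k" "Inf k \<le> x" "x \<le> Sup k" "Sup k \<le> 1" "Inf k \<in> k" "Sup k \<in> k" "x \<in> k"
    by auto
qed

text \<open>The radii supplied by the primitive form the gauge. The function \<open>s\<close> is
  arbitrary here, which later permits a bound with jumps at both ends of the interval.\<close>

lemma has_stieltjes_integral_if_approx_primitive:
  assumes "\<And>e. e > 0 \<Longrightarrow> approx_primitive pr f h s G e 0 1"
  shows "has_stieltjes_integral pr f h (G 1 - G 0)"
  unfolding has_stieltjes_integral_iff
proof (intro allI impI)
  fix e :: real assume "e > 0"
  \<comment> \<open>The increment of \<open>s\<close> may vanish or be negative; its absolute value
    plus 1 is a positive strict upper bound.\<close>
  define K where "K = \<bar>s 1 - s 0\<bar> + 1"
  have K: "K > 0" "s 1 - s 0 < K" by (auto simp: K_def)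
  then have eK: "e / K > 0" using \<open>e > 0\<close> by simp
  have "\<forall>x. \<exists>\<delta>>0. x \<in> {0..1} \<longrightarrow> (\<forall>u v.
     0 \<le> u \<and> x - \<delta> < u \<and> u \<le> x \<and> x \<le> v \<and> v < x + \<delta> \<and> v \<le> 1 \<longrightarrow>
     norm (pr (h v - h u) (f x) - (G v - G u)) \<le> e / K * (s v - s u))"
    using assms[OF eK] zero_less_one unfolding approx_primitive_def by blast
  then obtain \<delta> where \<delta>: "\<forall>x. \<delta> x > 0 \<and> (x \<in> {0..1} \<longrightarrow> (\<forall>u v.
     0 \<le> u \<and> x - \<delta> x < u \<and> u \<le> x \<and> x \<le> v \<and> v < x + \<delta> x \<and> v \<le> 1 \<longrightarrow>
     norm (pr (h v - h u) (f x) - (G v - G u)) \<le> e / K * (s v - s u)))"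
    by (rule choice[THEN exE])
  have "norm (stieltjes_sum pr f h p - (G 1 - G 0)) < e"
    if p: "p tagged_division_of {0..1}" "(\<lambda>x. ball x (\<delta> x)) fine p" for p
  proof -
    have "norm (stieltjes_sum pr f h p - (G 1 - G 0)) \<le> e / K * s 1 - e / K * s 0"
    proof (rule stieltjes_sum_diff_le[OF p(1)])
      fix x k assume xk: "(x, k) \<in> p"
      note D = tagged_division_of_unit_intervalD[OF p(1) xk]
      have "k \<subseteq> ball x (\<delta> x)" using p(2) xk by (auto simp: fine_def)
      then have "Inf k \<in> ball x (\<delta> x)" "Sup k \<in> ball x (\<delta> x)" using D by auto
      then have "x - \<delta> x < Inf k" "Sup k < x + \<delta> x" by (auto simp: dist_real_def)
      then show "norm (pr (h (Sup k) - h (Inf k)) (f x) - (G (Sup k) - G (Inf k))) \<le>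
          e / K * s (Sup k) - e / K * s (Inf k)"
        using \<delta>[rule_format, THEN conjunct2, rule_format, of x "Inf k" "Sup k"] D by (simp add: algebra_simps)
    qed
    also have "\<dots> = e / K * (s 1 - s 0)" by (simp add: algebra_simps)
    also have "\<dots> < e / K * K" using eK K by (intro mult_strict_left_mono)
    also have "\<dots> = e" using K by simp
    finally show ?thesis .
  qed
  moreover have "gauge (\<lambda>x. ball x (\<delta> x))" using \<delta> by (intro gauge_ball_dependent) blast
  ultimately show "\<exists>g. gauge g \<and> (\<forall>p. p tagged_division_of {0..1} \<and> g fine p \<longrightarrow>
      norm (stieltjes_sum pr f h p - (G 1 - G 0)) < e)" by blast
qed

text \<open>Completeness: convergence of the scalar majorant makes \<open>G\<close> Cauchy along the
  filter. This provides the operator-valued primitive with limits at the ends of the open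
  interval.\<close>

lemma tendsto_if_dominated_increments:
  fixes G :: "real \<Rightarrow> 'b::banach" and \<Phi> :: "real \<Rightarrow> real"
  assumes "F \<noteq> bot" and \<Phi>: "(\<Phi> \<longlongrightarrow> l) F" and ev: "eventually (\<lambda>t. t \<in> S) F"
    and le: "\<And>t u. t \<in> S \<Longrightarrow> u \<in> S \<Longrightarrow> norm (G t - G u) \<le> C * \<bar>\<Phi> t - \<Phi> u\<bar>"
  shows "\<exists>L. (G \<longlongrightarrow> L) F"
proof -
  have "cauchy_filter (filtermap G F)"
    unfolding cauchy_filter_metric_filtermap
  proof (intro allI impI)
    fix e :: real assume "e > 0"
    define M where "M = \<bar>C\<bar> + 1"
    have M: "M > 0" "C \<le> M" by (auto simp: M_def)
    define P where "P t \<longleftrightarrow> t \<in> S \<and> dist (\<Phi> t) l < e / (2 * M)" for t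
    have "eventually P F"
      unfolding P_def using ev tendstoD[OF \<Phi>, of "e / (2 * M)"] \<open>e > 0\<close> M
      by (intro eventually_conj) auto
    moreover have "dist (G x) (G y) < e" if "P x" "P y" for x y
    proof -
      have "\<bar>\<Phi> x - \<Phi> y\<bar> < e / M"
        using that dist_triangle_half_l[of "\<Phi> x" l "e / M" "\<Phi> y"] by (simp add: P_def dist_real_def dist_commute)
      then have "M * \<bar>\<Phi> x - \<Phi> y\<bar> < e" using M by (simp add: field_simps)
      moreover have "C * \<bar>\<Phi> x - \<Phi> y\<bar> \<le> M * \<bar>\<Phi> x - \<Phi> y\<bar>" using M by (intro mult_right_mono) auto
      ultimately show ?thesis using le[of x y] that by (simp add: dist_norm P_def)
    qed
    ultimately show "\<exists>P. eventually P F \<and> (\<forall>x y. P x \<and> P y \<longrightarrow> dist (G x) (G y) < e)" by blast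
  qed
  then obtain L where "filtermap G F \<le> nhds L"
    using cauchy_filter_complete_converges[of "filtermap G F" UNIV] \<open>F \<noteq> bot\<close>
    by (auto simp: complete_UNIV filtermap_bot_iff)
  then show ?thesis by (auto simp: filterlim_def)
qed

context dominated_integrator begin

text \<open>The open interval is exhausted by compact ones on which primitives exist. All of them
  contain 1/2, so after normalization at 1/2 uniqueness of increments makes the primitives
  agree.\<close>

lemma ex_primitive_open_interval:
  assumes f: "continuous_on {0<..<1} f"
  shows "\<exists>G. \<forall>a b. \<forall>e>0. 0 < a \<and> b < 1 \<longrightarrow> approx_primitive pr f h s G e a b"
proof -
  \<comment> \<open>The summand 3 keeps \<open>a n\<close> below 1/2 already for
    \<open>n = 0\<close>, so that every interval contains the point of normalization.\<close>
  define a where "a n = 1 / (real n + 3)" for n :: nat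
  have a: "0 < a n" "a n < 1/2" for n by (auto simp: a_def field_simps)
  have "\<exists>G. \<forall>e>0. approx_primitive pr f h s G e (a n) (1 - a n)" for n
    using a[of n] by (intro ex_primitive continuous_on_subset[OF f]) auto
  then have "\<exists>G. \<forall>n. \<forall>e>0. approx_primitive pr f h s (G n) e (a n) (1 - a n)"
    by (rule choice[OF allI])
  then obtain G where G: "\<And>n e. e > 0 \<Longrightarrow> approx_primitive pr f h s (G n) e (a n) (1 - a n)" by blast
  define N where "N t = (SOME n. a n \<le> t \<and> t \<le> 1 - a n)" for t
  define H where "H t = G (N t) t - G (N t) (1/2)" for t
  have ex: "\<exists>n. a n \<le> t \<and> u \<le> 1 - a n" if "0 < t" "u < 1" for t u
  proof -
    have "0 < min t (1 - u)" using that by simp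
    then obtain n where n: "inverse (real (Suc n)) < min t (1 - u)"
      using reals_Archimedean by blast
    have "a n \<le> inverse (real (Suc n))" by (simp add: a_def field_simps)
    with n show ?thesis by (intro exI[of _ n]) auto
  qed
  have H: "H t = G n t - G n (1/2)" if t: "a n \<le> t" "t \<le> 1 - a n" for n t
  proof -
    define m where "m = N t"
    have m: "a m \<le> t" "t \<le> 1 - a m"
      using someI_ex[OF ex[of t t]] that a[of n] unfolding m_def N_def by auto
    show ?thesis
    proof (cases "t \<le> 1/2")
      case True
      have "G m (1/2) - G m t = G n (1/2) - G n t"
        using True t m a(2)[of m] a(2)[of n]
        by (intro primitive_increment_unique[where f = f] approx_primitive_subinterval[OF G]) auto
      then show ?thesis by (simp add: H_def m_def algebra_simps)
    next
      case False
      have "G m t - G m (1/2) = G n t - G n (1/2)"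
        using False t m a(2)[of m] a(2)[of n]
        by (intro primitive_increment_unique[where f = f] approx_primitive_subinterval[OF G]) auto
      then show ?thesis by (simp add: H_def m_def algebra_simps)
    qed
  qed
  have "approx_primitive pr f h s H e u v" if "0 < u" "v < 1" "e > 0" for u v e
  proof -
    obtain n where "a n \<le> u" "v \<le> 1 - a n" using ex[OF \<open>0 < u\<close> \<open>v < 1\<close>] by blast
    then show ?thesis
      using H by (intro approx_primitive_cong[OF approx_primitive_subinterval[OF G[OF \<open>e > 0\<close>, of n]],
            where c = "- G n (1/2)"]) auto
  qed
  then show ?thesis by blast
qed

lemma primitive_increment_le:
  assumes "0 \<le> a" "a \<le> b" "b \<le> 1" and "0 \<le> C"
    and le: "\<And>x. a \<le> x \<Longrightarrow> x \<le> b \<Longrightarrow> norm (f x) \<le> C * \<phi> x"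
    and G: "\<And>e. e > 0 \<Longrightarrow> approx_primitive pr f h s G e a b"
    and \<Phi>: "\<And>e. e > 0 \<Longrightarrow> approx_primitive (*) \<phi> s s \<Phi> e a b"
  shows "norm (G b - G a) \<le> C * (\<Phi> b - \<Phi> a)"
proof (rule le_if_le_add_small_multiple)
  fix e :: real assume "e > 0"
  \<comment> \<open>Passing from the increment of \<open>G\<close> to the term with
    \<open>f x\<close> costs \<open>e\<close> times the increment of \<open>s\<close>; passing from
    the dominating term with \<open>\<phi> x\<close> to the increment of \<Phi> costs
    \<open>C * e\<close> times it. Together they make up the factor
    \<open>e * (C + 1)\<close>.\<close>
  define S where "S t = C * \<Phi> t + e * (C + 1) * s t" for t
  have "norm (G b - G a) \<le> S b - S a"
  proof (rule norm_increment_le_if_locally[OF \<open>a \<le> b\<close>])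
    fix x assume "a \<le> x" "x \<le> b"
    then have x: "x \<in> {a..b}" by auto
    obtain \<delta> where 1: "\<delta> > 0"
      "\<forall>u v. a \<le> u \<and> x - \<delta> < u \<and> u \<le> x \<and> x \<le> v \<and> v < x + \<delta> \<and> v \<le> b \<longrightarrow>
       norm (pr (h v - h u) (f x) - (G v - G u)) \<le> e * (s v - s u)"
      using approx_primitiveD[OF G[OF \<open>e > 0\<close>] x] by blast
    obtain \<delta>' where 2: "\<delta>' > 0"
      "\<forall>u v. a \<le> u \<and> x - \<delta>' < u \<and> u \<le> x \<and> x \<le> v \<and> v < x + \<delta>' \<and> v \<le> b \<longrightarrow>
       norm ((s v - s u) * \<phi> x - (\<Phi> v - \<Phi> u)) \<le> e * (s v - s u)"
      using approx_primitiveD[OF \<Phi>[OF \<open>e > 0\<close>] x] by blast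
    have "norm (G v - G u) \<le> S v - S u"
      if uv: "a \<le> u" "x - min \<delta> \<delta>' < u" "u \<le> x" "x \<le> v" "v < x + min \<delta> \<delta>'" "v \<le> b" for u v
    proof -
      have 11: "norm (pr (h v - h u) (f x) - (G v - G u)) \<le> e * (s v - s u)"
        using uv by (intro 1(2)[rule_format]) auto
      have 22: "(s v - s u) * \<phi> x \<le> (\<Phi> v - \<Phi> u) + e * (s v - s u)"
        using 2(2)[rule_format, of u v] uv by (auto simp: diff_min_less_iff less_add_min_iff)
      have "norm (pr (h v - h u) (f x)) \<le> norm (h v - h u) * norm (f x)" by (rule norm_pr)
      also have "\<dots> \<le> (s v - s u) * (C * \<phi> x)"
        using uv assms by (intro mult_mono increment_le le) (auto intro!: s_mono)
      also have "\<dots> = C * ((s v - s u) * \<phi> x)" by simp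
      also have "\<dots> \<le> C * ((\<Phi> v - \<Phi> u) + e * (s v - s u))"
        using 22 \<open>0 \<le> C\<close> by (rule mult_left_mono)
      finally have "norm (pr (h v - h u) (f x)) \<le> C * ((\<Phi> v - \<Phi> u) + e * (s v - s u))" .
      moreover have "norm (G v - G u) \<le> norm (pr (h v - h u) (f x)) + norm (pr (h v - h u) (f x) - (G v - G u))"
        using norm_triangle_sub[of "G v - G u" "pr (h v - h u) (f x)"] by (simp only: norm_minus_commute)
      ultimately have "norm (G v - G u) \<le> C * ((\<Phi> v - \<Phi> u) + e * (s v - s u)) + e * (s v - s u)"
        using 11 by linarith
      then show ?thesis by (simp add: S_def algebra_simps)
    qed
    then show "\<exists>\<delta>>0. \<forall>u v. a \<le> u \<and> x - \<delta> < u \<and> u \<le> x \<and> x \<le> v \<and> v < x + \<delta> \<and> v \<le> b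
      \<longrightarrow> norm (G v - G u) \<le> S v - S u"
      using 1(1) 2(1) by (intro exI[of _ "min \<delta> \<delta>'"]) auto
  qed
  then show "norm (G b - G a) \<le> C * (\<Phi> b - \<Phi> a) + e * ((C + 1) * (s b - s a))"
    by (simp add: S_def algebra_simps)
qed

end

text \<open>Truncating \<open>\<Phi>\<close> to \<open>[a, b]\<close> turns the tagged sums for \<open>J\<close> into upper bounds of its increment.\<close>

lemma primitive_increment_le_integral:
  fixes s \<phi> \<Phi> :: "real \<Rightarrow> real"
  assumes s_mono: "\<And>u v. 0 \<le> u \<Longrightarrow> u \<le> v \<Longrightarrow> v \<le> 1 \<Longrightarrow> s u \<le> s v"
    and nonneg: "\<And>t. 0 \<le> \<phi> t"
    and J: "has_stieltjes_integral (*) \<phi> s J"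
    and \<Phi>: "\<And>a b e. e > 0 \<Longrightarrow> 0 < a \<Longrightarrow> b < 1 \<Longrightarrow> approx_primitive (*) \<phi> s s \<Phi> e a b"
    and \<Phi>_mono: "\<And>u v. 0 < u \<Longrightarrow> u \<le> v \<Longrightarrow> v < 1 \<Longrightarrow> \<Phi> u \<le> \<Phi> v"
    and ab: "0 < a" "a \<le> b" "b < 1"
  shows "\<Phi> b - \<Phi> a \<le> J"
proof (rule le_if_le_add_small_multiple)
  fix e :: real assume "e > 0"
  define T where "T t = \<Phi> (max a (min b t))" for t
  have T: "T v - T u \<le> \<Phi> v - \<Phi> u" if "0 < u" "u \<le> v" "v < 1" for u v
    using that ab \<Phi>_mono[of u v] \<Phi>_mono[of u a] \<Phi>_mono[of b v] \<Phi>_mono[of a v] \<Phi>_mono[of u b]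
    by (auto simp: T_def max_def min_def)
  have "\<exists>\<delta>>0. \<forall>u v. 0 \<le> u \<and> x - \<delta> < u \<and> u \<le> x \<and> x \<le> v \<and> v < x + \<delta> \<and> v \<le> 1 \<longrightarrow>
     T v - T u \<le> (s v - s u) * \<phi> x + e * (s v - s u)" if x: "x \<in> {0..1}" for x
  proof -
    consider "x = 0" | "x = 1" | "0 < x" "x < 1" using x by force
    then show ?thesis
    proof cases
      case 1
      \<comment> \<open>An interval tagged at 0 and shorter than \<open>a\<close> lies where
        \<open>T\<close> is constant, so its increment of \<open>T\<close> is 0 and the right side
        is nonnegative whatever the value of \<phi> at 0. The tag 1 is treated in the same
        way.\<close>
      have "T v - T u \<le> (s v - s u) * \<phi> x + e * (s v - s u)"
        if "0 \<le> u \<and> x - a < u \<and> u \<le> x \<and> x \<le> v \<and> v < x + a \<and> v \<le> 1" for u v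
        using that 1 ab \<open>e > 0\<close> nonneg[of x] s_mono[of u v] by (auto simp: T_def)
      then show ?thesis using ab by blast
    next
      case 2
      have "T v - T u \<le> (s v - s u) * \<phi> x + e * (s v - s u)"
        if "0 \<le> u \<and> x - (1 - b) < u \<and> u \<le> x \<and> x \<le> v \<and> v < x + (1 - b) \<and> v \<le> 1" for u v
        using that 2 ab \<open>e > 0\<close> nonneg[of x] s_mono[of u v] by (auto simp: T_def)
      moreover have "1 - b > 0" using ab by simp
      ultimately show ?thesis by blast
    next
      case 3
      define c d where "c = x / 2" and "d = (x + 1) / 2"
      have cd: "0 < c" "c < x" "x < d" "d < 1" using 3 by (auto simp: c_def d_def)
      then have "x \<in> {c..d}" by simp
      from approx_primitiveD[OF \<Phi>[OF \<open>e > 0\<close> cd(1,4)] this] obtain \<delta> where \<delta>: "\<delta> > 0"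
        "\<forall>u v. c \<le> u \<and> x - \<delta> < u \<and> u \<le> x \<and> x \<le> v \<and> v < x + \<delta> \<and> v \<le> d \<longrightarrow>
           norm ((s v - s u) * \<phi> x - (\<Phi> v - \<Phi> u)) \<le> e * (s v - s u)" by blast
      define \<epsilon> where "\<epsilon> = min \<delta> (min (x - c) (d - x))"
      have "T v - T u \<le> (s v - s u) * \<phi> x + e * (s v - s u)"
        if uv: "0 \<le> u \<and> x - \<epsilon> < u \<and> u \<le> x \<and> x \<le> v \<and> v < x + \<epsilon> \<and> v \<le> 1" for u v
      proof -
        have "c \<le> u" "v \<le> d" "x - \<delta> < u" "v < x + \<delta>"
          using uv by (auto simp: \<epsilon>_def diff_min_less_iff less_add_min_iff)
        then have "norm ((s v - s u) * \<phi> x - (\<Phi> v - \<Phi> u)) \<le> e * (s v - s u)" using \<delta>(2) uv by blast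
        then show ?thesis using T[of u v] uv cd \<open>c \<le> u\<close> \<open>v \<le> d\<close> by (auto simp: abs_le_iff)
      qed
      moreover have "\<epsilon> > 0" using \<delta>(1) cd by (simp add: \<epsilon>_def)
      ultimately show ?thesis by blast
    qed
  qed
  then have "\<forall>x. \<exists>\<delta>>0. x \<in> {0..1} \<longrightarrow> (\<forall>u v. 0 \<le> u \<and> x - \<delta> < u \<and> u \<le> x \<and> x \<le> v \<and> v < x + \<delta> \<and> v \<le> 1 \<longrightarrow>
     T v - T u \<le> (s v - s u) * \<phi> x + e * (s v - s u))" using zero_less_one by blast
  then obtain \<delta> where \<delta>: "\<forall>x. \<delta> x > 0 \<and> (x \<in> {0..1} \<longrightarrow> (\<forall>u v. 0 \<le> u \<and> x - \<delta> x < u \<and> u \<le> x \<and> x \<le> v \<and> v < x + \<delta> x \<and> v \<le> 1 \<longrightarrow>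
     T v - T u \<le> (s v - s u) * \<phi> x + e * (s v - s u)))" by (rule choice[THEN exE])
  obtain g where g: "gauge g" "\<forall>p. p tagged_division_of {0..1} \<and> g fine p \<longrightarrow>
      norm (stieltjes_sum (*) \<phi> s p - J) < e"
    using J \<open>e > 0\<close> unfolding has_stieltjes_integral_iff by metis
  have "gauge (\<lambda>x. ball x (\<delta> x))" using \<delta> by (intro gauge_ball_dependent) blast
  from fine_division_exists_real[OF gauge_Int[OF g(1) this]]
  obtain p where p: "p tagged_division_of {0..1}" "(\<lambda>x. g x \<inter> ball x (\<delta> x)) fine p" by blast
  have "T 1 - T 0 = (\<Sum>(x, k)\<in>p. T (Sup k) - T (Inf k))"
    using additive_tagged_division_1[OF _ p(1), of T] by simp
  also have "\<dots> \<le> (\<Sum>(x, k)\<in>p. (s (Sup k) - s (Inf k)) * \<phi> x + e * (s (Sup k) - s (Inf k)))"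
  proof (rule sum_mono, clarify)
    fix x k assume xk: "(x, k) \<in> p"
    note D = tagged_division_of_unit_intervalD[OF p(1) xk]
    have "k \<subseteq> ball x (\<delta> x)" using p(2) xk by (auto simp: fine_def)
    then have "Inf k \<in> ball x (\<delta> x)" "Sup k \<in> ball x (\<delta> x)" using D by auto
    then have "x - \<delta> x < Inf k" "Sup k < x + \<delta> x" by (auto simp: dist_real_def)
    then show "T (Sup k) - T (Inf k) \<le> (s (Sup k) - s (Inf k)) * \<phi> x + e * (s (Sup k) - s (Inf k))"
      using \<delta>[rule_format, THEN conjunct2, rule_format, of x "Inf k" "Sup k"] D by simp
  qed
  also have "\<dots> = stieltjes_sum (*) \<phi> s p + e * (\<Sum>(x, k)\<in>p. s (Sup k) - s (Inf k))"
    by (simp add: stieltjes_sum_def case_prod_unfold sum.distrib sum_distrib_left)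
  also have "(\<Sum>(x, k)\<in>p. s (Sup k) - s (Inf k)) = s 1 - s 0"
    using additive_tagged_division_1[OF _ p(1), of s] by simp
  finally have "T 1 - T 0 \<le> stieltjes_sum (*) \<phi> s p + e * (s 1 - s 0)" .
  moreover have "norm (stieltjes_sum (*) \<phi> s p - J) < e" using g(2) p by (simp add: fine_Int)
  moreover have "T 1 - T 0 = \<Phi> b - \<Phi> a" using ab by (simp add: T_def)
  ultimately show "\<Phi> b - \<Phi> a \<le> J + e * (1 + (s 1 - s 0))"
    by (simp add: algebra_simps)
qed

context dominated_integrator begin

text \<open>The values of \<open>f\<close> at the end points are irrelevant: adding a unit jump at each of them
  to the variation bound absorbs the first and the last term of a tagged sum.\<close>

theorem has_stieltjes_integral_dominated:
  assumes f: "continuous_on {0<..<1} f" and \<phi>: "continuous_on {0<..<1} \<phi>"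
    and h: "continuous_on {0..1} h"
    and nonneg: "\<And>t. 0 \<le> \<phi> t" and "0 \<le> C"
    and le: "\<And>t. 0 < t \<Longrightarrow> t < 1 \<Longrightarrow> norm (f t) \<le> C * \<phi> t"
    and J: "has_stieltjes_integral (*) \<phi> s J"
  shows "\<exists>I. has_stieltjes_integral pr f h I \<and> norm I \<le> C * J"
proof -
  interpret s: dominated_integrator "(*)" s s
    by (rule dominated_integrator.intro) (auto simp: bounded_bilinear_mult abs_mult s_mono)
  obtain G where G: "\<And>a b e. e > 0 \<Longrightarrow> 0 < a \<Longrightarrow> b < 1 \<Longrightarrow> approx_primitive pr f h s G e a b"
    using ex_primitive_open_interval[OF f] by blast
  obtain \<Phi> where \<Phi>: "\<And>a b e. e > 0 \<Longrightarrow> 0 < a \<Longrightarrow> b < 1 \<Longrightarrow> approx_primitive (*) \<phi> s s \<Phi> e a b"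
    using s.ex_primitive_open_interval[OF \<phi>] by blast
  \<comment> \<open>Regarded as dominated by \<phi>, the zero function with its zero primitive
    yields the monotonicity of \<Phi>.\<close>
  have zero: "approx_primitive (*) (\<lambda>_. 0) s s (\<lambda>_. 0) e a b" if "e > 0" "0 < a" "b < 1" for a b e
    using that unfolding approx_primitive_def
    by (intro ballI exI[of _ 1] conjI allI impI) (auto intro!: mult_nonneg_nonneg s_mono)
  have \<Phi>_mono: "\<Phi> u \<le> \<Phi> v" if "0 < u" "u \<le> v" "v < 1" for u v
    using s.primitive_increment_le[of u v 1 "\<lambda>_. 0" \<phi> "\<lambda>_. 0" \<Phi>] that nonneg zero \<Phi> by simp
  have G_le: "norm (G v - G u) \<le> C * (\<Phi> v - \<Phi> u)" if "0 < u" "u \<le> v" "v < 1" for u v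
    using that by (intro primitive_increment_le[of u v C f \<phi>] le \<open>0 \<le> C\<close> G \<Phi>) auto
  have \<Phi>_le: "\<Phi> v - \<Phi> u \<le> J" if "0 < u" "u \<le> v" "v < 1" for u v
    by (rule primitive_increment_le_integral[OF s_mono nonneg J \<Phi> \<Phi>_mono that])
  have G_abs: "norm (G t - G u) \<le> C * \<bar>\<Phi> t - \<Phi> u\<bar>" if "t \<in> {0<..<1}" "u \<in> {0<..<1}" for t u
  proof (cases "u \<le> t")
    case True
    then show ?thesis using G_le[of u t] \<Phi>_mono[of u t] that by auto
  next
    case False
    then show ?thesis using G_le[of t u] \<Phi>_mono[of t u] that by (auto simp: norm_minus_commute)
  qed
  have ev0: "eventually (\<lambda>t. t \<in> {0<..<1::real}) (at_right 0)"
    unfolding eventually_at_right_field by (intro exI[of _ 1]) auto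
  have ev1: "eventually (\<lambda>t. t \<in> {0<..<1::real}) (at_left 1)"
    unfolding eventually_at_left_field by (intro exI[of _ 0]) auto
  \<comment> \<open>All increments of the monotone \<Phi> are at most \<open>J\<close>, so it has
    finite limits at both ends, and \<open>G\<close> inherits limits there by domination.\<close>
  have bdd: "bdd_below (\<Phi> ` {0<..<1})" "bdd_above (\<Phi> ` {0<..<1})"
  proof -
    have "\<bar>\<Phi> t - \<Phi> (1/2)\<bar> \<le> J" if "t \<in> {0<..<1}" for t
      using that \<Phi>_le[of t "1/2"] \<Phi>_le[of "1/2" t] \<Phi>_mono[of t "1/2"] \<Phi>_mono[of "1/2" t]
      by (cases "t \<le> 1/2") auto
    then have *: "\<Phi> (1/2) - J \<le> \<Phi> t" "\<Phi> t \<le> \<Phi> (1/2) + J" if "t \<in> {0<..<1}" for t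
      using that by (auto simp: abs_le_iff algebra_simps)
    show "bdd_below (\<Phi> ` {0<..<1})" by (rule bdd_belowI2[OF *(1)])
    show "bdd_above (\<Phi> ` {0<..<1})" by (rule bdd_aboveI2[OF *(2)])
  qed
  have ne: "{0<..<1::real} \<noteq> {}" by auto
  have "(\<Phi> \<longlongrightarrow> (INF t\<in>{0<..<1}. \<Phi> t)) (at_right 0)"
  proof (rule decreasing_tendsto)
    show "eventually (\<lambda>t. (INF t\<in>{0<..<1}. \<Phi> t) \<le> \<Phi> t) (at_right 0)"
      using ev0 by eventually_elim (rule cINF_lower[OF bdd(1)])
    fix y assume "(INF t\<in>{0<..<1}. \<Phi> t) < y"
    then obtain t where t: "t \<in> {0<..<1}" "\<Phi> t < y" using cINF_less_iff[OF ne bdd(1)] by blast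
    show "eventually (\<lambda>t. \<Phi> t < y) (at_right 0)"
      unfolding eventually_at_right_field
    proof (intro exI[of _ t] conjI allI impI)
      show "0 < t" using t by simp
      show "\<Phi> u < y" if "0 < u" "u < t" for u using \<Phi>_mono[of u t] t that by simp
    qed
  qed
  from tendsto_if_dominated_increments[where G = G and \<Phi> = \<Phi> and S = "{0<..<1}",
      OF trivial_limit_at_right_real this ev0 G_abs]
  obtain L0 where L0: "(G \<longlongrightarrow> L0) (at_right 0)" by blast
  have "(\<Phi> \<longlongrightarrow> (SUP t\<in>{0<..<1}. \<Phi> t)) (at_left 1)"
  proof (rule increasing_tendsto)
    show "eventually (\<lambda>t. \<Phi> t \<le> (SUP t\<in>{0<..<1}. \<Phi> t)) (at_left 1)"
      using ev1 by eventually_elim (rule cSUP_upper[OF _ bdd(2)])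
    fix y assume "y < (SUP t\<in>{0<..<1}. \<Phi> t)"
    then obtain t where t: "t \<in> {0<..<1}" "y < \<Phi> t" using less_cSUP_iff[OF ne bdd(2)] by blast
    show "eventually (\<lambda>t. y < \<Phi> t) (at_left 1)"
      unfolding eventually_at_left_field
    proof (intro exI[of _ t] conjI allI impI)
      show "t < 1" using t by simp
      show "y < \<Phi> u" if "t < u" "u < 1" for u using \<Phi>_mono[of t u] t that by simp
    qed
  qed
  from tendsto_if_dominated_increments[where G = G and \<Phi> = \<Phi> and S = "{0<..<1}",
      OF trivial_limit_at_left_real this ev1 G_abs]
  obtain L1 where L1: "(G \<longlongrightarrow> L1) (at_left 1)" by blast
  define H where "H t = (if t \<le> 0 then L0 else if 1 \<le> t then L1 else G t)" for t
  \<comment> \<open>The first jump occurs immediately after 0 and the second one at 1. Hence a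
    nondegenerate interval tagged at 0 or at 1 has an increment of \<open>r\<close> of at least
    1.\<close>
  define r where "r t = s t + (if 0 < t then 1 else 0) + (if 1 \<le> t then 1 else 0)" for t
  have s_le_r: "s v - s u \<le> r v - r u" if "u \<le> v" for u v
    using that by (auto simp: r_def)
  have "approx_primitive pr f h r H e 0 1" if "e > 0" for e
    unfolding approx_primitive_def
  proof
    fix x :: real assume x: "x \<in> {0..1}"
    define M where "M = norm (f x) + 1"
    have M: "M > 0" "norm (f x) \<le> M" by (auto simp: M_def add_nonneg_pos)
    \<comment> \<open>At an end point the value \<open>f x\<close> is unrelated to \<open>G\<close>,
      but it is a fixed value and \<open>h\<close> is continuous, so its term is at most
      \<open>e / 2\<close> on short intervals. The other half of \<open>e\<close> is left for the
      distance of \<open>G\<close> from its limit.\<close>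
    obtain \<delta>h where \<delta>h: "\<delta>h > 0" "\<forall>y\<in>{0..1}. dist y x < \<delta>h \<longrightarrow> dist (h y) (h x) < e / (2 * M)"
      using h[unfolded continuous_on_iff, rule_format, of x "e / (2 * M)"] x \<open>e > 0\<close> M by auto
    have small: "norm (pr (h v - h u) (f x)) \<le> e / 2"
      if "u \<in> {0..1}" "v \<in> {0..1}" "dist u x < \<delta>h" "dist v x < \<delta>h" "u = x \<or> v = x" for u v
    proof -
      have "norm (h v - h u) \<le> e / (2 * M)"
        using that \<delta>h(2) by (auto simp: dist_norm norm_minus_commute less_imp_le)
      then have "norm (h v - h u) * norm (f x) \<le> e / (2 * M) * M"
        using M \<open>e > 0\<close> by (intro mult_mono) auto
      also have "\<dots> = e / 2" using M by simp
      finally show ?thesis using norm_pr order_trans by blast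
    qed
    consider "x = 0" | "x = 1" | "0 < x" "x < 1" using x by force
    then show "\<exists>\<delta>>0. \<forall>u v. 0 \<le> u \<and> x - \<delta> < u \<and> u \<le> x \<and> x \<le> v \<and> v < x + \<delta> \<and> v \<le> 1 \<longrightarrow>
       norm (pr (h v - h u) (f x) - (H v - H u)) \<le> e * (r v - r u)"
    proof cases
      case 1
      obtain \<delta>0 where \<delta>0: "\<delta>0 > 0" "\<And>t. 0 < t \<Longrightarrow> t < \<delta>0 \<Longrightarrow> norm (G t - L0) < e / 2"
        using tendstoD[OF L0, of "e / 2"] \<open>e > 0\<close> by (auto simp: eventually_at_right_field dist_norm)
      define \<delta> where "\<delta> = min (min \<delta>h \<delta>0) 1"
      have "norm (pr (h v - h u) (f x) - (H v - H u)) \<le> e * (r v - r u)"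
        if uv: "0 \<le> u \<and> x - \<delta> < u \<and> u \<le> x \<and> x \<le> v \<and> v < x + \<delta> \<and> v \<le> 1" for u v
      proof (cases "v = 0")
        case True
        with uv 1 have "u = v" by auto
        then show ?thesis by (simp add: bounded_bilinear.zero_left[OF pr])
      next
        case False
        with uv 1 have v: "0 < v" "v < 1" "v < \<delta>0" "v < \<delta>h" and u: "u = 0" by (auto simp: \<delta>_def)
        have "norm (pr (h v - h u) (f x) - (H v - H u)) \<le> norm (pr (h v - h u) (f x)) + norm (G v - L0)"
          using v u norm_triangle_ineq4[of "pr (h v - h u) (f x)" "H v - H u"] by (simp add: H_def)
        also have "\<dots> \<le> e / 2 + e / 2"
          using small[of u v] 1 v u \<delta>0(2)[of v] by (intro add_mono) (auto simp: dist_real_def)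
        also have "\<dots> = e * 1" by simp
        also have "\<dots> \<le> e * (r v - r u)"
          using v u s_mono[of u v] \<open>e > 0\<close> by (intro mult_left_mono) (auto simp: r_def)
        finally show ?thesis .
      qed
      moreover have "\<delta> > 0" using \<delta>0 \<delta>h by (simp add: \<delta>_def)
      ultimately show ?thesis by blast
    next
      case 2
      obtain \<delta>1 where \<delta>1: "\<delta>1 < 1" "\<And>t. \<delta>1 < t \<Longrightarrow> t < 1 \<Longrightarrow> norm (G t - L1) < e / 2"
        using tendstoD[OF L1, of "e / 2"] \<open>e > 0\<close> by (auto simp: eventually_at_left_field dist_norm)
      define \<delta> where "\<delta> = min (min \<delta>h (1 - \<delta>1)) 1"
      have "norm (pr (h v - h u) (f x) - (H v - H u)) \<le> e * (r v - r u)"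
        if uv: "0 \<le> u \<and> x - \<delta> < u \<and> u \<le> x \<and> x \<le> v \<and> v < x + \<delta> \<and> v \<le> 1" for u v
      proof (cases "u = 1")
        case True
        with uv 2 have "u = v" by auto
        then show ?thesis by (simp add: bounded_bilinear.zero_left[OF pr])
      next
        case False
        with uv 2 have u: "0 < u" "u < 1" "\<delta>1 < u" "1 - u < \<delta>h" and v: "v = 1" by (auto simp: \<delta>_def)
        have "norm (pr (h v - h u) (f x) - (H v - H u)) \<le> norm (pr (h v - h u) (f x)) + norm (L1 - G u)"
          using v u norm_triangle_ineq4[of "pr (h v - h u) (f x)" "H v - H u"] by (simp add: H_def)
        also have "\<dots> \<le> e / 2 + e / 2"
          using small[of u v] 2 v u \<delta>1(2)[of u]
          by (intro add_mono) (auto simp: dist_real_def norm_minus_commute)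
        also have "\<dots> = e * 1" by simp
        also have "\<dots> \<le> e * (r v - r u)"
          using v u s_mono[of u v] \<open>e > 0\<close> by (intro mult_left_mono) (auto simp: r_def)
        finally show ?thesis .
      qed
      moreover have "\<delta> > 0" using \<delta>1 \<delta>h by (simp add: \<delta>_def)
      ultimately show ?thesis by blast
    next
      case 3
      define c d where "c = x / 2" and "d = (x + 1) / 2"
      have cd: "0 < c" "c < x" "x < d" "d < 1" using 3 by (auto simp: c_def d_def)
      then have "x \<in> {c..d}" by simp
      from approx_primitiveD[OF G[OF \<open>e > 0\<close> cd(1,4)] this] obtain \<delta> where \<delta>: "\<delta> > 0"
        "\<forall>u v. c \<le> u \<and> x - \<delta> < u \<and> u \<le> x \<and> x \<le> v \<and> v < x + \<delta> \<and> v \<le> d \<longrightarrow>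
           norm (pr (h v - h u) (f x) - (G v - G u)) \<le> e * (s v - s u)" by blast
      define \<epsilon> where "\<epsilon> = min \<delta> (min (x - c) (d - x))"
      have "norm (pr (h v - h u) (f x) - (H v - H u)) \<le> e * (r v - r u)"
        if uv: "0 \<le> u \<and> x - \<epsilon> < u \<and> u \<le> x \<and> x \<le> v \<and> v < x + \<epsilon> \<and> v \<le> 1" for u v
      proof -
        have cuvd: "c \<le> u" "v \<le> d" "x - \<delta> < u" "v < x + \<delta>"
          using uv by (auto simp: \<epsilon>_def diff_min_less_iff less_add_min_iff)
        then have "norm (pr (h v - h u) (f x) - (G v - G u)) \<le> e * (s v - s u)" using \<delta>(2) uv by blast
        also have "\<dots> \<le> e * (r v - r u)"
          using \<open>e > 0\<close> uv by (intro mult_left_mono s_le_r) auto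
        finally show ?thesis using cuvd cd uv by (simp add: H_def)
      qed
      moreover have "\<epsilon> > 0" using \<delta>(1) cd by (simp add: \<epsilon>_def)
      ultimately show ?thesis by blast
    qed
  qed
  then have "has_stieltjes_integral pr f h (H 1 - H 0)"
    by (rule has_stieltjes_integral_if_approx_primitive)
  moreover have "norm (L1 - L0) \<le> C * J"
  proof (rule tendsto_upperbound)
    show "((\<lambda>v. norm (G v - L0)) \<longlongrightarrow> norm (L1 - L0)) (at_left 1)" by (intro tendsto_intros L1)
    show "eventually (\<lambda>v. norm (G v - L0) \<le> C * J) (at_left 1)"
      using ev1
    proof eventually_elim
      case (elim v)
      show ?case
      proof (rule tendsto_upperbound)
        show "((\<lambda>u. norm (G v - G u)) \<longlongrightarrow> norm (G v - L0)) (at_right 0)" by (intro tendsto_intros L0)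
        have "norm (G v - G u) \<le> C * J" if "0 < u" "u < v" for u
          using G_le[of u v] \<Phi>_le[of u v] that elim mult_left_mono[OF _ \<open>0 \<le> C\<close>, of "\<Phi> v - \<Phi> u" J] by auto
        then show "eventually (\<lambda>u. norm (G v - G u) \<le> C * J) (at_right 0)"
          unfolding eventually_at_right_field using elim by auto
      qed (rule trivial_limit_at_right_real)
    qed
  qed (rule trivial_limit_at_left_real)
  ultimately show ?thesis by (auto simp: H_def)
qed

end

section \<open>Operator-valued holomorphic functions and contour integrals\<close>

text \<open>The choice \<open>y = T x\<close> shows this. It transfers scalar estimates for the
  functions \<open>cinner (F w x) y\<close> to the operator norm.\<close>

lemma norm_blinfun_le_if_form:
  fixes T :: "'a::complex_hilbert \<Rightarrow>\<^sub>L 'b::complex_hilbert"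
  assumes "0 \<le> K" "\<And>x y. cmod (cinner (T x) y) \<le> K * (norm x * norm y)"
  shows "norm T \<le> K"
proof (rule norm_blinfun_bound[OF \<open>0 \<le> K\<close>])
  fix x
  have "(norm (T x))\<^sup>2 \<le> K * norm x * norm (T x)"
    using assms(2)[of x "T x"] by (simp add: cinner_self mult.assoc norm_power)
  then show "norm (T x) \<le> K * norm x"
    by (cases "T x = 0") (auto simp: power2_eq_square \<open>0 \<le> K\<close>)
qed

lemma op_deriv_eq: "has_op_derivative F L z \<Longrightarrow> op_deriv F z = L"
  unfolding op_deriv_def has_op_derivative_def
  by (rule the_equality) (auto intro: tendsto_unique[OF at_neq_bot])

lemma isCont_if_has_op_derivative:
  assumes "has_op_derivative F L z"
  shows "isCont F z"
proof -
  have "((\<lambda>w. scale_op (w - z) (scale_op (inverse (w - z)) (F w - F z)) + F z) \<longlongrightarrow> scale_op (z - z) L + F z) (at z)"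
    using assms unfolding has_op_derivative_def
    by (intro tendsto_intros bounded_bilinear.tendsto[OF bounded_bilinear_scale_op]) auto
  moreover have "eventually (\<lambda>w. scale_op (w - z) (scale_op (inverse (w - z)) (F w - F z)) + F z = F w) (at z)"
    by (auto simp: eventually_at_filter scale_op_scale_op)
  ultimately show ?thesis
    by (auto simp: isCont_def scale_op_simps elim: Lim_transform_eventually)
qed

lemma has_field_derivative_cinner:
  assumes "has_op_derivative F L z"
  shows "((\<lambda>w. cinner (F w x) y) has_field_derivative cinner (L x) y) (at z)"
  unfolding has_field_derivative_iff
proof -
  have "bounded_linear (\<lambda>T. cinner (blinfun_apply T x) y)"
    by (rule bounded_linear_compose[OF bounded_linear_cinner_left blinfun.bounded_linear_left])
  from bounded_linear.tendsto[OF this assms[unfolded has_op_derivative_def]]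
  show "((\<lambda>w. (cinner (F w x) y - cinner (F z x) y) / (w - z)) \<longlongrightarrow> cinner (L x) y) (at z)"
    by (simp add: cinner_scaleC_left blinfun.diff_left cinner_diff_left divide_inverse mult.commute)
qed

lemma bop_if_has_op_derivative:
  assumes "has_op_derivative F L z" "open D" "z \<in> D" "\<And>w. w \<in> D \<Longrightarrow> bop (F w)"
  shows "bop L"
proof -
  have "L \<in> {T. bop T}"
  proof (rule Lim_in_closed_set[OF closed_bop _ _ assms(1)[unfolded has_op_derivative_def]])
    show "\<forall>\<^sub>F w in at z. scale_op (inverse (w - z)) (F w - F z) \<in> {T. bop T}"
      using eventually_at_in_open'[OF assms(2,3)]
      by eventually_elim (auto intro!: bop_scale_op bop_diff assms)
  qed simp
  then show ?thesis by simp
qed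

text \<open>Each \<open>cinner (F w x) y\<close> is holomorphic, so Cauchy's estimate for its second derivative makes its
  derivative Lipschitz near every point, with a constant proportional to \<open>norm x * norm y\<close>.\<close>

lemma continuous_on_op_deriv:
  assumes "open D" and F: "\<And>z. z \<in> D \<Longrightarrow> \<exists>L. has_op_derivative F L z"
  shows "continuous_on D (op_deriv F)"
proof (rule continuous_at_imp_continuous_on, rule ballI)
  fix z assume "z \<in> D"
  have F': "has_op_derivative F (op_deriv F w) w" if "w \<in> D" for w
    using F[OF that] op_deriv_eq by metis
  obtain r where r: "r > 0" "cball z r \<subseteq> D"
    using \<open>open D\<close> \<open>z \<in> D\<close> open_contains_cball by blast
  have "continuous_on (cball z r) F"
    using isCont_if_has_op_derivative[OF F'] r(2) by (intro continuous_at_imp_continuous_on) auto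
  then have "bounded (F ` cball z r)"
    by (intro compact_imp_bounded compact_continuous_image compact_cball)
  then obtain M where M: "M > 0" "\<And>w. w \<in> cball z r \<Longrightarrow> norm (F w) \<le> M"
    unfolding bounded_pos by auto
  \<comment> \<open>Cauchy's estimate for the second derivative on circles of radius
    \<open>r / 2\<close> gives 2! M / (r/2)^2 = 8 M / r^2.\<close>
  define K where "K = 8 * M / r\<^sup>2"
  have K: "K \<ge> 0" using M by (simp add: K_def)
  have lip: "norm (op_deriv F w - op_deriv F z) \<le> K * cmod (w - z)" if w: "w \<in> ball z (r / 2)" for w
  proof (rule norm_blinfun_le_if_form)
    fix x y
    define g where "g w = cinner (F w x) y" for w
    have g': "(g has_field_derivative cinner (op_deriv F w x) y) (at w)" if "w \<in> D" for w
      unfolding g_def by (rule has_field_derivative_cinner[OF F'[OF that]])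
    then have holo: "g holomorphic_on D"
      by (auto simp: holomorphic_on_open[OF \<open>open D\<close>])
    have dg: "deriv g w = cinner (op_deriv F w x) y" if "w \<in> D" for w
      by (rule DERIV_imp_deriv[OF g'[OF that]])
    have g_le: "cmod (g w) \<le> M * norm x * norm y" if "w \<in> cball z r" for w
    proof -
      have "cmod (g w) \<le> norm (F w x) * norm y" unfolding g_def by (rule cinner_cauchy_schwarz)
      also have "norm (F w x) \<le> M * norm x"
        using norm_blinfun[of "F w" x] M(2)[OF that] mult_right_mono[of "norm (F w)" M "norm x"] by simp
      finally show ?thesis by (simp add: mult_right_mono)
    qed
    have "cmod (deriv g w - deriv g z) \<le> (K * (norm x * norm y)) * cmod (w - z)"
    proof (rule field_differentiable_bound)
      show "convex (ball z (r / 2))" by simp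
      fix v assume v: "v \<in> ball z (r / 2)"
      have sub: "cball v (r / 2) \<subseteq> cball z r"
      proof
        fix t assume "t \<in> cball v (r / 2)"
        then show "t \<in> cball z r" using v dist_triangle[of z t v] by simp
      qed
      have "v \<in> cball v (r / 2)" using r by simp
      then have "v \<in> D" using sub r by blast
      have "(deriv g has_field_derivative deriv (deriv g) v) (at v)"
        using holomorphic_derivI[OF holomorphic_deriv[OF holo \<open>open D\<close>] \<open>open D\<close> \<open>v \<in> D\<close>] .
      then show "(deriv g has_field_derivative deriv (deriv g) v) (at v within ball z (r / 2))"
        by (rule has_field_derivative_at_within)
      have "cmod ((deriv ^^ 2) g v) \<le> fact 2 * (M * norm x * norm y) / (r / 2) ^ 2"
      proof (rule Cauchy_inequality)
        show "g holomorphic_on ball v (r / 2)"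
          using holo sub r ball_subset_cball by (meson holomorphic_on_subset subset_trans)
        show "continuous_on (cball v (r / 2)) g"
          using holo sub r by (meson holomorphic_on_imp_continuous_on holomorphic_on_subset subset_trans)
        show "cmod (g t) \<le> M * norm x * norm y" if "cmod (v - t) = r / 2" for t
          using that sub by (intro g_le) (auto simp: dist_norm)
      qed (use r in simp)
      also have "(deriv ^^ 2) g v = deriv (deriv g) v" by (simp add: numeral_2_eq_2)
      also have "fact 2 * (M * norm x * norm y) / (r / 2) ^ 2 = K * (norm x * norm y)"
        using r by (simp add: K_def field_simps power2_eq_square)
      finally show "cmod (deriv (deriv g) v) \<le> K * (norm x * norm y)" .
    qed (use w r in auto)
    moreover have "w \<in> D" using w r by auto
    ultimately show "cmod (cinner ((op_deriv F w - op_deriv F z) x) y) \<le> K * cmod (w - z) * (norm x * norm y)"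
      using \<open>z \<in> D\<close> by (simp add: dg blinfun.diff_left cinner_diff_left mult_ac)
  qed (use K in simp)
  have "((\<lambda>w. op_deriv F w - op_deriv F z) \<longlongrightarrow> 0) (at z)"
  proof (rule Lim_null_comparison)
    show "\<forall>\<^sub>F w in at z. norm (op_deriv F w - op_deriv F z) \<le> K * cmod (w - z)"
      using eventually_at_in_open'[of "ball z (r / 2)" z] r by (auto elim!: eventually_mono intro!: lip)
    show "((\<lambda>w. K * cmod (w - z)) \<longlongrightarrow> 0) (at z)" by (auto intro!: tendsto_eq_intros)
  qed
  then show "isCont (op_deriv F) z"
    unfolding isCont_def by (simp add: LIM_zero_iff)
qed

lemma bop_vector_derivative:
  assumes "(F has_vector_derivative L) (at t)" "\<And>u. bop (F u)"
  shows "bop L"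
proof -
  have "L (c *\<^sub>C x) - c *\<^sub>C L x = 0" for c x
    using bounded_linear.has_vector_derivative[OF bounded_linear_bop_defect assms(1), of c x]
    by (rule vector_derivative_unique_at) (simp add: bopD[OF assms(2)])
  then show ?thesis by (simp add: bop_def)
qed

section \<open>Arc length and integrals along contours\<close>

lemma ex_division_unit: "\<exists>d. d division_of {0..t::real}"
  by (metis box_real(2) division_of_self elementary_interval elementary_empty)

text \<open>Adding the interval from \<open>u\<close> to \<open>v\<close> to a division of the
  interval up to \<open>u\<close> lengthens the polygon by the chord, and the longer polygon is
  bounded by the arc length at \<open>v\<close>. Taking the supremum over the shorter polygons gives
  the claim.\<close>

lemma arc_length_increment_le:
  assumes "rectifiable p" "0 \<le> u" "u \<le> v" "v \<le> 1"
  shows "norm (p v - p u) \<le> arc_length p v - arc_length p u"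
proof -
  have extend: "c + norm (p t - p u) \<in> polygon_lengths p t"
    if c: "c \<in> polygon_lengths p u" and u: "0 \<le> u" "u < t" for c u t
  proof -
    obtain d where d: "d division_of {0..u}" "c = (\<Sum>k\<in>d. norm (p (Sup k) - p (Inf k)))"
      using c by (auto simp: polygon_lengths_def)
    have "{{u..t}} division_of {u..t}"
      using u division_of_self[of u t] by simp
    moreover have "interior {0..u} \<inter> interior {u..t} = {}" by auto
    ultimately have "d \<union> {{u..t}} division_of ({0..u} \<union> {u..t})"
      by (intro division_disjoint_union d(1))
    moreover have "{0..u} \<union> {u..t} = {0..t}" using u by auto
    moreover have "{u..t} \<notin> d"
      using division_ofD(2)[OF d(1), of "{u..t}"] u by auto
    moreover have "finite d" using d(1) by auto
    ultimately show ?thesis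
      using d(2) u unfolding polygon_lengths_def
      by (intro CollectI exI[of _ "d \<union> {{u..t}}"]) (auto simp: add.commute)
  qed
  have ne: "polygon_lengths p t \<noteq> {}" for t
    using ex_division_unit[of t] by (auto simp: polygon_lengths_def)
  \<comment> \<open>Rectifiability bounds the polygons over the whole unit interval only. A polygon
    ending at some t < 1 is extended by the chord to \<open>p 1\<close>, so the same bound applies
    to it.\<close>
  have bdd: "bdd_above (polygon_lengths p t)" if "0 \<le> t" "t \<le> 1" for t
  proof (cases "t = 1")
    case True
    then show ?thesis using assms(1) by (simp add: rectifiable_def)
  next
    case False
    obtain B where B: "\<And>c. c \<in> polygon_lengths p 1 \<Longrightarrow> c \<le> B"
      using assms(1) by (auto simp: rectifiable_def bdd_above_def)
    show ?thesis
    proof (rule bdd_aboveI[of _ B])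
      fix c assume "c \<in> polygon_lengths p t"
      then have "c + norm (p 1 - p t) \<le> B" using that False by (intro B extend) auto
      then show "c \<le> B" using norm_ge_zero[of "p 1 - p t"] by linarith
    qed
  qed
  show ?thesis
  proof (cases "u = v")
    case False
    have "arc_length p u \<le> arc_length p v - norm (p v - p u)"
      unfolding arc_length_def[of p u]
    proof (rule cSup_least[OF ne])
      fix c assume "c \<in> polygon_lengths p u"
      then have "c + norm (p v - p u) \<le> arc_length p v"
        unfolding arc_length_def using assms False by (intro cSup_upper extend bdd) auto
      then show "c \<le> arc_length p v - norm (p v - p u)" by simp
    qed
    then show ?thesis by simp
  qed simp
qed

text \<open>Domination by the zero density bounds the integral by 0, with the values of
  \<open>f\<close> at both end points left free. This is the means of altering integrands at the
  ends of the curve.\<close>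

lemma (in dominated_integrator) has_stieltjes_integral_zero:
  assumes "continuous_on {0..1} h" "\<And>t. 0 < t \<Longrightarrow> t < 1 \<Longrightarrow> f t = 0"
  shows "has_stieltjes_integral pr f h 0"
proof -
  have "continuous_on {0<..<1} f"
    using continuous_on_const[of "{0<..<1}" 0] by (rule continuous_on_eq) (use assms in auto)
  moreover have "has_stieltjes_integral (*) (\<lambda>_. 0) s 0"
    unfolding has_stieltjes_integral_iff
    by (auto simp: stieltjes_sum_def intro!: exI[of _ "\<lambda>x. ball x 1"])
  ultimately obtain I where "has_stieltjes_integral pr f h I" "norm I \<le> 1 * 0"
    using has_stieltjes_integral_dominated[of f "\<lambda>_. 0" 1 0] assms by auto
  then show ?thesis by simp
qed

lemma dominated_integrator_scale_op:
  "rectifiable p \<Longrightarrow> dominated_integrator scale_op p (arc_length p)"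
  by (rule dominated_integrator.intro)
    (auto simp: bounded_bilinear_scale_op norm_scale_op_le arc_length_increment_le)

lemma dominated_integrator_scaleC:
  "rectifiable p \<Longrightarrow> dominated_integrator (scaleC :: complex \<Rightarrow> 'a \<Rightarrow> 'a::complex_hilbert) p (arc_length p)"
  by (rule dominated_integrator.intro)
    (auto simp: bounded_bilinear_scaleC arc_length_increment_le)

text \<open>The total function \<open>contour_op_integral\<close> is informative only where the
  integral exists. The factorization adds and multiplies integrals, so existence is made part of the
  relation.\<close>

definition has_contour_op_integral :: "real \<Rightarrow> (real \<Rightarrow> complex) \<Rightarrow>
    (complex \<Rightarrow> ('a::complex_hilbert \<Rightarrow>\<^sub>L 'a)) \<Rightarrow> ('a \<Rightarrow>\<^sub>L 'a) \<Rightarrow> bool" where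
  "has_contour_op_integral b p F I \<longleftrightarrow> (\<exists>I1 I2. has_stieltjes_integral scale_op (\<lambda>t. F (p t)) p I1 \<and>
     ((\<lambda>m. F (complex_of_real m)) has_integral I2) {b..} \<and> I = I1 + I2)"

lemma contour_op_integral_eq: "has_contour_op_integral b p F I \<Longrightarrow> contour_op_integral b p F = I"
  unfolding has_contour_op_integral_def contour_op_integral_def
  by (auto simp: stieltjes_integral_eq integral_unique)

lemma has_contour_op_integral_add:
  assumes "has_contour_op_integral b p F I" "has_contour_op_integral b p G J"
  shows "has_contour_op_integral b p (\<lambda>m. F m + G m) (I + J)"
proof -
  obtain I1 I2 where I: "has_stieltjes_integral scale_op (\<lambda>t. F (p t)) p I1"
    "((\<lambda>m. F (complex_of_real m)) has_integral I2) {b..}" "I = I1 + I2"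
    using assms(1) unfolding has_contour_op_integral_def by blast
  obtain J1 J2 where J: "has_stieltjes_integral scale_op (\<lambda>t. G (p t)) p J1"
    "((\<lambda>m. G (complex_of_real m)) has_integral J2) {b..}" "J = J1 + J2"
    using assms(2) unfolding has_contour_op_integral_def by blast
  show ?thesis
    unfolding has_contour_op_integral_def
    using has_stieltjes_integral_add[OF scale_op_simps(2) I(1) J(1)] has_integral_add[OF I(2) J(2)]
    by (intro exI[of _ "I1 + J1"] exI[of _ "I2 + J2"]) (simp add: I(3) J(3))
qed

lemma has_contour_op_integral_linear:
  assumes L: "bounded_linear L" "\<And>a T. L (scale_op a T) = scale_op a (L T)"
    and F: "has_contour_op_integral b p F I"
  shows "has_contour_op_integral b p (\<lambda>m. L (F m)) (L I)"
proof -
  obtain I1 I2 where I: "has_stieltjes_integral scale_op (\<lambda>t. F (p t)) p I1"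
    "((\<lambda>m. F (complex_of_real m)) has_integral I2) {b..}" "I = I1 + I2"
    using F unfolding has_contour_op_integral_def by blast
  show ?thesis
    unfolding has_contour_op_integral_def
    using has_stieltjes_integral_linear[OF L I(1)] has_integral_linear[OF I(2) L(1)]
    by (intro exI[of _ "L I1"] exI[of _ "L I2"])
      (simp add: I(3) o_def linear_add[OF bounded_linear.linear[OF L(1)]])
qed

text \<open>Agreement on the curve is asked between its end points only, because the kernel
  derivative is not controlled at the starting point. The difference of the integrands then has
  Stieltjes integral 0.\<close>

lemma has_contour_op_integral_cong:
  assumes "rectifiable p" and F: "has_contour_op_integral b p F I"
    and "\<And>t. 0 < t \<Longrightarrow> t < 1 \<Longrightarrow> G (p t) = F (p t)"
    and "\<And>m. b \<le> m \<Longrightarrow> G (complex_of_real m) = F (complex_of_real m)"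
  shows "has_contour_op_integral b p G I"
proof -
  have p: "continuous_on {0..1} p" using assms(1) by (simp add: rectifiable_def path_def)
  obtain I1 I2 where I: "has_stieltjes_integral scale_op (\<lambda>t. F (p t)) p I1"
    "((\<lambda>m. F (complex_of_real m)) has_integral I2) {b..}" "I = I1 + I2"
    using F unfolding has_contour_op_integral_def by blast
  interpret dominated_integrator scale_op p "arc_length p"
    by (rule dominated_integrator_scale_op[OF assms(1)])
  have "has_stieltjes_integral scale_op (\<lambda>t. G (p t) - F (p t)) p 0"
    by (rule has_stieltjes_integral_zero[OF p]) (simp add: assms)
  from has_stieltjes_integral_add[OF scale_op_simps(2) I(1) this]
  have "has_stieltjes_integral scale_op (\<lambda>t. G (p t)) p I1" by simp
  moreover have "((\<lambda>m. G (complex_of_real m)) has_integral I2) {b..}"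
    using I(2) by (rule has_integral_eq[rotated]) (simp add: assms)
  ultimately show ?thesis using I(3) unfolding has_contour_op_integral_def by blast
qed

text \<open>The defect of complex linearity is bounded and linear, so it may be taken under both
  integrals, where it vanishes. On the curve this leads from operators to vectors, hence to
  Stieltjes sums formed with \<open>scaleC\<close>.\<close>

lemma bop_has_contour_op_integral:
  fixes F :: "complex \<Rightarrow> 'a::complex_hilbert \<Rightarrow>\<^sub>L 'a"
  assumes "rectifiable p" and F: "has_contour_op_integral b p F I"
    and bop_curve: "\<And>t. 0 < t \<Longrightarrow> t < 1 \<Longrightarrow> bop (F (p t))"
    and bop_ray: "\<And>m. b \<le> m \<Longrightarrow> bop (F (complex_of_real m))"
  shows "bop I"
proof -
  have p: "continuous_on {0..1} p" using assms(1) by (simp add: rectifiable_def path_def)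
  obtain I1 I2 where I: "has_stieltjes_integral scale_op (\<lambda>t. F (p t)) p I1"
    "((\<lambda>m. F (complex_of_real m)) has_integral I2) {b..}" "I = I1 + I2"
    using F unfolding has_contour_op_integral_def by blast
  interpret dominated_integrator "scaleC :: complex \<Rightarrow> 'a \<Rightarrow> 'a" p "arc_length p"
    by (rule dominated_integrator_scaleC[OF assms(1)])
  have 1: "I1 (c *\<^sub>C x) - c *\<^sub>C I1 x = 0" for c x
  proof -
    have "has_stieltjes_integral scaleC (\<lambda>t. F (p t) (c *\<^sub>C x) - c *\<^sub>C F (p t) x) p
        (I1 (c *\<^sub>C x) - c *\<^sub>C I1 x)"
      by (rule has_stieltjes_integral_linear[OF bounded_linear_bop_defect _ I(1)])
        (simp add: bounded_bilinear.diff_right[OF bounded_bilinear_scaleC] scaleC_scaleC mult.commute)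
    moreover have "has_stieltjes_integral scaleC (\<lambda>t. F (p t) (c *\<^sub>C x) - c *\<^sub>C F (p t) x) p 0"
      by (rule has_stieltjes_integral_zero[OF p]) (simp add: bopD[OF bop_curve])
    ultimately show ?thesis by (rule has_stieltjes_integral_unique)
  qed
  have 2: "I2 (c *\<^sub>C x) - c *\<^sub>C I2 x = 0" for c x
  proof (rule has_integral_unique)
    show "((\<lambda>m. F (complex_of_real m) (c *\<^sub>C x) - c *\<^sub>C F (complex_of_real m) x) has_integral
        I2 (c *\<^sub>C x) - c *\<^sub>C I2 x) {b..}"
      using has_integral_linear[OF I(2) bounded_linear_bop_defect] by (simp add: o_def)
    show "((\<lambda>m. F (complex_of_real m) (c *\<^sub>C x) - c *\<^sub>C F (complex_of_real m) x) has_integral 0) {b..}"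
      by (rule has_integral_is_0) (simp add: bopD[OF bop_ray])
  qed
  have "bop I1" "bop I2" using 1 2 by (auto simp: bop_def)
  then show ?thesis unfolding I(3) by (rule bop_add)
qed

lemma integrable_on_ray_if_dominated:
  fixes f :: "real \<Rightarrow> 'b::banach"
  assumes "continuous_on {b..} f" "\<phi> integrable_on {b..}" "\<And>m. b \<le> m \<Longrightarrow> norm (f m) \<le> \<phi> m"
  shows "f integrable_on {b..}"
proof (rule integrable_on_all_intervals_integrable_bound[where g = \<phi>])
  fix c d :: real
  have "f integrable_on {max b c..d}"
    by (rule integrable_continuous_interval, rule continuous_on_subset[OF assms(1)]) auto
  moreover have "{b..} \<inter> cbox c d = {max b c..d}" by auto
  ultimately show "(\<lambda>x. if x \<in> {b..} then f x else 0) integrable_on cbox c d"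
    by (simp only: integrable_restrict_Int)
qed (use assms in auto)

text \<open>This turns the finite scalar variation into existence of operator integrals together
  with a norm bound. Curve and ray are dominated separately and share the constant
  \<open>C\<close>.\<close>

lemma has_contour_op_integral_dominated:
  fixes F :: "complex \<Rightarrow> 'a::complex_hilbert \<Rightarrow>\<^sub>L 'a" and \<phi> :: "complex \<Rightarrow> real"
  assumes "rectifiable p" and int: "contour_length_integrable b p \<phi>"
    and F_curve: "continuous_on {0<..<1} (\<lambda>t. F (p t))"
    and F_ray: "continuous_on {b..} (\<lambda>m. F (complex_of_real m))"
    and \<phi>: "continuous_on {0<..<1} (\<lambda>t. \<phi> (p t))" and nonneg: "\<And>m. 0 \<le> \<phi> m" and "0 \<le> C"
    and le_curve: "\<And>t. 0 < t \<Longrightarrow> t < 1 \<Longrightarrow> norm (F (p t)) \<le> C * \<phi> (p t)"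
    and le_ray: "\<And>m. b \<le> m \<Longrightarrow> norm (F (complex_of_real m)) \<le> C * \<phi> (complex_of_real m)"
  shows "\<exists>I. has_contour_op_integral b p F I \<and> norm I \<le> C * contour_length_integral b p \<phi>"
proof -
  have p: "continuous_on {0..1} p" using assms(1) by (simp add: rectifiable_def path_def)
  interpret dominated_integrator scale_op p "arc_length p"
    by (rule dominated_integrator_scale_op[OF assms(1)])
  obtain J where J: "has_stieltjes_integral (*) (\<lambda>t. \<phi> (p t)) (arc_length p) J"
    and \<phi>_ray: "(\<lambda>m. \<phi> (complex_of_real m)) integrable_on {b..}"
    using int unfolding contour_length_integrable_def by blast
  obtain I1 where I1: "has_stieltjes_integral scale_op (\<lambda>t. F (p t)) p I1" "norm I1 \<le> C * J"
    using has_stieltjes_integral_dominated[OF F_curve \<phi> p nonneg \<open>0 \<le> C\<close> le_curve J] by blast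
  have C\<phi>: "(\<lambda>m. C * \<phi> (complex_of_real m)) integrable_on {b..}"
    using \<phi>_ray by (rule integrable_on_mult_right)
  have F: "(\<lambda>m. F (complex_of_real m)) integrable_on {b..}"
    by (rule integrable_on_ray_if_dominated[OF F_ray C\<phi> le_ray])
  define I2 where "I2 = integral {b..} (\<lambda>m. F (complex_of_real m))"
  have "norm I2 \<le> integral {b..} (\<lambda>m. C * \<phi> (complex_of_real m))"
    unfolding I2_def by (rule integral_norm_bound_integral[OF F C\<phi>]) (simp add: le_ray)
  also have "\<dots> = C * integral {b..} (\<lambda>m. \<phi> (complex_of_real m))" by simp
  finally have "norm (I1 + I2) \<le> C * contour_length_integral b p \<phi>"
    using I1(2) norm_triangle_ineq[of I1 I2]
    unfolding contour_length_integral_def stieltjes_integral_eq[OF J] by (simp add: distrib_left)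
  moreover have "has_contour_op_integral b p F (I1 + I2)"
    unfolding has_contour_op_integral_def using I1(1) integrable_integral[OF F] I2_def by blast
  ultimately show ?thesis by blast
qed

section \<open>Factorization of the transfer function\<close>

lemma cinner_diff_scalar_op:
  assumes "norm x = 1"
  shows "cinner ((T - scalar_op z) x) x = cinner (T x) x - z"
  using assms by (simp add: blinfun.diff_left cinner_diff_left cinner_scaleC_left cinner_self)

lemma infdist_numrange_le_form:
  assumes "norm x = 1"
  shows "infdist z (numrange T) \<le> cmod (cinner ((T - scalar_op z) x) x)"
proof -
  have "cinner (T x) x \<in> {cinner (T x) x |x. norm x = 1}" using assms by blast
  then have "cinner (T x) x \<in> numrange T"
    unfolding numrange_def by (rule subsetD[OF closure_subset])
  then have "infdist z (numrange T) \<le> dist z (cinner (T x) x)" by (rule infdist_le)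
  then show ?thesis using cinner_diff_scalar_op[OF assms] by (simp add: dist_norm norm_minus_commute)
qed

lemma cmod_form_le_norm:
  fixes T :: "'a::complex_hilbert \<Rightarrow>\<^sub>L 'a"
  shows "norm x = 1 \<Longrightarrow> cmod (cinner (T x) x) \<le> norm T"
  using cinner_cauchy_schwarz[of "T x" x] norm_blinfun[of T x] by simp

text \<open>On unit vectors the form of \<open>T - scalar_op z\<close> has modulus at least the
  distance of \<open>z\<close> from the numerical range, and the perturbation lowers this by at most
  \<open>norm X\<close>. A lower bound of the form gives two-sided invertibility without
  self-adjointness.\<close>

lemma ex_inverse_add_scalar_op:
  assumes "bop T" "bop X" "norm X < infdist z (numrange T)"
  shows "\<exists>S. is_op_inverse (T + X - scalar_op z) S \<and> norm S \<le> 1 / (infdist z (numrange T) - norm X)"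
proof (rule is_op_inverse_if_form_bounded_below)
  show "bop (T + X - scalar_op z)" using assms by (intro bop_diff bop_add bop_scalar_op)
  fix x :: 'a assume x: "norm x = 1"
  have "cinner ((T + X - scalar_op z) x) x = cinner ((T - scalar_op z) x) x + cinner (X x) x"
    by (simp add: blinfun.add_left blinfun.diff_left cinner_add_left cinner_diff_left)
  then have "cmod (cinner ((T - scalar_op z) x) x) \<le> cmod (cinner ((T + X - scalar_op z) x) x) + cmod (cinner (X x) x)"
    by (metis add_diff_cancel_right' norm_triangle_ineq4)
  then show "infdist z (numrange T) - norm X \<le> cmod (cinner ((T + X - scalar_op z) x) x)"
    using infdist_numrange_le_form[OF x, of z T] cmod_form_le_norm[OF x, of X] by linarith
qed (use assms in simp)

text \<open>Instead of a Neumann series, the form criterion is applied: on unit vectors the form of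
  \<open>id_blinfun + Y\<close> has modulus at least \<open>1 - norm Y\<close>.\<close>

lemma ex_inverse_id_plus:
  fixes Y :: "'a::complex_hilbert \<Rightarrow>\<^sub>L 'a"
  assumes "bop Y" "norm Y < 1"
  shows "\<exists>S. is_op_inverse (id_blinfun + Y) S"
proof -
  have "\<exists>S. is_op_inverse (id_blinfun + Y) S \<and> norm S \<le> 1 / (1 - norm Y)"
  proof (rule is_op_inverse_if_form_bounded_below)
    fix x :: 'a assume x: "norm x = 1"
    have "cinner ((id_blinfun + Y) x) x = 1 + cinner (Y x) x"
      using x by (simp add: blinfun.add_left cinner_add_left cinner_self)
    moreover have "cmod 1 \<le> cmod (1 + cinner (Y x) x) + cmod (cinner (Y x) x)"
      by (metis add_diff_cancel_right' norm_triangle_ineq4)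
    ultimately show "1 - norm Y \<le> cmod (cinner ((id_blinfun + Y) x) x)"
      using cmod_form_le_norm[OF x, of Y] by simp
  qed (use assms bop_add bop_id in auto)
  then show ?thesis by blast
qed

text \<open>The two transformations differ in the order of the factors only.\<close>

definition side_mult :: "bool \<Rightarrow> ('a::complex_hilbert \<Rightarrow>\<^sub>L 'a) \<Rightarrow> ('a \<Rightarrow>\<^sub>L 'a) \<Rightarrow> ('a \<Rightarrow>\<^sub>L 'a)" where
  "side_mult right S T = (if right then S o\<^sub>L T else T o\<^sub>L S)"

section \<open>Algebra of one-sided products and resolvents\<close>

lemma blinfun_compose_assoc': "(R o\<^sub>L S) o\<^sub>L T = R o\<^sub>L (S o\<^sub>L T)"
  by (rule blinfun_eqI) simp

lemma bounded_bilinear_side_mult: "bounded_bilinear (side_mult right)"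
  unfolding side_mult_def
  by (cases right) (auto intro: bounded_bilinear_blinfun_compose
      bounded_bilinear.flip[OF bounded_bilinear_blinfun_compose])

lemma norm_side_mult_le: "norm (side_mult right S T) \<le> norm S * norm T"
  unfolding side_mult_def using norm_blinfun_compose[of S T] norm_blinfun_compose[of T S]
  by (auto simp: mult.commute)

lemma side_mult_assoc: "side_mult right (side_mult right R S) T = side_mult right R (side_mult right S T)"
  by (simp add: side_mult_def blinfun_compose_assoc')

lemma bop_side_mult: "bop S \<Longrightarrow> bop T \<Longrightarrow> bop (side_mult right S T)"
  by (simp add: side_mult_def bop_compose)

lemma side_mult_scale_op_left:
  "bop T \<Longrightarrow> side_mult right (scale_op a S) T = scale_op a (side_mult right S T)"
  by (auto simp: side_mult_def bopD intro!: blinfun_eqI)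

lemma side_mult_id [simp]: "side_mult right id_blinfun T = T" "side_mult right T id_blinfun = T"
  by (auto simp: side_mult_def intro!: blinfun_eqI)

lemma side_mult_scale_op_id:
  "bop T \<Longrightarrow> side_mult right T (scale_op a id_blinfun) = scale_op a T"
  by (auto simp: side_mult_def bopD intro!: blinfun_eqI)

lemma is_op_inverse_iff_side_mult:
  "is_op_inverse T S \<longleftrightarrow> bop S \<and> side_mult right S T = id_blinfun \<and> side_mult right T S = id_blinfun"
  by (auto simp: is_op_inverse_def side_mult_def)

lemma ex_inverse_side_mult_iff:
  assumes W: "is_op_inverse W W'" and "bop W"
  shows "(\<exists>S. is_op_inverse (side_mult right W T) S) \<longleftrightarrow> (\<exists>S. is_op_inverse T S)"
proof
  have W': "bop W'" "side_mult right W' W = id_blinfun" "side_mult right W W' = id_blinfun"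
    using W is_op_inverse_iff_side_mult by blast+
  {
    assume "\<exists>S. is_op_inverse (side_mult right W T) S"
    then obtain S where S: "bop S" "side_mult right S (side_mult right W T) = id_blinfun"
      "side_mult right (side_mult right W T) S = id_blinfun"
      using is_op_inverse_iff_side_mult by blast
    \<comment> \<open>With an inverse S of W T, the product S W is a left inverse of T by
      associativity alone. That it is a right inverse needs W': T (S W) = W' (W T S) W = W' W = 1.
      For the other side the same holds with reversed products.\<close>
    have "side_mult right T (side_mult right S W) =
        side_mult right (side_mult right W' W) (side_mult right T (side_mult right S W))"
      using W' by simp
    also have "\<dots> = side_mult right W' (side_mult right (side_mult right (side_mult right W T) S) W)"
      by (simp only: side_mult_assoc)
    also have "\<dots> = id_blinfun" using S W' by simp
    finally have "is_op_inverse T (side_mult right S W)"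
      unfolding is_op_inverse_iff_side_mult[of T _ right]
      using S \<open>bop W\<close> by (simp add: side_mult_assoc bop_side_mult)
    then show "\<exists>S. is_op_inverse T S" by blast
  next
    assume "\<exists>S. is_op_inverse T S"
    then obtain S where S: "bop S" "side_mult right S T = id_blinfun" "side_mult right T S = id_blinfun"
      using is_op_inverse_iff_side_mult by blast
    have "side_mult right (side_mult right S W') (side_mult right W T) =
        side_mult right S (side_mult right (side_mult right W' W) T)"
      by (simp only: side_mult_assoc)
    moreover have "side_mult right (side_mult right W T) (side_mult right S W') =
        side_mult right W (side_mult right (side_mult right T S) W')"
      by (simp only: side_mult_assoc)
    ultimately have "is_op_inverse (side_mult right W T) (side_mult right S W')"
      unfolding is_op_inverse_iff_side_mult[of _ _ right] using S W' by (simp add: bop_side_mult)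
    then show "\<exists>S. is_op_inverse (side_mult right W T) S" by blast
  }
qed

lemma resolvent_apply:
  assumes "is_op_inverse (Z - scalar_op m) R"
  shows "Z (R x) = x + m *\<^sub>C R x" "R (Z x) = x + m *\<^sub>C R x"
proof -
  have R: "bop R" "R o\<^sub>L (Z - scalar_op m) = id_blinfun" "(Z - scalar_op m) o\<^sub>L R = id_blinfun"
    using assms by (auto simp: is_op_inverse_def)
  have "(Z - scalar_op m) (R x) = x" "R ((Z - scalar_op m) x) = x"
    using R(2,3) by (metis blinfun_apply_blinfun_compose blinfun_apply_id_blinfun id_apply)+
  then show "Z (R x) = x + m *\<^sub>C R x" "R (Z x) = x + m *\<^sub>C R x"
    by (simp_all add: blinfun.diff_left blinfun.diff_right bopD[OF R(1)] algebra_simps)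
qed

lemma scale_op_resolvent:
  assumes "is_op_inverse (Z - scalar_op m) R"
  shows "scale_op m R = (Z o\<^sub>L R) - id_blinfun"
  by (rule blinfun_eqI) (simp add: blinfun.diff_left resolvent_apply[OF assms])

text \<open>Since Z R = R Z = 1 + m R, with q = m/(z - m) the second summand equals q - m R in
  either order of the factors. The terms m R cancel, and 1 + q = z/(z - m) remains.\<close>

lemma resolvent_factor_identity:
  assumes R: "is_op_inverse (Z - scalar_op m) R" and Z: "bop Z" and "z \<noteq> m"
  shows "(Z o\<^sub>L R) + side_mult right (scale_op (m / (z - m)) R) (Z - scalar_op z) =
    scale_op (z / (z - m)) id_blinfun"
proof (rule blinfun_eqI)
  fix x
  define y where "y = R x"
  have bR: "bop R" using R by (simp add: is_op_inverse_def)
  define q where "q = m / (z - m)"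
  have q1: "q * m + m = q * z" and q2: "1 + q = z / (z - m)"
    using \<open>z \<noteq> m\<close> by (simp_all add: q_def field_simps)
  note sc = scaleC_add_right scaleC_add_left scaleC_scaleC
    bounded_bilinear.diff_right[OF bounded_bilinear_scaleC]
  have "side_mult right (scale_op q R) (Z - scalar_op z) x = q *\<^sub>C x + (q * m) *\<^sub>C y - (q * z) *\<^sub>C y"
    by (auto simp: side_mult_def y_def blinfun.diff_left blinfun.diff_right bopD[OF bR] bopD[OF Z] sc
        resolvent_apply[OF R] mult.commute)
  also have "\<dots> = q *\<^sub>C x - m *\<^sub>C y" by (simp add: sc flip: q1)
  finally have "((Z o\<^sub>L R) + side_mult right (scale_op q R) (Z - scalar_op z)) x = 1 *\<^sub>C x + q *\<^sub>C x"
    by (simp add: blinfun.add_left resolvent_apply[OF R] y_def)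
  also have "\<dots> = (z / (z - m)) *\<^sub>C x" by (simp only: flip: scaleC_add_left q2)
  finally show "((Z o\<^sub>L R) + side_mult right (scale_op (m / (z - m)) R) (Z - scalar_op z)) x =
      scale_op (z / (z - m)) id_blinfun x" by (simp add: q_def)
qed

text \<open>By the first resolvent identity R(m) - R(m') = (m - m') R(m) R(m'), a uniform bound on
  the resolvent makes it Lipschitz.\<close>

lemma resolvent_continuous:
  fixes Z :: "'a::complex_hilbert \<Rightarrow>\<^sub>L 'a"
  assumes R: "\<And>m. m \<in> S \<Longrightarrow> is_op_inverse (Z - scalar_op m) (R m)" and K: "\<And>m. m \<in> S \<Longrightarrow> norm (R m) \<le> K"
  shows "continuous_on S R"
proof (cases "S = {}")
  case False
  then have "0 \<le> K" using K norm_ge_zero order_trans by blast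
  have eq: "R m - R m' = scale_op (m - m') (R m o\<^sub>L R m')" if "m \<in> S" "m' \<in> S" for m m'
  proof (rule blinfun_eqI)
    fix x
    have bop: "bop (R m)" using R[OF that(1)] by (simp add: is_op_inverse_def)
    have "R m x = R m (Z (R m' x) - m' *\<^sub>C R m' x)"
      using resolvent_apply(1)[OF R[OF that(2)]] by simp
    also have "\<dots> = R m' x + m *\<^sub>C R m (R m' x) - m' *\<^sub>C R m (R m' x)"
      by (simp add: blinfun.diff_right resolvent_apply(2)[OF R[OF that(1)]] bopD[OF bop])
    finally show "(R m - R m') x = scale_op (m - m') (R m o\<^sub>L R m') x"
      by (simp add: blinfun.diff_left bounded_bilinear.diff_left[OF bounded_bilinear_scaleC])
  qed
  have "norm (R m - R m') \<le> K * K * cmod (m - m')" if "m \<in> S" "m' \<in> S" for m m'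
  proof -
    have "norm (R m - R m') \<le> cmod (m - m') * norm (R m o\<^sub>L R m')"
      unfolding eq[OF that] by (rule norm_scale_op_le)
    also have "\<dots> \<le> cmod (m - m') * (K * K)"
      by (intro mult_left_mono order_trans[OF norm_blinfun_compose] mult_mono K that norm_ge_zero \<open>0 \<le> K\<close>)
    finally show ?thesis by (simp add: mult.commute)
  qed
  then have "(K * K)-lipschitz_on S R"
    using \<open>0 \<le> K\<close> by (intro lipschitz_onI) (auto simp: dist_norm)
  then show ?thesis by (rule lipschitz_on_continuous_on)
qed simp

text \<open>Here the kernel appears only through its derivative along one contour: continuity and
  complex linearity, besides the numerical conditions. On the curve they are stated between the end
  points, towards which \<open>K'\<close> may be unbounded.\<close>

locale admissible_contour =
  fixes At :: "'a::complex_hilbert \<Rightarrow>\<^sub>L 'a" and K' :: "complex \<Rightarrow> 'a \<Rightarrow>\<^sub>L 'a" and b :: real and p :: "real \<Rightarrow> complex"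
  assumes At: "bop At" and rect: "rectifiable p"
    and K'_curve: "continuous_on {0<..<1} (\<lambda>t. K' (p t))"
    and K'_ray: "continuous_on {b..} (\<lambda>m. K' (complex_of_real m))"
    and bop_curve: "\<And>t. 0 < t \<Longrightarrow> t < 1 \<Longrightarrow> bop (K' (p t))"
    and bop_ray: "\<And>m. b \<le> m \<Longrightarrow> bop (K' (complex_of_real m))"
    and dist_pos: "contour_dist At b p > 0"
    and integrable: "contour_length_integrable b p (var_density At K')"
    and var_less_1: "contour_var At K' b p < 1"
    and var_norm_less: "contour_var At K' b p * norm At <
       1/4 * contour_dist At b p * (1 - contour_var At K' b p)\<^sup>2"
begin

abbreviation "d \<equiv> contour_dist At b p"
abbreviation "var \<equiv> contour_var At K' b p"
abbreviation "dist_nu m \<equiv> infdist m (numrange At)"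

lemma contour_points:
  "t \<in> {0..1} \<Longrightarrow> p t \<in> contour_set b p" "b \<le> m \<Longrightarrow> complex_of_real m \<in> contour_set b p"
  by (auto simp: contour_set_def path_image_def)

lemma d_le_dist_nu: "m \<in> contour_set b p \<Longrightarrow> d \<le> dist_nu m"
  by (metis contour_dist_def infdist_eq_setdist setdist_le_sing setdist_sym)

lemma var_density_nonneg: "0 \<le> var_density At K' m"
  by (simp add: var_density_def infdist_nonneg)

lemma continuous_curve: "continuous_on {0<..<1} p"
  using rect by (auto simp: rectifiable_def path_def intro: continuous_on_subset)

text \<open>A multiplier bounded by \<open>C\<close> over the distance to the numerical range makes
  the integrand at most \<open>C\<close> times the variation density. Every integral below,
  including the one in the equation for \<open>X\<close>, is obtained in this way.\<close>

lemma multiplier_integral: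
  assumes Q: "continuous_on (contour_set b p) Q" and "0 \<le> C"
    and Q_le: "\<And>m. m \<in> contour_set b p \<Longrightarrow> norm (Q m) \<le> C / dist_nu m"
  shows "\<exists>I. has_contour_op_integral b p (\<lambda>m. side_mult right (K' m) (Q m)) I \<and> norm I \<le> C * var"
  unfolding contour_var_def
proof (rule has_contour_op_integral_dominated[OF rect integrable _ _ _ var_density_nonneg \<open>0 \<le> C\<close>])
  note side = bounded_bilinear.continuous_on[OF bounded_bilinear_side_mult]
  have curve: "p ` {0<..<1} \<subseteq> contour_set b p" using contour_points(1) by auto
  show "continuous_on {0<..<1} (\<lambda>t. side_mult right (K' (p t)) (Q (p t)))"
    by (intro side K'_curve continuous_on_compose2[OF Q continuous_curve curve])
  have ray: "complex_of_real ` {b..} \<subseteq> contour_set b p" using contour_points(2) by auto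
  show "continuous_on {b..} (\<lambda>m. side_mult right (K' (complex_of_real m)) (Q (complex_of_real m)))"
    by (intro side K'_ray continuous_on_compose2[OF Q _ ray] continuous_on_of_real continuous_on_id)
  show "continuous_on {0<..<1} (\<lambda>t. var_density At K' (p t))"
    unfolding var_density_def
  proof (intro continuous_on_divide continuous_on_norm K'_curve ballI)
    show "continuous_on {0<..<1} (\<lambda>t. infdist (p t) (numrange At))"
      by (intro continuous_on_infdist continuous_curve)
    show "dist_nu (p t) \<noteq> 0" if "t \<in> {0<..<1}" for t
      using d_le_dist_nu[of "p t"] curve that dist_pos by force
  qed
  have le: "norm (side_mult right (K' m) (Q m)) \<le> C * var_density At K' m" if "m \<in> contour_set b p" for m
  proof -
    have "norm (side_mult right (K' m) (Q m)) \<le> norm (K' m) * (C / dist_nu m)"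
      by (intro order_trans[OF norm_side_mult_le] mult_left_mono Q_le that norm_ge_zero)
    then show ?thesis by (simp add: var_density_def mult.commute)
  qed
  show "norm (side_mult right (K' (p t)) (Q (p t))) \<le> C * var_density At K' (p t)"
    if "0 < t" "t < 1" for t
    using that by (intro le contour_points) auto
  show "norm (side_mult right (K' (complex_of_real m)) (Q (complex_of_real m)))
      \<le> C * var_density At K' (complex_of_real m)" if "b \<le> m" for m
    using that by (intro le contour_points)
qed

text \<open>The zero multiplier in the preceding estimate gives
  \<open>0 \<le> norm I \<le> 1 * var\<close>.\<close>

lemma var_nonneg: "0 \<le> var"
proof -
  have "\<exists>I. has_contour_op_integral b p (\<lambda>m. side_mult True (K' m) 0) I \<and> norm I \<le> 1 * var"
    by (rule multiplier_integral) (auto simp: infdist_nonneg)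
  then show ?thesis by (metis mult_1 norm_ge_zero order_trans)
qed

definition "radius = 1/2 * d * (1 - var)"

lemma radius_less: "radius < d" "0 \<le> radius"
proof -
  have "1/2 * d * (1 - var) \<le> 1/2 * d * 1"
    using dist_pos var_nonneg by (intro mult_left_mono) auto
  then show "radius < d" using dist_pos by (simp add: radius_def)
  show "0 \<le> radius" using dist_pos var_less_1 by (simp add: radius_def)
qed

lemma O_set_eq: "O_set At K' b p = {z. dist_nu z \<le> radius}"
  by (simp add: O_set_def radius_def)

lemma r_min_bounds: "0 \<le> r_min At K' b p" "r_min At K' b p \<le> radius"
proof -
  define w where "w = 1/4 * d\<^sup>2 * (1 - var)\<^sup>2 - d * var * norm At"
  have w: "r_min At K' b p = radius - sqrt w" by (simp add: r_min_def radius_def w_def)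
  \<comment> \<open>Multiplied by \<open>d\<close>, the last admissibility condition says that the
    discriminant \<open>w\<close> in \<open>r_min\<close> is positive.\<close>
  have "d * (var * norm At) < d * (1/4 * d * (1 - var)\<^sup>2)"
    using var_norm_less dist_pos by (intro mult_strict_left_mono)
  then have "0 \<le> w" by (simp add: w_def power2_eq_square algebra_simps)
  moreover have "w \<le> radius\<^sup>2"
    using dist_pos var_nonneg by (simp add: w_def radius_def power_mult_distrib power_divide)
  then have "sqrt w \<le> radius" using radius_less(2) by (rule real_le_lsqrt[rotated])
  ultimately show "0 \<le> r_min At K' b p" "r_min At K' b p \<le> radius" using w by auto
qed

text \<open>As \<open>d \<le> dist_nu m\<close>, the radius is at most (1 - var)/2 times
  \<open>dist_nu m\<close>, and the triangle inequality leaves the fraction (1 + var)/2. Keeping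
  \<open>dist_nu m\<close> in place of \<open>d\<close> preserves the decay needed along the
  ray.\<close>

lemma dist_contour_ge:
  assumes "dist_nu z \<le> radius" "m \<in> contour_set b p"
  shows "dist_nu m * (1 + var) / 2 \<le> cmod (z - m)"
proof -
  have "dist_nu m \<le> dist_nu z + dist m z" by (rule infdist_triangle)
  moreover have "radius \<le> 1/2 * dist_nu m * (1 - var)"
    using d_le_dist_nu[OF assms(2)] var_less_1 dist_pos unfolding radius_def by (intro mult_mono) (auto simp: infdist_nonneg)
  moreover have "dist m z = cmod (z - m)" by (simp add: dist_norm norm_minus_commute)
  ultimately show ?thesis using assms(1) by (simp add: algebra_simps)
qed

end

locale contour_solution = admissible_contour +
  fixes X :: "'a \<Rightarrow>\<^sub>L 'a" and right :: bool
  assumes X: "bop X" and norm_X: "norm X \<le> radius"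
    and X_eq: "X = contour_op_integral b p (\<lambda>m. side_mult right (K' m)
      ((At + X) o\<^sub>L op_inverse (At + X - scalar_op m)))"
begin

definition "Z = At + X"

definition "R m = op_inverse (Z - scalar_op m)"

lemma bop_Z: "bop Z" unfolding Z_def by (intro bop_add At X)

lemma norm_X_less: "norm X < d" using norm_X radius_less by simp

lemma resolvent:
  assumes "norm X < dist_nu m"
  shows "is_op_inverse (Z - scalar_op m) (R m)" "norm (R m) \<le> 1 / (dist_nu m - norm X)"
proof -
  obtain S where "is_op_inverse (Z - scalar_op m) S" "norm S \<le> 1 / (dist_nu m - norm X)"
    using ex_inverse_add_scalar_op[OF At X assms] unfolding Z_def by blast
  then show "is_op_inverse (Z - scalar_op m) (R m)" "norm (R m) \<le> 1 / (dist_nu m - norm X)"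
    unfolding R_def by (simp_all add: op_inverse_eq)
qed

lemma op_spectrum_dist: "z \<in> op_spectrum Z \<Longrightarrow> dist_nu z \<le> norm X"
  using resolvent(1)[of z] unfolding op_spectrum_def by force

lemma contour_resolvent:
  assumes "m \<in> contour_set b p"
  shows "is_op_inverse (Z - scalar_op m) (R m)" "norm (R m) \<le> 1 / (dist_nu m - norm X)"
    "norm X < dist_nu m" "0 < dist_nu m"
proof -
  show "norm X < dist_nu m" using d_le_dist_nu[OF assms] norm_X_less by simp
  then show "is_op_inverse (Z - scalar_op m) (R m)" "norm (R m) \<le> 1 / (dist_nu m - norm X)"
    by (rule resolvent)+
  show "0 < dist_nu m" using d_le_dist_nu[OF assms] dist_pos by simp
qed

lemma continuous_on_resolvent: "continuous_on (contour_set b p) R"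
proof (rule resolvent_continuous[OF contour_resolvent(1)])
  fix m assume m: "m \<in> contour_set b p"
  have "1 / (dist_nu m - norm X) \<le> 1 / (d - norm X)"
    using d_le_dist_nu[OF m] norm_X_less by (intro divide_left_mono) auto
  then show "norm (R m) \<le> 1 / (d - norm X)" using contour_resolvent(2)[OF m] by simp
qed

lemma norm_Z_resolvent_le:
  assumes m: "m \<in> contour_set b p"
  shows "norm (Z o\<^sub>L R m) \<le> (norm At + norm X) / (dist_nu m - norm X)"
proof -
  have "norm (Z o\<^sub>L R m) \<le> (norm At + norm X) * (1 / (dist_nu m - norm X))"
    unfolding Z_def
    by (intro order_trans[OF norm_blinfun_compose] mult_mono norm_triangle_ineq contour_resolvent(2)[OF m]) auto
  then show ?thesis by simp
qed

text \<open>The ratio x/(x - norm X) does not increase for x > norm X, so on the contour its worst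
  value is the one at x = d. The bound then has the shape that \<open>multiplier_integral\<close>
  requires.\<close>

lemma divide_dist_le:
  assumes m: "m \<in> contour_set b p" and "0 \<le> k"
  shows "k / (dist_nu m - norm X) \<le> (k * d / (d - norm X)) / dist_nu m"
proof -
  have *: "d \<le> dist_nu m" "norm X < d" "0 < dist_nu m"
    using d_le_dist_nu[OF m] norm_X_less contour_resolvent[OF m] by auto
  have "(d - norm X) * dist_nu m \<le> d * (dist_nu m - norm X)"
    using mult_left_mono[OF *(1), of "norm X"] by (simp add: algebra_simps)
  then have "k * ((d - norm X) * dist_nu m) \<le> k * (d * (dist_nu m - norm X))"
    using \<open>0 \<le> k\<close> by (rule mult_left_mono)
  then show ?thesis using * by (simp add: field_simps)
qed

text \<open>The equation for \<open>X\<close> mentions only the total function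
  \<open>contour_op_integral\<close>. Existence of the integral comes from domination, and
  afterwards the equation identifies its value as \<open>X\<close>.\<close>

lemma X_integral:
  "has_contour_op_integral b p (\<lambda>m. side_mult right (K' m) (Z o\<^sub>L R m)) X"
proof -
  have "\<exists>I. has_contour_op_integral b p (\<lambda>m. side_mult right (K' m) (Z o\<^sub>L R m)) I \<and>
      norm I \<le> (norm At + norm X) * d / (d - norm X) * var"
  proof (rule multiplier_integral)
    show "continuous_on (contour_set b p) (\<lambda>m. Z o\<^sub>L R m)"
      by (intro bounded_bilinear.continuous_on[OF bounded_bilinear_blinfun_compose]
          continuous_on_const continuous_on_resolvent)
    show "0 \<le> (norm At + norm X) * d / (d - norm X)" using norm_X_less dist_pos by simp
    fix m assume m: "m \<in> contour_set b p"
    show "norm (Z o\<^sub>L R m) \<le> (norm At + norm X) * d / (d - norm X) / dist_nu m"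
      by (rule order_trans[OF norm_Z_resolvent_le[OF m] divide_dist_le[OF m]]) simp
  qed
  then obtain I where "has_contour_op_integral b p (\<lambda>m. side_mult right (K' m) (Z o\<^sub>L R m)) I" by blast
  moreover from contour_op_integral_eq[OF this] have "I = X"
    using X_eq unfolding Z_def R_def by simp
  ultimately show ?thesis by simp
qed

text \<open>The multiplier of the factor \<open>W(z) - 1\<close>, estimated by means of \<open>m R(m) = Z R(m) - 1\<close>.\<close>

lemma norm_factor_multiplier_le:
  assumes z: "dist_nu z \<le> radius" and m: "m \<in> contour_set b p"
  shows "norm (scale_op (m / (z - m)) (R m)) \<le> 2 * (d + norm At) / ((1 + var) * (d - norm X)) / dist_nu m"
proof -
  note D = contour_resolvent(3,4)[OF m] d_le_dist_nu[OF m] norm_X_less var_nonneg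
  have "norm (scale_op m (R m)) \<le> norm (Z o\<^sub>L R m) + norm (id_blinfun :: 'a \<Rightarrow>\<^sub>L 'a)"
    unfolding scale_op_resolvent[OF contour_resolvent(1)[OF m]] by (rule norm_triangle_ineq4)
  also have "\<dots> \<le> (norm At + norm X) / (dist_nu m - norm X) + 1"
    by (intro add_mono norm_Z_resolvent_le[OF m] norm_blinfun_id_le)
  also have "\<dots> = (dist_nu m + norm At) / (dist_nu m - norm X)"
    using D by (simp add: field_simps)
  also have "\<dots> \<le> (d + norm At) / (d - norm X)"
  proof -
    \<comment> \<open>This product is the difference of the two sides after clearing denominators:
      the quotient of x + norm At by x - norm X is largest at x = d.\<close>
    have "(dist_nu m - d) * (norm X + norm At) \<ge> 0" using D by simp
    then show ?thesis using D by (simp add: field_simps)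
  qed
  finally have mR: "norm (scale_op m (R m)) \<le> (d + norm At) / (d - norm X)" .
  have low: "0 < dist_nu m * (1 + var) / 2" "dist_nu m * (1 + var) / 2 \<le> cmod (z - m)"
    using D dist_contour_ge[OF z m] by auto
  have "scale_op (m / (z - m)) (R m) = scale_op (1 / (z - m)) (scale_op m (R m))"
    by (simp add: scale_op_scale_op)
  then have "norm (scale_op (m / (z - m)) (R m)) \<le> cmod (1 / (z - m)) * norm (scale_op m (R m))"
    by (simp only: norm_scale_op_le)
  also have "\<dots> \<le> 1 / (dist_nu m * (1 + var) / 2) * ((d + norm At) / (d - norm X))"
  proof (rule mult_mono[OF _ mR])
    have "1 / cmod (z - m) \<le> 1 / (dist_nu m * (1 + var) / 2)"
      using low by (intro frac_le) auto
    then show "cmod (1 / (z - m)) \<le> 1 / (dist_nu m * (1 + var) / 2)" by (simp only: norm_divide norm_one)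
  qed (use low in auto)
  also have "\<dots> = 2 * (d + norm At) / ((1 + var) * (d - norm X)) / dist_nu m"
    by (simp add: divide_simps)
  finally show ?thesis .
qed

lemma factor_constant: "2 * (d + norm At) / ((1 + var) * (d - norm X)) * var < 1"
proof -
  have "1/2 * d * (1 + var) \<le> d - norm X"
    using norm_X unfolding radius_def right_diff_distrib distrib_left by linarith
  then have le: "(1 + var) * (1/2 * d * (1 + var)) \<le> (1 + var) * (d - norm X)"
    using var_nonneg by (intro mult_left_mono) auto
  have "2 * (d + norm At) * var < 2 * d * var + 2 * (1/4 * d * (1 - var)\<^sup>2)"
    using var_norm_less by (simp add: algebra_simps)
  \<comment> \<open>The admissibility condition fits because 4 var + (1 - var)^2 = (1 +
    var)^2.\<close>
  also have "\<dots> = (1 + var) * (1/2 * d * (1 + var))"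
    by (simp add: power2_eq_square algebra_simps)
  also note le
  finally have "2 * (d + norm At) * var < (1 + var) * (d - norm X)" .
  moreover have "0 < (1 + var) * (d - norm X)"
    using norm_X_less var_nonneg by (intro mult_pos_pos) auto
  ultimately show ?thesis by (simp add: pos_divide_less_eq)
qed

lemma transfer_factorization:
  assumes z: "dist_nu z \<le> radius"
  shows "\<exists>W W'. bop W \<and> is_op_inverse W W' \<and>
    transfer_fun At K' b p z = side_mult right W (Z - scalar_op z)"
proof -
  define C where "C = 2 * (d + norm At) / ((1 + var) * (d - norm X))"
  define Q where "Q m = scale_op (m / (z - m)) (R m)" for m
  \<comment> \<open>Contour points have distance at least \<open>d\<close> from the numerical range
    and \<open>z\<close> has distance at most \<open>radius < d\<close>, so z/(z - m) has no pole on
    the contour.\<close>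
  have z_neq: "z \<noteq> m" if "m \<in> contour_set b p" for m
    using d_le_dist_nu[OF that] z radius_less(1) by auto
  have "\<exists>Y. has_contour_op_integral b p (\<lambda>m. side_mult right (K' m) (Q m)) Y \<and> norm Y \<le> C * var"
  proof (rule multiplier_integral)
    show "continuous_on (contour_set b p) Q"
      unfolding Q_def using z_neq
      by (intro bounded_bilinear.continuous_on[OF bounded_bilinear_scale_op] continuous_on_resolvent
          continuous_on_divide continuous_intros) auto
    show "0 \<le> C" using norm_X_less dist_pos var_nonneg by (simp add: C_def)
    show "norm (Q m) \<le> C / dist_nu m" if "m \<in> contour_set b p" for m
      unfolding Q_def C_def by (rule norm_factor_multiplier_le[OF z that])
  qed
  then obtain Y where Y: "has_contour_op_integral b p (\<lambda>m. side_mult right (K' m) (Q m)) Y"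
    and "norm Y \<le> C * var" by blast
  then have "norm Y < 1" using factor_constant by (simp add: C_def)
  have bop_Q: "bop (Q m)" if "m \<in> contour_set b p" for m
    unfolding Q_def using contour_resolvent(1)[OF that] by (intro bop_scale_op) (simp add: is_op_inverse_def)
  have "bop Y"
    by (rule bop_has_contour_op_integral[OF rect Y])
      (auto intro!: bop_side_mult bop_curve bop_ray bop_Q contour_points)
  obtain W' where W': "is_op_inverse (id_blinfun + Y) W'"
    using ex_inverse_id_plus[OF \<open>bop Y\<close> \<open>norm Y < 1\<close>] by blast
  have bop_Zz: "bop (Z - scalar_op z)" by (intro bop_diff bop_Z bop_scalar_op)
  \<comment> \<open>Multiplication by \<open>Z - scalar_op z\<close> may be taken under the integral
    since it commutes with complex scaling; for \<open>right\<close> this rests on the complex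
    linearity of \<open>Z - scalar_op z\<close>.\<close>
  have YZ: "has_contour_op_integral b p
      (\<lambda>m. side_mult right (side_mult right (K' m) (Q m)) (Z - scalar_op z)) (side_mult right Y (Z - scalar_op z))"
    by (rule has_contour_op_integral_linear[OF bounded_bilinear.bounded_linear_left[OF
        bounded_bilinear_side_mult] side_mult_scale_op_left[OF bop_Zz] Y])
  have V: "scale_op (z / (z - m)) (K' m) = side_mult right (K' m) (Z o\<^sub>L R m) +
      side_mult right (side_mult right (K' m) (Q m)) (Z - scalar_op z)"
    if m: "m \<in> contour_set b p" and K: "bop (K' m)" for m
  proof -
    have "side_mult right (K' m) (Z o\<^sub>L R m) + side_mult right (side_mult right (K' m) (Q m)) (Z - scalar_op z) =
        side_mult right (K' m) ((Z o\<^sub>L R m) + side_mult right (Q m) (Z - scalar_op z))"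
      by (simp add: side_mult_assoc bounded_bilinear.add_right[OF bounded_bilinear_side_mult])
    also have "(Z o\<^sub>L R m) + side_mult right (Q m) (Z - scalar_op z) = scale_op (z / (z - m)) id_blinfun"
      unfolding Q_def by (rule resolvent_factor_identity[OF contour_resolvent(1)[OF m] bop_Z z_neq[OF m]])
    also have "side_mult right (K' m) \<dots> = scale_op (z / (z - m)) (K' m)"
      by (rule side_mult_scale_op_id[OF K])
    finally show ?thesis by simp
  qed
  \<comment> \<open>Both summands on the right of \<open>V\<close> have integrals, the first one
    being \<open>X\<close>, so the pointwise identity can be integrated. The starting point of the
    curve, where \<open>K'\<close> is not known to be complex-linear, is skipped by the congruence
    rule.\<close>
  have "has_contour_op_integral b p (\<lambda>m. scale_op (z / (z - m)) (K' m)) (X + side_mult right Y (Z - scalar_op z))"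
    by (rule has_contour_op_integral_cong[OF rect has_contour_op_integral_add[OF X_integral YZ]])
      (auto intro!: V contour_points bop_curve bop_ray)
  then have "V_fun K' b p z = X + side_mult right Y (Z - scalar_op z)"
    unfolding V_fun_def by (rule contour_op_integral_eq)
  \<comment> \<open>The terms \<open>At - scalar_op z\<close> and \<open>X\<close> combine to
    \<open>Z - scalar_op z\<close>, which supplies the identity in the factor 1 + Y.\<close>
  then have "transfer_fun At K' b p z = side_mult right (id_blinfun + Y) (Z - scalar_op z)"
    by (simp add: transfer_fun_def Z_def bounded_bilinear.add_left[OF bounded_bilinear_side_mult])
  moreover have "bop (id_blinfun + Y)" using \<open>bop Y\<close> by (intro bop_add bop_id)
  ultimately show ?thesis using W' by blast
qed

text \<open>The factorization compares invertibility inside \<open>O_set\<close> only. This captures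
  all of \<open>op_spectrum Z\<close>, whose points have distance at most
  \<open>norm X \<le> radius\<close> from the numerical range.\<close>

theorem transfer_spectrum_eq: "transfer_spectrum At K' b p \<inter> O_set At K' b p = op_spectrum Z"
proof -
  have "z \<in> transfer_spectrum At K' b p \<longleftrightarrow> z \<in> op_spectrum Z" if z: "dist_nu z \<le> radius" for z
  proof -
    have "z \<notin> contour_set b p" using d_le_dist_nu[of z] z radius_less(1) by auto
    moreover obtain W W' where "bop W" "is_op_inverse W W'"
      "transfer_fun At K' b p z = side_mult right W (Z - scalar_op z)"
      using transfer_factorization[OF z] by blast
    ultimately show ?thesis
      using ex_inverse_side_mult_iff[of W W' right "Z - scalar_op z"]
      unfolding transfer_spectrum_def op_spectrum_def mem_Collect_eq by (simp only:) simp
  qed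
  moreover have "dist_nu z \<le> radius" if "z \<in> op_spectrum Z" for z
    using op_spectrum_dist[OF that] norm_X by simp
  ultimately show ?thesis unfolding O_set_eq by blast
qed

end

section \<open>From the kernel data to the spectra of both solutions\<close>

lemma admissible_contour_if_admissible:
  assumes kernel: "kernel_data lamC b D Kr Kc c g" and "lamC < b"
    and At: "bop At" and Kr: "\<And>m. bop (Kr m)" and l: "l \<in> {1, -1}"
    and adm: "admissible At (kernel_deriv Kr Kc) lamC b D l p"
  shows "admissible_contour At (kernel_deriv Kr Kc) b p"
proof -
  interpret kernel_data lamC b D Kr Kc c g by (rule kernel)
  note adm' = adm[unfolded admissible_def deformed_curve_def]
  have p: "continuous_on {0<..<1} p"
    using adm' by (auto simp: rectifiable_def path_def intro: continuous_on_subset)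
  \<comment> \<open>The open curve avoids the real axis, so there \<open>kernel_deriv\<close> is the
    derivative of the analytic continuation; on the ray it is the derivative of the real kernel. The
    two clauses are treated separately.\<close>
  have curve: "p t \<in> D" "Im (p t) \<noteq> 0" if "0 < t" "t < 1" for t
  proof -
    have "p ` {0<..<1} \<subseteq> D \<inter> {z. 0 < of_int l * Im z}" using adm' by blast
    moreover have "p t \<in> p ` {0<..<1}" using that by simp
    ultimately have "p t \<in> D \<inter> {z. 0 < of_int l * Im z}" by (rule subsetD)
    then show "p t \<in> D" "Im (p t) \<noteq> 0" using l by auto
  qed
  then have K_curve: "kernel_deriv Kr Kc (p t) = op_deriv Kc (p t)" if "0 < t" "t < 1" for t
    using that by (simp add: kernel_deriv_def)
  have K_ray: "kernel_deriv Kr Kc (complex_of_real m) = vector_derivative Kr (at m)" for m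
    by (simp add: kernel_deriv_def)
  show ?thesis
  proof
    have "continuous_on {0<..<1} (\<lambda>t. op_deriv Kc (p t))"
      using curve by (intro continuous_on_compose2[OF continuous_on_op_deriv[OF open_\<D> Kc_analytic] p]) auto
    then show "continuous_on {0<..<1} (\<lambda>t. kernel_deriv Kr Kc (p t))"
      by (rule continuous_on_eq) (simp add: K_curve)
    have "continuous_on {lamC<..} (\<lambda>m. vector_derivative Kr (at m))"
      using Kr_C1 unfolding C1_differentiable_on_eq by blast
    then show "continuous_on {b..} (\<lambda>m. kernel_deriv Kr Kc (complex_of_real m))"
      unfolding K_ray by (rule continuous_on_subset) (use \<open>lamC < b\<close> in auto)
    show "bop (kernel_deriv Kr Kc (p t))" if t: "0 < t" "t < 1" for t
    proof -
      obtain L where L: "has_op_derivative Kc L (p t)" using Kc_analytic curve(1)[OF t] by blast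
      then have "bop L" by (rule bop_if_has_op_derivative[OF _ open_\<D> curve(1)[OF t] Kc_bop])
      then show ?thesis using K_curve[OF t] op_deriv_eq[OF L] by simp
    qed
    show "bop (kernel_deriv Kr Kc (complex_of_real m))" if "b \<le> m" for m
    proof -
      have "(Kr has_vector_derivative vector_derivative Kr (at m)) (at m)"
        using Kr_C1 that \<open>lamC < b\<close> unfolding C1_differentiable_on_eq
        by (auto simp: vector_derivative_works)
      then show ?thesis unfolding K_ray by (rule bop_vector_derivative[OF _ Kr])
    qed
  qed (use At adm' in auto)
qed

text \<open>The real infimum lies below its members only if the set is bounded below. The bound 0
  must hold for \<open>r_min\<close> of every admissible contour, hence the universally quantified
  assumption.\<close>

lemma r_zero_le_radius:
  assumes adm: "\<forall>p. admissible At K' lamC b D l p \<longrightarrow> admissible_contour At K' b p"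
    and p: "admissible At K' lamC b D l p"
  shows "r_zero At K' lamC b D l \<le> admissible_contour.radius At K' b p"
proof -
  have "r_zero At K' lamC b D l \<le> r_min At K' b p"
    unfolding r_zero_def
  proof (rule cInf_lower)
    show "r_min At K' b p \<in> {r_min At K' b p |p. admissible At K' lamC b D l p}" using p by blast
    show "bdd_below {r_min At K' b p |p. admissible At K' lamC b D l p}"
      using admissible_contour.r_min_bounds(1)[OF adm[rule_format]] by (intro bdd_belowI[of _ 0]) blast
  qed
  also have "\<dots> \<le> admissible_contour.radius At K' b p"
    by (rule admissible_contour.r_min_bounds(2)[OF adm[rule_format, OF p]])
  finally show ?thesis .
qed

text \<open>With \<open>V\<close> abstract, one argument serves both transformations. As
  \<open>X\<close> solves the equation on every admissible contour, \<open>p\<close> may vary while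
  \<open>At + X\<close> stays fixed. The inclusion uses the bound of \<open>norm X\<close> by the
  infimum, which is sharper than the radius of a single contour.\<close>

lemma common_solution_spectrum:
  assumes adm: "\<forall>p. admissible At K' lamC b D l p \<longrightarrow> admissible_contour At K' b p"
    and X: "common_solution V At K' lamC b D l X"
    and V: "\<And>p Z. V K' b p Z = contour_op_integral b p
      (\<lambda>m. side_mult right (K' m) (Z o\<^sub>L op_inverse (Z - scalar_op m)))"
    and p: "admissible At K' lamC b D l p"
  shows "transfer_spectrum At K' b p \<inter> O_set At K' b p = op_spectrum (At + X)"
    and "op_spectrum (At + X) \<subseteq> {z. infdist z (numrange At) \<le> r_zero At K' lamC b D l}"
proof -
  interpret admissible_contour At K' b p by (rule adm[rule_format, OF p])
  note X' = X[unfolded common_solution_def]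
  interpret contour_solution At K' b p X right
  proof
    show "norm X \<le> radius" using X' r_zero_le_radius[OF adm p] by linarith
    show "X = contour_op_integral b p (\<lambda>m. side_mult right (K' m)
      ((At + X) o\<^sub>L op_inverse (At + X - scalar_op m)))"
      using X' p V by metis
  qed (use X' in blast)
  show "transfer_spectrum At K' b p \<inter> O_set At K' b p = op_spectrum (At + X)"
    using transfer_spectrum_eq by (simp add: Z_def)
  show "op_spectrum (At + X) \<subseteq> {z. infdist z (numrange At) \<le> r_zero At K' lamC b D l}"
    using op_spectrum_dist X' unfolding Z_def by (blast intro: order_trans)
qed

theorem corollary4p2:
  fixes domC :: "'c::{complex_hilbert, second_countable_topology} set" and C :: "'c \<Rightarrow> 'c"
    and lamC :: real and E :: "real \<Rightarrow> 'c \<Rightarrow>\<^sub>L 'c" and Cmh :: "'c \<Rightarrow>\<^sub>L 'c"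
    and A At :: "'a::{complex_hilbert, second_countable_topology} \<Rightarrow>\<^sub>L 'a"
    and domD :: "'a set" and D :: "'a \<Rightarrow> 'c" and Dt :: "'a \<Rightarrow>\<^sub>L 'c"
    and domB :: "'c set" and B :: "'c \<Rightarrow> 'a" and Bt :: "'c \<Rightarrow>\<^sub>L 'a"
    and \<alpha>1 \<alpha>2 \<eta> \<beta> c \<gamma> :: real and \<D> :: "complex set"
    and Kr :: "real \<Rightarrow> 'a \<Rightarrow>\<^sub>L 'a" and Kc K' :: "complex \<Rightarrow> 'a \<Rightarrow>\<^sub>L 'a"
    and l :: int and X_right X_left Z_right Z_left :: "'a \<Rightarrow>\<^sub>L 'a"
  assumes "operator_data domC C lamC E Cmh A domD D Dt domB B Bt"
    and "At = A - (Bt o\<^sub>L Dt)"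
    and "\<eta> > 0" and "\<alpha>1 < \<alpha>2" and "\<alpha>1 - \<eta> > lamC"
    and "numrange At \<subseteq> {z. infdist z (complex_of_real ` {\<alpha>1..\<alpha>2}) \<le> \<eta>}"
    and "\<beta> > \<alpha>2 + \<eta>"
    and "{z. infdist z (complex_of_real ` {\<alpha>1..\<alpha>2}) \<le> \<eta>} \<subseteq> \<D>"
    and "Kr = spectral_kernel Bt E Dt"
    and "kernel_data lamC \<beta> \<D> Kr Kc c \<gamma>"
    and "K' = kernel_deriv Kr Kc"
    and "\<exists>p. admissible At K' lamC \<beta> \<D> 1 p"
    and "\<exists>p. admissible At K' lamC \<beta> \<D> (-1) p"
    and "l \<in> {1, -1}"
    and "common_solution V_right At K' lamC \<beta> \<D> l X_right"
    and "common_solution V_left At K' lamC \<beta> \<D> l X_left"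
    and "Z_right = At + X_right"
    and "Z_left = At + X_left"
  shows "op_spectrum Z_right = op_spectrum Z_left \<and>
    op_spectrum Z_right \<subseteq> {z. infdist z (numrange At) \<le> r_zero At K' lamC \<beta> \<D> l} \<and>
    (\<forall>p. admissible At K' lamC \<beta> \<D> l p \<longrightarrow>
      transfer_spectrum At K' \<beta> p \<inter> O_set At K' \<beta> p = op_spectrum Z_right \<and>
      transfer_spectrum At K' \<beta> p \<inter> O_set At K' \<beta> p = op_spectrum Z_left)"
proof -
  interpret operator_data domC C lamC E Cmh A domD D Dt domB B Bt by (rule assms(1))
  have bop_At: "bop At"
    unfolding assms(2) by (intro bop_diff bop_compose A_bop Bt_bop Dt_bop)
  have bop_Kr: "bop (Kr m)" for m
    using E_family unfolding assms(9) spectral_kernel_def spectral_family_def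
    by (intro bop_compose Bt_bop Dt_bop) blast
  have "lamC < \<beta>" using assms(3-5,7) by linarith
  then have adm: "\<forall>p. admissible At K' lamC \<beta> \<D> l p \<longrightarrow> admissible_contour At K' \<beta> p"
    using admissible_contour_if_admissible[OF assms(10) _ bop_At bop_Kr assms(14)]
    unfolding assms(11) by blast
  have V_r: "V_right K' \<beta> p Z = contour_op_integral \<beta> p
      (\<lambda>m. side_mult True (K' m) (Z o\<^sub>L op_inverse (Z - scalar_op m)))" for p Z
    by (simp add: V_right_def side_mult_def blinfun_compose_assoc')
  have V_l: "V_left K' \<beta> p Z = contour_op_integral \<beta> p
      (\<lambda>m. side_mult False (K' m) (Z o\<^sub>L op_inverse (Z - scalar_op m)))" for p Z
    by (simp add: V_left_def side_mult_def)
  note right = common_solution_spectrum[OF adm assms(15) V_r, folded assms(17)]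
  note left = common_solution_spectrum[OF adm assms(16) V_l, folded assms(18)]
  obtain q where q: "admissible At K' lamC \<beta> \<D> l q" using assms(12-14) by auto
  \<comment> \<open>On one contour both spectra equal the same part of the spectrum of the transfer
    function, which does not refer to either side.\<close>
  have "op_spectrum Z_right = op_spectrum Z_left" using right(1)[OF q] left(1)[OF q] by simp
  then show ?thesis using right(1) right(2)[OF q] left(1) by blast
qed

end
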